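(* Let $M>0$ and let $\varphi\in W^{1,2}(\mathbb{R}^3)$ with $\|\varphi\|_{W^{1,2}}\le M$ be fixed. Then there is $T_M>0$ such that the frictional Newton-Schrödinger problem $$i\frac{\partial\psi}{\partial t}=-\frac{\hbar}{2m}\Delta\psi+i\,4\pi\frac{Gm^2}{\hbar}\,g_1(\psi)-i\,4\pi\frac{Gm^2}{\hbar}\,g_2(\psi),\qquad \psi(0)=\varphi,$$ has a (weak) solution $\psi\in L^\infty([-T_M,T_M],W^{1,2})$.
   Context: $W^{1,2}=W^{1,2}(\mathbb{R}^3)$ is the Sobolev space of complex-valued functions with $\|\psi\|_{W^{1,2}}^2=\int|\nabla\psi|^2\,dx+\int|\psi|^2\,dx$, and $W^{-1,2}$ is its dual. The constants $\hbar,m,G$ are positive. For $\psi\in W^{1,2}$, $$g_1(\psi)=\psi\int_{\mathbb{R}^3}\frac{|\psi(y)|^2}{|\cdot-y|}\,dy,\qquad g_2(\psi)=\psi\int_{\mathbb{R}^3}\int_{\mathbb{R}^3}\frac{|\psi(y)|^2|\psi(z)|^2}{|z-y|}\,dy\,dz,$$ both regarded as elements of $W^{-1,2}$. A weak solution on an interval $I\ni 0$ is a function $\psi\in L^\infty(I,W^{1,2})\cap W^{1,\infty}(I,W^{-1,2})$ that satisfies the equation in $W^{-1,2}$ for a.e. $t\in I$ and $\psi(0)=\varphi$ (this makes sense because such $\psi$ lies in $C(I,L^2(\mathbb{R}^3))$). *)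

theory Defs
  imports "HOL-Analysis.Analysis"
begin

primrec C_k :: "nat \<Rightarrow> ('a::real_normed_vector \<Rightarrow> 'b::real_normed_vector) \<Rightarrow> bool" where
  "C_k 0 f \<longleftrightarrow> continuous_on UNIV f"
| "C_k (Suc k) f \<longleftrightarrow>
     (\<exists>f'. (\<forall>x. (f has_derivative f' x) (at x)) \<and> (\<forall>v. C_k k (\<lambda>x. f' x v)))"

definition test_functions :: "'a::euclidean_space set \<Rightarrow> ('a \<Rightarrow> 'b::real_normed_vector) set" where
  "test_functions \<Omega> = {\<eta>. (\<forall>k. C_k k \<eta>) \<and>
      compact (closure {x. \<eta> x \<noteq> 0}) \<and> closure {x. \<eta> x \<noteq> 0} \<subseteq> \<Omega>}"

text \<open>
  Elements of the function spaces are represented by functions rather than by classes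
  modulo null sets, so the ``norms'' below are seminorms and equality of elements means
  that the difference has norm zero. Every class has a Borel representative.
\<close>

definition L2 :: "(real^3 \<Rightarrow> complex) set" where
  "L2 = {f \<in> borel_measurable lborel. integrable lborel (\<lambda>x. (cmod (f x))\<^sup>2)}"

definition norm_L2 :: "(real^3 \<Rightarrow> complex) \<Rightarrow> real" where
  "norm_L2 f = sqrt (LINT x|lborel. (cmod (f x))\<^sup>2)"

definition has_weak_gradient :: "(real^3 \<Rightarrow> complex) \<Rightarrow> (real^3 \<Rightarrow> complex^3) \<Rightarrow> bool" where
  "has_weak_gradient f g \<longleftrightarrow> f \<in> L2 \<and> (\<forall>j. (\<lambda>x. g x $ j) \<in> L2) \<and>
     (\<forall>\<eta>\<in>test_functions UNIV. \<forall>j.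
        (LINT x|lborel. f x * frechet_derivative \<eta> (at x) (axis j 1)) =
        - (LINT x|lborel. g x $ j * \<eta> x))"

definition W12 :: "(real^3 \<Rightarrow> complex) set" where
  "W12 = {f. \<exists>g. has_weak_gradient f g}"

text \<open>The weak gradient is determined up to a null set; any choice gives the same integrals.\<close>

definition weak_gradient :: "(real^3 \<Rightarrow> complex) \<Rightarrow> real^3 \<Rightarrow> complex^3" where
  "weak_gradient f = (SOME g. has_weak_gradient f g)"

definition norm_W12 :: "(real^3 \<Rightarrow> complex) \<Rightarrow> real" where
  "norm_W12 f = sqrt ((LINT x|lborel. (norm (weak_gradient f x))\<^sup>2) +
                      (LINT x|lborel. (cmod (f x))\<^sup>2))"

text \<open>
  The dual consists of the bounded complex-linear functionals on \<open>W12\<close>; two functionals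
  are identified if they agree on \<open>W12\<close> (values elsewhere are meaningless).
\<close>

definition W12_dual :: "((real^3 \<Rightarrow> complex) \<Rightarrow> complex) set" where
  "W12_dual = {F.
     (\<forall>u\<in>W12. \<forall>v\<in>W12. F (\<lambda>x. u x + v x) = F u + F v) \<and>
     (\<forall>c. \<forall>u\<in>W12. F (\<lambda>x. c * u x) = c * F u) \<and>
     (\<exists>C. \<forall>u\<in>W12. cmod (F u) \<le> C * norm_W12 u)}"

definition norm_W12_dual :: "((real^3 \<Rightarrow> complex) \<Rightarrow> complex) \<Rightarrow> real" where
  "norm_W12_dual F = (SUP v \<in> {v \<in> W12. norm_W12 v \<le> 1}. cmod (F v))"

text \<open>
  Functions and distributional Laplacians as elements of the dual, with the bilinear
  pairing of distribution theory (no complex conjugation).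
\<close>

definition as_dual :: "(real^3 \<Rightarrow> complex) \<Rightarrow> (real^3 \<Rightarrow> complex) \<Rightarrow> complex" where
  "as_dual f v = (LINT x|lborel. f x * v x)"

definition laplacian :: "(real^3 \<Rightarrow> complex) \<Rightarrow> (real^3 \<Rightarrow> complex) \<Rightarrow> complex" where
  "laplacian f v =
     - (LINT x|lborel. (\<Sum>j\<in>UNIV. weak_gradient f x $ j * weak_gradient v x $ j))"

text \<open>
  The library's Bochner integral requires the values to form a normed vector type. The following
  is its analogue for a carrier \<open>X\<close> of complex-valued functions (pointwise operations)
  with seminorm \<open>N\<close>; it is used for both \<open>W12\<close> and \<open>W12_dual\<close>.
\<close>

definition simple_on :: "real set \<Rightarrow> ('p \<Rightarrow> complex) set \<Rightarrow> (real \<Rightarrow> 'p \<Rightarrow> complex) \<Rightarrow> bool" where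
  "simple_on I X s \<longleftrightarrow> finite (s ` I) \<and> s ` I \<subseteq> X \<and>
     (\<forall>y. {t\<in>I. s t = y} \<in> sets lborel) \<and>
     emeasure lborel {t\<in>I. s t \<noteq> (\<lambda>_. 0)} < \<infinity>"

definition simple_integral_on :: "real set \<Rightarrow> (real \<Rightarrow> 'p \<Rightarrow> complex) \<Rightarrow> 'p \<Rightarrow> complex" where
  "simple_integral_on I s = (\<lambda>p. \<Sum>y\<in>s ` I. of_real (measure lborel {t\<in>I. s t = y}) * y p)"

definition strongly_measurable_on ::
    "real set \<Rightarrow> ('p \<Rightarrow> complex) set \<Rightarrow> (('p \<Rightarrow> complex) \<Rightarrow> real) \<Rightarrow> (real \<Rightarrow> 'p \<Rightarrow> complex) \<Rightarrow> bool" where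
  "strongly_measurable_on I X N u \<longleftrightarrow>
     (AE t in lborel. t \<in> I \<longrightarrow> u t \<in> X) \<and>
     (\<exists>s. (\<forall>n. simple_on I X (s n)) \<and>
          (AE t in lborel. t \<in> I \<longrightarrow> (\<lambda>n. N (\<lambda>p. s n t p - u t p)) \<longlonglongrightarrow> 0))"

definition has_bochner_integral_on ::
    "real set \<Rightarrow> ('p \<Rightarrow> complex) set \<Rightarrow> (('p \<Rightarrow> complex) \<Rightarrow> real) \<Rightarrow>
     (real \<Rightarrow> 'p \<Rightarrow> complex) \<Rightarrow> ('p \<Rightarrow> complex) \<Rightarrow> bool" where
  "has_bochner_integral_on I X N f y \<longleftrightarrow>
     strongly_measurable_on I X N f \<and> y \<in> X \<and>
     (\<exists>s. (\<forall>n. simple_on I X (s n)) \<and>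
          (\<lambda>n. \<integral>\<^sup>+ t\<in>I. ennreal (N (\<lambda>p. f t p - s n t p)) \<partial>lborel) \<longlonglongrightarrow> 0 \<and>
          (\<lambda>n. N (\<lambda>p. simple_integral_on I (s n) p - y p)) \<longlonglongrightarrow> 0)"

definition Linf_on ::
    "real set \<Rightarrow> ('p \<Rightarrow> complex) set \<Rightarrow> (('p \<Rightarrow> complex) \<Rightarrow> real) \<Rightarrow> (real \<Rightarrow> 'p \<Rightarrow> complex) set" where
  "Linf_on I X N = {u. strongly_measurable_on I X N u \<and>
     (\<exists>C. AE t in lborel. t \<in> I \<longrightarrow> N (u t) \<le> C)}"

definition has_weak_time_derivative ::
    "real set \<Rightarrow> ('p \<Rightarrow> complex) set \<Rightarrow> (('p \<Rightarrow> complex) \<Rightarrow> real) \<Rightarrow>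
     (real \<Rightarrow> 'p \<Rightarrow> complex) \<Rightarrow> (real \<Rightarrow> 'p \<Rightarrow> complex) \<Rightarrow> bool" where
  "has_weak_time_derivative I X N u u' \<longleftrightarrow>
     (\<forall>\<eta>\<in>test_functions (interior I). \<exists>y.
        has_bochner_integral_on I X N (\<lambda>t p. of_real (deriv \<eta> t) * u t p) y \<and>
        has_bochner_integral_on I X N (\<lambda>t p. - (of_real (\<eta> t) * u' t p)) y)"

text \<open>\<open>W1inf_on I X N u u'\<close>: \<open>u\<close> lies in \<open>W\<^sup>1\<^sup>,\<^sup>\<infinity>(I, X)\<close> and \<open>u'\<close> is its derivative.\<close>

definition W1inf_on ::
    "real set \<Rightarrow> ('p \<Rightarrow> complex) set \<Rightarrow> (('p \<Rightarrow> complex) \<Rightarrow> real) \<Rightarrow>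
     (real \<Rightarrow> 'p \<Rightarrow> complex) \<Rightarrow> (real \<Rightarrow> 'p \<Rightarrow> complex) \<Rightarrow> bool" where
  "W1inf_on I X N u u' \<longleftrightarrow>
     u \<in> Linf_on I X N \<and> u' \<in> Linf_on I X N \<and> has_weak_time_derivative I X N u u'"

text \<open>
  An element of \<open>L\<^sup>\<infinity>(I, W\<^sup>1\<^sup>,\<^sup>2)\<close> is only defined for almost every time; its value at a point is
  that of its \<open>L\<^sup>2\<close>-continuous representative.
\<close>

definition has_value_at ::
    "real set \<Rightarrow> (real \<Rightarrow> real^3 \<Rightarrow> complex) \<Rightarrow> real \<Rightarrow> (real^3 \<Rightarrow> complex) \<Rightarrow> bool" where
  "has_value_at I \<psi> t0 \<phi> \<longleftrightarrow>
     (\<exists>w. (\<forall>t\<in>I. w t \<in> L2) \<and>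
          (\<forall>t\<in>I. ((\<lambda>s. norm_L2 (\<lambda>x. w s x - w t x)) \<longlongrightarrow> 0) (at t within I)) \<and>
          (AE t in lborel. t \<in> I \<longrightarrow> (AE x in lborel. w t x = \<psi> t x)) \<and>
          (AE x in lborel. w t0 x = \<phi> x))"

text \<open>
  For \<open>\<psi> \<in> W12\<close> these integrals converge (Hardy), so that \<open>g1 \<psi>\<close> and \<open>g2 \<psi>\<close> lie in \<open>L2\<close>.
\<close>

definition g1 :: "(real^3 \<Rightarrow> complex) \<Rightarrow> real^3 \<Rightarrow> complex" where
  "g1 \<psi> x = \<psi> x * of_real (LINT y|lborel. (cmod (\<psi> y))\<^sup>2 / norm (x - y))"

definition g2 :: "(real^3 \<Rightarrow> complex) \<Rightarrow> real^3 \<Rightarrow> complex" where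
  "g2 \<psi> x = \<psi> x * of_real (LINT z|lborel. (LINT y|lborel.
                (cmod (\<psi> y))\<^sup>2 * (cmod (\<psi> z))\<^sup>2 / norm (z - y)))"

definition weak_solution ::
    "real \<Rightarrow> real \<Rightarrow> real \<Rightarrow> real set \<Rightarrow> (real^3 \<Rightarrow> complex) \<Rightarrow> (real \<Rightarrow> real^3 \<Rightarrow> complex) \<Rightarrow> bool" where
  "weak_solution hbar m G I \<phi> \<psi> \<longleftrightarrow>
     \<psi> \<in> Linf_on I W12 norm_W12 \<and>
     (\<exists>\<psi>'. W1inf_on I W12_dual norm_W12_dual (\<lambda>t. as_dual (\<psi> t)) \<psi>' \<and>
        (AE t in lborel. t \<in> I \<longrightarrow> (\<forall>v\<in>W12.
           \<i> * \<psi>' t v =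
             - of_real (hbar / (2 * m)) * laplacian (\<psi> t) v
             + \<i> * of_real (4 * pi * (G * m\<^sup>2 / hbar)) * as_dual (g1 (\<psi> t)) v
             - \<i> * of_real (4 * pi * (G * m\<^sup>2 / hbar)) * as_dual (g2 (\<psi> t)) v))) \<and>
     has_value_at I \<psi> 0 \<phi>"

end

theory Submission
  imports Defs "HOL-Computational_Algebra.Polynomial"
begin

text \<open>
  Write \<open>a = hbar / (2 m)\<close>. The group \<open>exp (i a t Laplace)\<close> is the strong limit of the exponentials of
  \<open>i a\<close> times second-order difference Laplacians: these are bounded, skew and commute with each
  other, and they converge on test functions, which are dense in \<open>L\<^sup>2\<close>. As everything commutes with
  translations, the group acts isometrically on the pairs \<open>(f, grad f)\<close>, a closed subspace of
  \<open>L\<^sup>2 \<times> (L\<^sup>2)\<^sup>3\<close> whose norm is that of \<open>W\<^sup>1\<^sup>,\<^sup>2\<close>. By Hardy's inequality and Cauchy-Schwarz the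
  potential of \<open>f\<^sub>1 cnj f\<^sub>2\<close> is bounded as soon as one of the factors lies in \<open>W\<^sup>1\<^sup>,\<^sup>2\<close>; hence
  \<open>g1\<close> and \<open>g2\<close> are locally Lipschitz maps of \<open>W\<^sup>1\<^sup>,\<^sup>2\<close> into itself. Undoing the free evolution
  turns the equation into an ordinary differential equation in \<open>W\<^sup>1\<^sup>,\<^sup>2\<close>, to which Picard's theorem
  applies on a time interval depending only on the size of the initial value. The solution is norm
  continuous in time, so all Bochner integrals reduce to Riemann sums, and its weak time derivative
  is found by testing with a fixed \<open>v\<close> in \<open>W\<^sup>1\<^sup>,\<^sup>2\<close> and integrating by parts.
\<close>

section \<open>The Hilbert space of square-integrable functions\<close>

text \<open>The Laplacian of a function in \<open>W12\<close> is only a functional, so the equation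
  is not an identity in L2. This dictates the shape of the proof: limits that involve the Laplacian
  of the solution are taken after pairing with a fixed \<open>v\<close>, one gradient on each side,
  while everything else happens in norm. Weak derivatives are characterised as L2-limits of
  difference quotients (\<open>gen_iff_weak\<close>). Operators commuting with translations then
  preserve weak gradients at once, summation by parts is an algebraic identity, and the product rule
  for the nonlocal term is the limit of a three-term difference identity. Both nonlinear terms come
  from one map \<open>tau\<close> that is real-linear in each slot: \<open>g1\<close> is
  \<open>tau u u u\<close>, and \<open>g2\<close> is \<open>u\<close> times the real number
  \<open>inner (tau u u u) u\<close>. Two pairings coexist. The real inner product measures norms
  and skewness. The bilinear \<open>pair\<close> matches the dual of the definitions; for it the
  free group is symmetric, so that it can be moved onto the test function.\<close>

lemma L2_measurable [measurable_dest]: "f \<in> L2 \<Longrightarrow> f \<in> borel_measurable borel"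
  by (simp add: L2_def)

lemma L2_integrable: "f \<in> L2 \<Longrightarrow> integrable lborel (\<lambda>x. (cmod (f x))\<^sup>2)"
  by (simp add: L2_def)

lemma L2_I: "f \<in> borel_measurable borel \<Longrightarrow> integrable lborel (\<lambda>x. (cmod (f x))\<^sup>2) \<Longrightarrow> f \<in> L2"
  by (simp add: L2_def)

lemma L2_dominated:
  assumes "f \<in> borel_measurable borel" "g \<in> L2" "AE x in lborel. cmod (f x) \<le> cmod (g x)"
  shows "f \<in> L2"
proof (rule L2_I)
  show "integrable lborel (\<lambda>x. (cmod (f x))\<^sup>2)"
    by (rule Bochner_Integration.integrable_bound[OF L2_integrable[OF assms(2)]])
       (use assms in \<open>auto elim!: eventually_mono\<close>)
qed (use assms in auto)

lemma L2_AE: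
  assumes "f \<in> borel_measurable borel" "g \<in> L2" "AE x in lborel. f x = g x"
  shows "f \<in> L2"
  using assms by (intro L2_dominated[OF assms(1,2)]) (auto elim!: eventually_mono)

lemma L2_zero [simp]: "(\<lambda>_. 0) \<in> L2"
  by (simp add: L2_def)

lemma L2_cmul: "f \<in> L2 \<Longrightarrow> (\<lambda>x. c * f x) \<in> L2"
  by (rule L2_I) (auto simp: norm_mult power_mult_distrib L2_integrable dest: L2_measurable)

lemma L2_uminus: "f \<in> L2 \<Longrightarrow> (\<lambda>x. - f x) \<in> L2"
  by (simp add: L2_def)

lemma L2_cnj: "f \<in> L2 \<Longrightarrow> (\<lambda>x. cnj (f x)) \<in> L2"
  by (simp add: L2_def borel_measurable_continuous_on[OF continuous_on_cnj[OF continuous_on_id]])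

lemma norm_add_sq_le: "(norm (a + b))\<^sup>2 \<le> 2 * (norm a)\<^sup>2 + 2 * (norm (b::'a::real_normed_vector))\<^sup>2"
proof -
  have "(norm (a + b))\<^sup>2 \<le> (norm a + norm b)\<^sup>2"
    by (rule power_mono[OF norm_triangle_ineq]) simp
  also have "\<dots> \<le> 2 * (norm a)\<^sup>2 + 2 * (norm b)\<^sup>2"
    using sum_squares_bound[of "norm a" "norm b"] by (simp add: power2_sum)
  finally show ?thesis .
qed

lemma L2_add: assumes "f \<in> L2" "g \<in> L2" shows "(\<lambda>x. f x + g x) \<in> L2"
proof (rule L2_I)
  show "integrable lborel (\<lambda>x. (cmod (f x + g x))\<^sup>2)"
  proof (rule Bochner_Integration.integrable_bound)
    show "integrable lborel (\<lambda>x. 2 * (cmod (f x))\<^sup>2 + 2 * (cmod (g x))\<^sup>2)"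
      using assms by (simp add: L2_integrable)
  qed (use assms in \<open>auto simp: norm_add_sq_le dest: L2_measurable\<close>)
qed (use assms in \<open>auto dest: L2_measurable\<close>)

lemma L2_diff: "f \<in> L2 \<Longrightarrow> g \<in> L2 \<Longrightarrow> (\<lambda>x. f x - g x) \<in> L2"
  using L2_add[of f "\<lambda>x. - g x"] L2_uminus[of g] by simp

lemma L2_norm: "f \<in> L2 \<Longrightarrow> (\<lambda>x. complex_of_real (cmod (f x))) \<in> L2"
  by (rule L2_I) (auto simp: L2_integrable dest: L2_measurable)

lemma L2_mult_integrable:
  assumes "f \<in> L2" "g \<in> L2" shows "integrable lborel (\<lambda>x. f x * g x)"
proof (rule Bochner_Integration.integrable_bound)
  show "integrable lborel (\<lambda>x. (cmod (f x))\<^sup>2 + (cmod (g x))\<^sup>2)"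
    using assms by (simp add: L2_integrable)
  have "cmod (f x * g x) \<le> (cmod (f x))\<^sup>2 + (cmod (g x))\<^sup>2" for x
  proof -
    have "2 * (cmod (f x) * cmod (g x)) \<le> (cmod (f x))\<^sup>2 + (cmod (g x))\<^sup>2"
      using sum_squares_bound[of "cmod (f x)" "cmod (g x)"] by simp
    moreover have "0 \<le> cmod (f x) * cmod (g x)" by simp
    ultimately show ?thesis by (simp only: norm_mult)
  qed
  then show "AE x in lborel. norm (f x * g x) \<le> norm ((cmod (f x))\<^sup>2 + (cmod (g x))\<^sup>2)"
    by (intro AE_I2) (simp add: abs_of_nonneg)
qed (use assms in \<open>auto dest: L2_measurable\<close>)

\<comment> \<open>The given definitions speak of representatives. Passing to classes modulo null
  sets turns L2 into a type, so that the type classes of inner product and Banach spaces, with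
  everything proved for them, apply. The relation is partial: functions outside \<open>L2\<close>
  belong to no class.\<close>
quotient_type l2 = "real^3 \<Rightarrow> complex" / partial: "\<lambda>f g. f \<in> L2 \<and> g \<in> L2 \<and> (AE x in lborel. f x = g x)"
proof (rule part_equivpI)
  show "\<exists>x. x \<in> L2 \<and> x \<in> L2 \<and> (AE xa in lborel. x xa = x xa)"
    by (rule exI[of _ "\<lambda>_. 0"]) simp
  show "symp (\<lambda>f g. f \<in> L2 \<and> g \<in> L2 \<and> (AE x in lborel. f x = g x))"
    by (auto simp: symp_def elim: eventually_mono)
  show "transp (\<lambda>f g. f \<in> L2 \<and> g \<in> L2 \<and> (AE x in lborel. f x = g x))"
    by (auto simp: transp_def elim: eventually_elim2)
qed

lemma rep_in_L2 [simp]: "rep_l2 a \<in> L2"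
  using Quotient_rep_reflp[OF Quotient_l2, of a] by blast

lemma rep_measurable [measurable, simp]: "rep_l2 a \<in> borel_measurable borel"
  by (rule L2_measurable) simp

lemma abs_rep [simp]: "abs_l2 (rep_l2 a) = a"
  by (rule Quotient_abs_rep[OF Quotient_l2])

lemma rep_abs: "f \<in> L2 \<Longrightarrow> AE x in lborel. rep_l2 (abs_l2 f) x = f x"
  using Quotient_rep_abs[OF Quotient_l2, of f] by simp

lemma abs_eqI: "f \<in> L2 \<Longrightarrow> g \<in> L2 \<Longrightarrow> AE x in lborel. f x = g x \<Longrightarrow> abs_l2 f = abs_l2 g"
  using Quotient_rel_abs[OF Quotient_l2, of f g] by simp

text \<open>The type becomes a real vector space; multiplication by complex scalars is carried along
  as an operation of its own.\<close>

lift_definition cmul :: "complex \<Rightarrow> l2 \<Rightarrow> l2" is "\<lambda>c f x. c * f x"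
  by (auto simp: L2_cmul)

text \<open>Without conjugation, in agreement with \<open>as_dual\<close> and with the integrals in
  \<open>has_weak_gradient\<close>.\<close>

lift_definition pair :: "l2 \<Rightarrow> l2 \<Rightarrow> complex" is "\<lambda>f g. LINT x|lborel. f x * g x"
  by (rule integral_cong_AE) (auto dest: L2_measurable)

lemma inner_self_integral: "(LINT x|lborel. f x * cnj (f x)) = of_real (LINT x|lborel. (cmod (f x))\<^sup>2)"
  by (subst integral_complex_of_real[symmetric]) (simp only: complex_norm_square)

text \<open>Taking the real part of the Hermitian product leaves the norm unchanged and makes
  multiplication by \<open>\<i>\<close> skew (\<open>inner_cmul_i\<close>), which is all that
  conservation of the norm requires.\<close>

instantiation l2 :: real_inner
begin
lift_definition zero_l2 :: l2 is "\<lambda>_. 0" by simp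
lift_definition plus_l2 :: "l2 \<Rightarrow> l2 \<Rightarrow> l2" is "\<lambda>f g x. f x + g x"
  by (auto simp: L2_add)
lift_definition uminus_l2 :: "l2 \<Rightarrow> l2" is "\<lambda>f x. - f x"
  by (auto simp: L2_uminus)
lift_definition minus_l2 :: "l2 \<Rightarrow> l2 \<Rightarrow> l2" is "\<lambda>f g x. f x - g x"
  by (auto simp: L2_diff)
lift_definition scaleR_l2 :: "real \<Rightarrow> l2 \<Rightarrow> l2" is "\<lambda>r f x. of_real r * f x"
  by (auto simp: L2_cmul)
lift_definition inner_l2 :: "l2 \<Rightarrow> l2 \<Rightarrow> real" is "\<lambda>f g. Re (LINT x|lborel. f x * cnj (g x))"
  by (intro arg_cong[where f=Re] integral_cong_AE)
     (auto dest: L2_measurable intro!: borel_measurable_times L2_measurable[OF L2_cnj])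
lift_definition norm_l2 :: "l2 \<Rightarrow> real" is norm_L2
  unfolding norm_L2_def
  by (intro arg_cong[where f=sqrt] integral_cong_AE) (auto dest: L2_measurable)
definition dist_l2 :: "l2 \<Rightarrow> l2 \<Rightarrow> real" where "dist_l2 x y = norm (x - y)"
definition sgn_l2 :: "l2 \<Rightarrow> l2" where "sgn_l2 x = scaleR (inverse (norm x)) x"
definition uniformity_l2 :: "(l2 \<times> l2) filter"
  where "uniformity_l2 = (INF e\<in>{0<..}. principal {(x, y). dist x y < e})"
definition open_l2 :: "l2 set \<Rightarrow> bool"
  where "open_l2 U \<longleftrightarrow> (\<forall>x\<in>U. \<forall>\<^sub>F (x', y) in uniformity. x' = x \<longrightarrow> y \<in> U)"
instance
proof
  fix x y z :: l2 and r s :: real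
  show "x + y + z = x + (y + z)" by transfer (auto simp: add.assoc L2_add)
  show "x + y = y + x" by transfer (auto simp: add.commute L2_add)
  show "0 + x = x" by transfer auto
  show "- x + x = 0" by transfer auto
  show "x - y = x + - y" by transfer (auto simp: L2_diff)
  show "r *\<^sub>R (x + y) = r *\<^sub>R x + r *\<^sub>R y"
    by transfer (auto simp: L2_add L2_cmul distrib_left)
  show "(r + s) *\<^sub>R x = r *\<^sub>R x + s *\<^sub>R x"
    by transfer (auto simp: L2_add L2_cmul distrib_right)
  show "r *\<^sub>R s *\<^sub>R x = (r * s) *\<^sub>R x" by transfer (auto simp: L2_cmul)
  show "1 *\<^sub>R x = x" by transfer auto
  show "dist x y = norm (x - y)" by (rule dist_l2_def)
  show "sgn x = scaleR (inverse (norm x)) x" by (rule sgn_l2_def)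
  show "(uniformity :: (l2 \<times> l2) filter) = (INF e\<in>{0<..}. principal {(x, y). dist x y < e})"
    by (rule uniformity_l2_def)
  show "open U \<longleftrightarrow> (\<forall>x\<in>U. \<forall>\<^sub>F (x', y) in uniformity. x' = x \<longrightarrow> y \<in> U)" for U :: "l2 set"
    by (rule open_l2_def)
  show "inner x y = inner y x"
  proof transfer
    fix f g :: "real^3 \<Rightarrow> complex"
    have "(LINT x|lborel. g x * cnj (f x)) = (LINT x|lborel. cnj (f x * cnj (g x)))"
      by (simp add: mult.commute)
    also have "\<dots> = cnj (LINT x|lborel. f x * cnj (g x))" by (rule Bochner_Integration.integral_cnj)
    finally show "Re (LINT x|lborel. f x * cnj (g x)) = Re (LINT x|lborel. g x * cnj (f x))" by simp
  qed
  show "inner (x + y) z = inner x z + inner y z"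
    by transfer (simp add: distrib_right L2_mult_integrable L2_cnj)
  show "inner (r *\<^sub>R x) y = r * inner x y"
    by transfer (simp add: mult.assoc)
  show "0 \<le> inner x x" by transfer (simp add: inner_self_integral)
  show "inner x x = 0 \<longleftrightarrow> x = 0"
  proof transfer
    fix f :: "real^3 \<Rightarrow> complex" assume "f \<in> L2 \<and> f \<in> L2 \<and> (AE x in lborel. f x = f x)"
    then have f: "f \<in> L2" by simp
    have "(LINT x|lborel. (cmod (f x))\<^sup>2) = 0 \<longleftrightarrow> (AE x in lborel. (cmod (f x))\<^sup>2 = 0)"
      by (rule integral_nonneg_eq_0_iff_AE) (simp_all add: f L2_integrable)
    then show "(Re (LINT x|lborel. f x * cnj (f x)) = 0) = (f \<in> L2 \<and> (\<lambda>_. 0) \<in> L2 \<and> (AE x in lborel. f x = 0))"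
      using f by (simp add: inner_self_integral)
  qed
  show "norm x = sqrt (inner x x)"
    by transfer (simp add: norm_L2_def inner_self_integral)
qed

end

lemma abs_add: "f \<in> L2 \<Longrightarrow> g \<in> L2 \<Longrightarrow> abs_l2 (\<lambda>x. f x + g x) = abs_l2 f + abs_l2 g"
  by (simp add: plus_l2.abs_eq)
lemma abs_diff: "f \<in> L2 \<Longrightarrow> g \<in> L2 \<Longrightarrow> abs_l2 (\<lambda>x. f x - g x) = abs_l2 f - abs_l2 g"
  by (simp add: minus_l2.abs_eq)
lemma abs_cmul: "f \<in> L2 \<Longrightarrow> abs_l2 (\<lambda>x. c * f x) = cmul c (abs_l2 f)"
  by (simp add: cmul.abs_eq)
lemma abs_scaleR: "f \<in> L2 \<Longrightarrow> abs_l2 (\<lambda>x. of_real r * f x) = r *\<^sub>R abs_l2 f"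
  by (simp add: scaleR_l2.abs_eq)
lemma abs_zero: "abs_l2 (\<lambda>_. 0) = 0"
  by (simp add: zero_l2_def)
lemma norm_abs: "f \<in> L2 \<Longrightarrow> norm (abs_l2 f) = norm_L2 f"
  by (simp add: norm_l2.abs_eq)
lemma pair_abs: "f \<in> L2 \<Longrightarrow> g \<in> L2 \<Longrightarrow> pair (abs_l2 f) (abs_l2 g) = (LINT x|lborel. f x * g x)"
  by (simp add: pair.abs_eq)
lemma pair_rep: "pair a b = (LINT x|lborel. rep_l2 a x * rep_l2 b x)"
  by (metis abs_rep pair_abs rep_in_L2)
lemma norm_rep: "norm a = norm_L2 (rep_l2 a)"
  by (metis abs_rep norm_abs rep_in_L2)
lemma rep_add: "AE x in lborel. rep_l2 (a + b) x = rep_l2 a x + rep_l2 b x"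
  using rep_abs[OF L2_add[of "rep_l2 a" "rep_l2 b"]] by (simp add: abs_add)
lemma rep_diff: "AE x in lborel. rep_l2 (a - b) x = rep_l2 a x - rep_l2 b x"
  using rep_abs[OF L2_diff[of "rep_l2 a" "rep_l2 b"]] by (simp add: abs_diff)
lemma rep_scaleR: "AE x in lborel. rep_l2 (r *\<^sub>R a) x = of_real r * rep_l2 a x"
  using rep_abs[OF L2_cmul[of "rep_l2 a" "of_real r"]] by (simp add: abs_scaleR)

lemma norm_sq_l2: "(norm a)\<^sup>2 = (LINT x|lborel. (cmod (rep_l2 a x))\<^sup>2)"
  by (simp add: norm_rep norm_L2_def)

lemma norm_L2_sq: "(norm_L2 f)\<^sup>2 = (LINT x|lborel. (cmod (f x))\<^sup>2)"
  by (simp add: norm_L2_def)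

lemma norm_L2_norm [simp]: "norm_L2 (\<lambda>x. of_real (cmod (f x))) = norm_L2 f"
  by (simp add: norm_L2_def)

lemma norm_L2_nonneg [simp]: "0 \<le> norm_L2 f"
  by (simp add: norm_L2_def)

text \<open>The abstract inequality is applied to the moduli of \<open>f\<close> and
  \<open>g\<close>, for which the real inner product is exactly the integral on the left.\<close>

lemma L2_Cauchy_Schwarz:
  assumes "f \<in> L2" "g \<in> L2"
  shows "(LINT x|lborel. cmod (f x) * cmod (g x)) \<le> norm_L2 f * norm_L2 g"
proof -
  let ?f = "\<lambda>x. complex_of_real (cmod (f x))" and ?g = "\<lambda>x. complex_of_real (cmod (g x))"
  have "inner (abs_l2 ?f) (abs_l2 ?g) = Re (LINT x|lborel. ?f x * cnj (?g x))"
    using assms by (intro inner_l2.abs_eq) (auto simp: L2_norm)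
  also have "(LINT x|lborel. ?f x * cnj (?g x)) = of_real (LINT x|lborel. cmod (f x) * cmod (g x))"
    by (subst integral_complex_of_real[symmetric]) simp
  finally have "inner (abs_l2 ?f) (abs_l2 ?g) = (LINT x|lborel. cmod (f x) * cmod (g x))" by simp
  moreover have "inner (abs_l2 ?f) (abs_l2 ?g) \<le> norm (abs_l2 ?f) * norm (abs_l2 ?g)"
    by (rule norm_cauchy_schwarz)
  ultimately show ?thesis using assms by (simp add: norm_abs L2_norm)
qed

lemma L2_Cauchy_Schwarz':
  assumes "f \<in> L2" "g \<in> L2"
  shows "cmod (LINT x|lborel. f x * g x) \<le> norm_L2 f * norm_L2 g"
proof -
  have "cmod (LINT x|lborel. f x * g x) \<le> (LINT x|lborel. cmod (f x * g x))"
    by (rule integral_norm_bound)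
  then show ?thesis using L2_Cauchy_Schwarz[OF assms] by (simp add: norm_mult)
qed

lemma bounded_bilinear_pair: "bounded_bilinear pair"
proof
  fix a a' b b' :: l2 and r :: real
  show "pair (a + a') b = pair a b + pair a' b"
    by transfer (simp add: distrib_right L2_mult_integrable)
  show "pair a (b + b') = pair a b + pair a b'"
    by transfer (simp add: distrib_left L2_mult_integrable)
  show "pair (r *\<^sub>R a) b = r *\<^sub>R pair a b"
    by transfer (simp add: scaleR_conv_of_real mult.assoc)
  show "pair a (r *\<^sub>R b) = r *\<^sub>R pair a b"
    by transfer (simp add: scaleR_conv_of_real mult.left_commute flip: integral_mult_right_zero)
  show "\<exists>K. \<forall>a b. norm (pair a b) \<le> norm a * norm b * K"
    by (rule exI[of _ 1]) (simp add: pair_rep norm_rep L2_Cauchy_Schwarz')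
qed

interpretation pair: bounded_bilinear pair by (rule bounded_bilinear_pair)

lemma norm_pair_le: "cmod (pair a b) \<le> norm a * norm b"
  by (simp add: pair_rep norm_rep L2_Cauchy_Schwarz')

lemma pair_commute: "pair a b = pair b a"
  by transfer (simp add: mult.commute)

lemma pair_cmul_left: "pair (cmul c a) b = c * pair a b"
  by transfer (simp add: mult.assoc)
lemma pair_cmul_right: "pair a (cmul c b) = c * pair a b"
  by (metis pair_commute pair_cmul_left)

lemma cmul_add: "cmul c (a + b) = cmul c a + cmul c b"
  by transfer (auto simp: L2_add L2_cmul distrib_left)
lemma cmul_diff: "cmul c (a - b) = cmul c a - cmul c b"
  by transfer (auto simp: L2_diff L2_cmul right_diff_distrib)
lemma cmul_scaleR: "cmul c (r *\<^sub>R a) = r *\<^sub>R cmul c a"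
  by transfer (auto simp: L2_cmul mult.left_commute)
lemma cmul_cmul: "cmul c (cmul d a) = cmul (c * d) a"
  by transfer (auto simp: L2_cmul mult.assoc)
lemma cmul_of_real: "cmul (of_real r) a = r *\<^sub>R a"
  by transfer (auto simp: L2_cmul)
lemma norm_cmul: "norm (cmul c a) = cmod c * norm a"
  by transfer (simp add: norm_L2_def norm_mult power_mult_distrib real_sqrt_mult)

lemma bounded_linear_cmul: "bounded_linear (cmul c)"
  by (rule bounded_linear_intro[where K="cmod c"])
     (simp_all add: cmul_add cmul_scaleR norm_cmul mult.commute)

lemma inner_cmul_i: "inner (cmul \<i> a) b = - inner a (cmul \<i> b)"
  by transfer (simp add: mult.assoc mult.left_commute)

text \<open>A weighted square sum replaces Minkowski's inequality for infinite sums: if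
  \<open>\<parallel>f\<^sub>n\<^sub>+\<^sub>1 - f\<^sub>n\<parallel>\<^sup>2 \<le> 8\<^sup>-\<^sup>n\<close>, then \<open>\<Sum> 4\<^sup>n \<bar>f\<^sub>n\<^sub>+\<^sub>1 - f\<^sub>n\<bar>\<^sup>2\<close> is integrable, so that
  \<open>\<bar>f\<^sub>n\<^sub>+\<^sub>1 - f\<^sub>n\<bar> \<le> 2\<^sup>-\<^sup>n\<close> eventually, almost everywhere.\<close>

lemma AE_convergent_fast_Cauchy:
  fixes f :: "nat \<Rightarrow> real^3 \<Rightarrow> complex"
  assumes f: "\<And>n. f n \<in> L2"
    and fast: "\<And>n. (norm_L2 (\<lambda>x. f (Suc n) x - f n x))\<^sup>2 \<le> (1/8)^n"
  shows "AE x in lborel. convergent (\<lambda>n. f n x)"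
proof -
  define d where "d n x = 4^n * (cmod (f (Suc n) x - f n x))\<^sup>2" for n x
  have [measurable]: "f n \<in> borel_measurable borel" for n
    using f by (rule L2_measurable)
  have [measurable]: "d n \<in> borel_measurable borel" for n
    unfolding d_def by measurable
  have "(\<integral>\<^sup>+x. (\<Sum>n. ennreal (d n x)) \<partial>lborel) = (\<Sum>n. \<integral>\<^sup>+x. ennreal (d n x) \<partial>lborel)"
    by (rule nn_integral_suminf) measurable
  also have "\<dots> \<le> (\<Sum>n. ennreal ((1/2)^n))"
  proof (rule suminf_le)
    fix n
    have "(\<integral>\<^sup>+x. ennreal (d n x) \<partial>lborel) = ennreal (LINT x|lborel. d n x)"
      unfolding d_def
      by (rule nn_integral_eq_integral) (auto intro!: L2_integrable L2_diff f)
    also have "(LINT x|lborel. d n x) = 4^n * (norm_L2 (\<lambda>x. f (Suc n) x - f n x))\<^sup>2"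
      unfolding d_def by (simp add: norm_L2_sq)
    also have "\<dots> \<le> 4^n * (1/8)^n"
      by (intro mult_left_mono fast) simp
    also have "\<dots> = (1/2)^n" by (simp flip: power_mult_distrib)
    finally show "(\<integral>\<^sup>+x. ennreal (d n x) \<partial>lborel) \<le> ennreal ((1/2)^n)"
      by (simp add: ennreal_leI)
  qed auto
  also have "\<dots> = ennreal (\<Sum>n. (1/2)^n)"
    by (rule suminf_ennreal2) (auto intro: summable_geometric)
  also have "\<dots> < \<infinity>" by simp
  finally have "(\<integral>\<^sup>+x. (\<Sum>n. ennreal (d n x)) \<partial>lborel) \<noteq> \<infinity>" by simp
  then have "AE x in lborel. (\<Sum>n. ennreal (d n x)) \<noteq> \<infinity>"
    by (intro nn_integral_noteq_infinite) measurable
  then show ?thesis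
  proof eventually_elim
    case (elim x)
    have "summable (\<lambda>n. d n x)"
      by (rule summable_suminf_not_top) (use elim in \<open>auto simp: d_def\<close>)
    then have "(\<lambda>n. d n x) \<longlonglongrightarrow> 0" by (rule summable_LIMSEQ_zero)
    then have ev: "\<forall>\<^sub>F n in sequentially. d n x < 1"
      by (rule order_tendstoD) simp
    have "summable (\<lambda>n. f (Suc n) x - f n x)"
    proof (rule summable_comparison_test_ev)
      show "\<forall>\<^sub>F n in sequentially. norm (f (Suc n) x - f n x) \<le> (1/2)^n"
        using ev
      proof eventually_elim
        case (elim n)
        have four: "((2::real)^n)\<^sup>2 = 4^n"
          by (simp add: power2_eq_square flip: power_mult_distrib)
        from elim have "(2^n * cmod (f (Suc n) x - f n x))\<^sup>2 < 1\<^sup>2"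
          using four by (simp add: d_def power_mult_distrib)
        then have "2^n * cmod (f (Suc n) x - f n x) < 1"
          by (rule power_less_imp_less_base) simp
        then show ?case by (simp add: power_divide field_simps)
      qed
      show "summable (\<lambda>n. (1/2)^n :: real)" by (auto intro: summable_geometric)
    qed
    then show "convergent (\<lambda>n. f n x)"
      using sum_lessThan_telescope[of "\<lambda>n. f n x"]
      by (simp add: summable_iff_convergent convergent_diff_const_right_iff)
  qed
qed


text \<open>Fatou's lemma in \<open>k\<close> carries the bound on |f_k - f_n| over to the pointwise
  limit \<open>g\<close>.\<close>

lemma L2_Cauchy_limit:
  fixes f :: "nat \<Rightarrow> real^3 \<Rightarrow> complex"
  assumes f: "\<And>n. f n \<in> L2" and [measurable]: "g \<in> borel_measurable borel"
    and lim: "AE x in lborel. (\<lambda>n. f n x) \<longlonglongrightarrow> g x"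
    and C: "\<And>k. k \<ge> N \<Longrightarrow> norm_L2 (\<lambda>x. f k x - f n x) \<le> e" and "0 \<le> e"
  shows "(\<lambda>x. g x - f n x) \<in> L2" "norm_L2 (\<lambda>x. g x - f n x) \<le> e"
proof -
  have [measurable]: "f n \<in> borel_measurable borel" for n
    using f by (rule L2_measurable)
  have "(\<integral>\<^sup>+x. ennreal ((cmod (g x - f n x))\<^sup>2) \<partial>lborel)
      = (\<integral>\<^sup>+x. liminf (\<lambda>k. ennreal ((cmod (f k x - f n x))\<^sup>2)) \<partial>lborel)"
  proof (rule nn_integral_cong_AE)
    show "AE x in lborel. ennreal ((cmod (g x - f n x))\<^sup>2) = liminf (\<lambda>k. ennreal ((cmod (f k x - f n x))\<^sup>2))"
      using lim
    proof eventually_elim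
      case (elim x)
      then have "(\<lambda>k. ennreal ((cmod (f k x - f n x))\<^sup>2)) \<longlonglongrightarrow> ennreal ((cmod (g x - f n x))\<^sup>2)"
        by (intro tendsto_ennrealI tendsto_intros)
      then show ?case by (intro lim_imp_Liminf[symmetric]) simp_all
    qed
  qed
  also have "\<dots> \<le> liminf (\<lambda>k. \<integral>\<^sup>+x. ennreal ((cmod (f k x - f n x))\<^sup>2) \<partial>lborel)"
    by (rule nn_integral_liminf) measurable
  also have "\<dots> \<le> ennreal (e\<^sup>2)"
  proof (rule Liminf_le)
    show "\<forall>\<^sub>F k in sequentially. (\<integral>\<^sup>+x. ennreal ((cmod (f k x - f n x))\<^sup>2) \<partial>lborel) \<le> ennreal (e\<^sup>2)"
    proof (rule eventually_sequentiallyI[of N])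
      fix k assume k: "N \<le> k"
      have "(\<integral>\<^sup>+x. ennreal ((cmod (f k x - f n x))\<^sup>2) \<partial>lborel) = ennreal ((norm_L2 (\<lambda>x. f k x - f n x))\<^sup>2)"
        unfolding norm_L2_sq by (rule nn_integral_eq_integral) (auto intro!: L2_integrable L2_diff f)
      then show "(\<integral>\<^sup>+x. ennreal ((cmod (f k x - f n x))\<^sup>2) \<partial>lborel) \<le> ennreal (e\<^sup>2)"
        using power_mono[OF C[OF k], of 2] by (simp add: ennreal_leI)
    qed
  qed simp
  finally have le: "(\<integral>\<^sup>+x. ennreal ((cmod (g x - f n x))\<^sup>2) \<partial>lborel) \<le> ennreal (e\<^sup>2)" .
  have int: "integrable lborel (\<lambda>x. (cmod (g x - f n x))\<^sup>2)"
  proof (rule integrableI_bounded)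
    show "(\<integral>\<^sup>+x. ennreal (norm ((cmod (g x - f n x))\<^sup>2)) \<partial>lborel) < \<infinity>"
      using le by (auto simp: le_less_trans)
  qed measurable
  then show "(\<lambda>x. g x - f n x) \<in> L2" by (intro L2_I) measurable
  have "ennreal (LINT x|lborel. (cmod (g x - f n x))\<^sup>2) \<le> ennreal (e\<^sup>2)"
    using le nn_integral_eq_integral[OF int] by simp
  then have "(norm_L2 (\<lambda>x. g x - f n x))\<^sup>2 \<le> e\<^sup>2" by (simp add: norm_L2_sq)
  then show "norm_L2 (\<lambda>x. g x - f n x) \<le> e"
    by (rule power2_le_imp_le) fact
qed

instance l2 :: complete_space
proof
  fix X :: "nat \<Rightarrow> l2" assume X: "Cauchy X"
  have "\<exists>N. \<forall>m\<ge>N. \<forall>n\<ge>N. dist (X m) (X n) < (1/4)^j" for j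
    using metric_CauchyD[OF X, of "(1/4)^j"] by simp
  then obtain N where N: "\<And>j m n. m \<ge> N j \<Longrightarrow> n \<ge> N j \<Longrightarrow> dist (X m) (X n) < (1/4)^j" by metis
  \<comment> \<open>The sum dominates \<open>N j\<close>, and the extra summand \<open>j\<close>
    makes the sequence strictly increasing. The distances 4^-n of the subsequence have squares
    16^-n, below the 8^-n required for convergence almost everywhere.\<close>
  define r where "r j = (\<Sum>i\<le>j. N i) + j" for j
  have rN: "N j \<le> r j" for j
    unfolding r_def using member_le_sum[of j "{..j}" N] by simp
  have r: "strict_mono r"
    unfolding r_def by (rule strict_monoI_Suc) simp
  define f where "f j = rep_l2 (X (r j))" for j
  have f: "f j \<in> L2" for j by (simp add: f_def)
  have diff: "norm_L2 (\<lambda>x. f k x - f j x) = dist (X (r k)) (X (r j))" for k j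
    by (simp add: f_def dist_norm flip: norm_abs[OF L2_diff[OF rep_in_L2 rep_in_L2]])
       (simp add: abs_diff)
  have "(norm_L2 (\<lambda>x. f (Suc n) x - f n x))\<^sup>2 \<le> (1/8)^n" for n
  proof -
    have "dist (X (r (Suc n))) (X (r n)) < (1/4)^n"
      using rN[of n] strict_mono_leD[OF r, of n "Suc n"] by (intro N) auto
    then have "(norm_L2 (\<lambda>x. f (Suc n) x - f n x))\<^sup>2 \<le> ((1/4)^n)\<^sup>2"
      by (intro power_mono) (auto simp: diff)
    also have "\<dots> = (1/16)^n" by (simp add: power2_eq_square flip: power_mult_distrib)
    also have "\<dots> \<le> (1/8)^n" by (rule power_mono) auto
    finally show ?thesis .
  qed
  then have conv: "AE x in lborel. convergent (\<lambda>n. f n x)"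
    by (intro AE_convergent_fast_Cauchy f)
  define g where "g x = lim (\<lambda>n. f n x)" for x
  have [measurable]: "f n \<in> borel_measurable borel" for n
    using f by (rule L2_measurable)
  have gm: "g \<in> borel_measurable borel"
    unfolding g_def by measurable
  have lim: "AE x in lborel. (\<lambda>n. f n x) \<longlonglongrightarrow> g x"
    using conv by eventually_elim (simp add: g_def convergent_LIMSEQ_iff)
  have C: "norm_L2 (\<lambda>x. f k x - f n x) \<le> (1/4)^n" if "k \<ge> n" for k n
    using N[of n "r k" "r n"] rN[of n] strict_mono_leD[OF r that] by (simp add: diff)
  have L1: "(\<lambda>x. g x - f n x) \<in> L2" and L2: "norm_L2 (\<lambda>x. g x - f n x) \<le> (1/4)^n" for n
    using L2_Cauchy_limit[OF f gm lim, of n n "(1/4)^n"] C[of n] by auto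
  have g: "g \<in> L2"
    using L2_add[OF L1[of 0] f[of 0]] by simp
  have "(\<lambda>n. X (r n)) \<longlonglongrightarrow> abs_l2 g"
  proof (rule LIM_zero_cancel, rule Lim_null_comparison)
    have "norm (X (r n) - abs_l2 g) \<le> (1/4)^n" for n
    proof -
      have "norm (X (r n) - abs_l2 g) = norm (abs_l2 g - X (r n))" by (rule norm_minus_commute)
      also have "\<dots> = norm_L2 (\<lambda>x. g x - f n x)"
        using norm_abs[OF L2_diff[OF g f, of n]] abs_diff[OF g f, of n] by (simp add: f_def)
      finally show ?thesis using L2[of n] by simp
    qed
    then show "\<forall>\<^sub>F n in sequentially. norm (X (r n) - abs_l2 g) \<le> (1/4)^n" by simp
    show "(\<lambda>n. (1/4)^n :: real) \<longlonglongrightarrow> 0" by (rule LIMSEQ_power_zero) simp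
  qed
  then have "X \<longlonglongrightarrow> abs_l2 g"
    by (intro Cauchy_converges_subseq[OF X r]) (simp add: comp_def)
  then show "convergent X" by (rule convergentI)
qed

instance l2 :: banach ..

text \<open>The squares |f_n - g|^2 are dominated by (2 |w|)^2. The density proof and
  \<open>gen_test\<close> use it for every passage from pointwise limits to limits in norm.\<close>

lemma L2_dominated_convergence:
  fixes f :: "nat \<Rightarrow> real^3 \<Rightarrow> complex"
  assumes "\<And>n. f n \<in> L2" "g \<in> borel_measurable borel" "w \<in> L2"
    and lim: "AE x in lborel. (\<lambda>n. f n x) \<longlonglongrightarrow> g x"
    and bound: "\<And>n. AE x in lborel. cmod (f n x) \<le> cmod (w x)"
  shows "g \<in> L2" "(\<lambda>n. abs_l2 (f n)) \<longlonglongrightarrow> abs_l2 g"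
proof -
  note [measurable] = L2_measurable[OF assms(1)] assms(2) L2_measurable[OF assms(3)]
  have bound': "AE x in lborel. \<forall>n. cmod (f n x) \<le> cmod (w x)"
    using bound by (simp add: AE_all_countable)
  have gw: "AE x in lborel. cmod (g x) \<le> cmod (w x)"
    using lim bound'
  proof eventually_elim
    case (elim x)
    then show ?case by (intro LIMSEQ_le_const2[OF tendsto_norm[OF elim(1)]]) auto
  qed
  show g: "g \<in> L2" by (rule L2_dominated[OF assms(2,3) gw])
  have "(\<lambda>n. LINT x|lborel. (cmod (f n x - g x))\<^sup>2) \<longlonglongrightarrow> (LINT (x::real^3)|lborel. (0 :: real))"
  proof (rule Bochner_Integration.integral_dominated_convergence)
    show "integrable lborel (\<lambda>x. (2 * cmod (w x))\<^sup>2)"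
      using assms(3) by (simp add: power_mult_distrib L2_integrable)
    show "AE x in lborel. (\<lambda>n. (cmod (f n x - g x))\<^sup>2) \<longlonglongrightarrow> 0"
      using lim
    proof eventually_elim
      case (elim x)
      have "(\<lambda>n. (cmod (f n x - g x))\<^sup>2) \<longlonglongrightarrow> (cmod (g x - g x))\<^sup>2"
        by (intro tendsto_intros elim)
      then show ?case by simp
    qed
    fix n
    show "AE x in lborel. norm ((cmod (f n x - g x))\<^sup>2) \<le> (2 * cmod (w x))\<^sup>2"
      using gw bound[of n]
    proof eventually_elim
      case (elim x)
      have "cmod (f n x - g x) \<le> 2 * cmod (w x)"
        using norm_triangle_ineq4[of "f n x" "g x"] elim by linarith
      then show ?case using power_mono[of "cmod (f n x - g x)" "2 * cmod (w x)" 2] by simp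
    qed
  qed measurable
  then have "(\<lambda>n. sqrt (LINT x|lborel. (cmod (f n x - g x))\<^sup>2)) \<longlonglongrightarrow> sqrt 0"
    by (intro tendsto_real_sqrt) simp
  then have "(\<lambda>n. norm (abs_l2 (f n) - abs_l2 g)) \<longlonglongrightarrow> 0"
    using assms(1) g by (simp add: norm_abs L2_diff norm_L2_def flip: abs_diff)
  then show "(\<lambda>n. abs_l2 (f n)) \<longlonglongrightarrow> abs_l2 g"
    by (simp add: LIM_zero_cancel tendsto_norm_zero_iff)
qed

section \<open>Density of test functions\<close>

lemma C_k_Suc_imp: "C_k (Suc k) f \<Longrightarrow> C_k k f"
proof (induction k arbitrary: f)
  case 0
  then obtain f' where "\<And>x. (f has_derivative f' x) (at x)" by auto
  then show ?case
    by (auto intro!: continuous_at_imp_continuous_on has_derivative_continuous)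
next
  case (Suc k)
  obtain f' where "\<And>x. (f has_derivative f' x) (at x)" "\<And>v. C_k (Suc k) (\<lambda>x. f' x v)"
    using Suc.prems by (subst (asm) C_k.simps(2)) blast
  then show ?case using Suc.IH by (auto simp only: C_k.simps(2) intro!: exI[of _ f'])
qed

lemma C_k_const: "C_k k (\<lambda>_. c)"
proof (induction k arbitrary: c)
  case (Suc k)
  then show ?case by (auto intro!: exI[of _ "\<lambda>_ _. 0"])
qed auto

lemma C_k_add: "C_k k f \<Longrightarrow> C_k k g \<Longrightarrow> C_k k (\<lambda>x. f x + g x)"
proof (induction k arbitrary: f g)
  case (Suc k)
  obtain f' where f: "\<And>x. (f has_derivative f' x) (at x)" "\<And>v. C_k k (\<lambda>x. f' x v)"
    using Suc.prems(1) by auto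
  obtain g' where g: "\<And>x. (g has_derivative g' x) (at x)" "\<And>v. C_k k (\<lambda>x. g' x v)"
    using Suc.prems(2) by auto
  show ?case
    using f g Suc.IH by (auto intro!: exI[of _ "\<lambda>x v. f' x v + g' x v"] has_derivative_add)
qed (auto intro: continuous_intros)

lemma C_k_bounded_linear:
  assumes "bounded_linear L" shows "C_k k f \<Longrightarrow> C_k k (\<lambda>x. L (f x))"
proof (induction k arbitrary: f)
  case 0
  then show ?case by (auto intro!: bounded_linear.continuous_on[OF assms])
next
  case (Suc k)
  obtain f' where f: "\<And>x. (f has_derivative f' x) (at x)" "\<And>v. C_k k (\<lambda>x. f' x v)"
    using Suc.prems(1) by auto
  show ?case
    using f Suc.IH
    by (auto intro!: exI[of _ "\<lambda>x v. L (f' x v)"] bounded_linear.has_derivative[OF assms])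
qed

lemma C_k_affine:
  assumes "bounded_linear L" shows "C_k k f \<Longrightarrow> C_k k (\<lambda>x. f (L x + c))"
proof (induction k arbitrary: f)
  case 0
  have "continuous_on UNIV (\<lambda>x. L x + c)"
    by (intro continuous_intros bounded_linear.continuous_on[OF assms])
  from continuous_on_compose2[OF _ this] 0 show ?case by auto
next
  case (Suc k)
  obtain f' where f: "\<And>x. (f has_derivative f' x) (at x)" "\<And>v. C_k k (\<lambda>x. f' x v)"
    using Suc.prems(1) by auto
  have "((\<lambda>x. L x + c) has_derivative L) (at x)" for x
    using has_derivative_add_const[OF bounded_linear.has_derivative[OF assms has_derivative_ident]]
    by simp
  from has_derivative_compose[OF this f(1)]
  have "((\<lambda>x. f (L x + c)) has_derivative (\<lambda>v. f' (L x + c) (L v))) (at x)" for x by simp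
  then show ?case
    using f(2) Suc.IH by (auto intro!: exI[of _ "\<lambda>x v. f' (L x + c) (L v)"])
qed

text \<open>Each term of the product rule still contains an undifferentiated factor, which must be
  known to lie in the lower class; hence the appeal to \<open>C_k_Suc_imp\<close>.\<close>

lemma C_k_mult:
  fixes f g :: "'a::real_normed_vector \<Rightarrow> 'b::real_normed_algebra"
  shows "C_k k f \<Longrightarrow> C_k k g \<Longrightarrow> C_k k (\<lambda>x. f x * g x)"
proof (induction k arbitrary: f g)
  case (Suc k)
  obtain f' where f: "\<And>x. (f has_derivative f' x) (at x)" "\<And>v. C_k k (\<lambda>x. f' x v)"
    using Suc.prems(1) by auto
  obtain g' where g: "\<And>x. (g has_derivative g' x) (at x)" "\<And>v. C_k k (\<lambda>x. g' x v)"
    using Suc.prems(2) by auto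
  show ?case
    using f g Suc.IH C_k_Suc_imp[OF Suc.prems(1)] C_k_Suc_imp[OF Suc.prems(2)]
    by (auto intro!: exI[of _ "\<lambda>x v. f x * g' x v + f' x v * g x"] has_derivative_mult C_k_add)
qed (auto intro: continuous_intros)

lemma C_k_prod:
  fixes f :: "'i \<Rightarrow> 'a::real_normed_vector \<Rightarrow> 'b::real_normed_field"
  shows "(\<And>i. i \<in> A \<Longrightarrow> C_k k (f i)) \<Longrightarrow> C_k k (\<lambda>x. \<Prod>i\<in>A. f i x)"
  by (induction A rule: infinite_finite_induct) (auto simp: C_k_const C_k_mult)

lemma C_k_exp:
  fixes f :: "'a::real_normed_vector \<Rightarrow> real"
  shows "C_k k f \<Longrightarrow> C_k k (\<lambda>x. exp (f x))"
proof (induction k)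
  case (Suc k)
  obtain f' where f: "\<And>x. (f has_derivative f' x) (at x)" "\<And>v. C_k k (\<lambda>x. f' x v)"
    using Suc.prems(1) by auto
  have "((\<lambda>x. exp (f x)) has_derivative (\<lambda>v. exp (f x) * f' x v)) (at x)" for x
    by (rule has_derivative_eq_rhs, rule has_derivative_exp[OF f(1)]) (simp add: mult.commute)
  then show ?case
    using f(2) Suc.IH[OF C_k_Suc_imp[OF Suc.prems]]
    by (auto intro!: exI[of _ "\<lambda>x v. exp (f x) * f' x v"] C_k_mult)
qed (auto intro: continuous_intros)

section \<open>Smooth cutoff functions for boxes\<close>

definition flat :: "real poly \<Rightarrow> real \<Rightarrow> real" where
  "flat p t = (if t > 0 then poly p (inverse t) * exp (- inverse t) else 0)"

lemma poly_exp_tendsto_0: "((\<lambda>x::real. poly p x * exp (- x)) \<longlongrightarrow> 0) at_top"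
proof -
  have "((\<lambda>x. \<Sum>i\<le>degree p. coeff p i * (x ^ i / exp x)) \<longlongrightarrow> (\<Sum>i\<le>degree p. coeff p i * 0)) at_top"
    by (intro tendsto_intros tendsto_power_div_exp_0)
  then show ?thesis
    by (simp add: poly_altdef sum_distrib_right exp_minus divide_inverse mult.assoc)
qed

text \<open>For t > 0, differentiating p(1/t) exp(-1/t) gives (p - p')(1/t) t^-2 exp(-1/t), and t^-2
  is the polynomial X^2 at 1/t. The family is thus closed under differentiation, which is why the
  classical exp(-1/t), that is \<open>flat 1\<close>, is treated together with all polynomial
  factors.\<close>

lemma flat_has_derivative:
  "(flat p has_real_derivative flat ([:0, 0, 1:] * (p - pderiv p)) t) (at t)"
proof -
  consider "t > 0" | "t < 0" | "t = 0" by linarith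
  then show ?thesis
  proof cases
    case 1
    have "((\<lambda>t. poly p (inverse t) * exp (- inverse t)) has_real_derivative
        flat ([:0, 0, 1:] * (p - pderiv p)) t) (at t)"
      using 1 unfolding flat_def
      by (auto intro!: derivative_eq_intros DERIV_chain2[OF poly_DERIV]
          simp: field_simps power2_eq_square)
    then show ?thesis
      by (rule has_field_derivative_transform_within_open[where S="{0<..}"])
         (use 1 in \<open>auto simp: flat_def\<close>)
  next
    case 2
    have "((\<lambda>_. 0) has_real_derivative 0) (at t)" by simp
    then have "(flat p has_real_derivative 0) (at t)"
      by (rule has_field_derivative_transform_within_open[where S="{..<0}"])
         (use 2 in \<open>auto simp: flat_def\<close>)
    then show ?thesis using 2 by (simp add: flat_def)
  next
    case 3
    have "((\<lambda>h. flat p h / h) \<longlongrightarrow> 0) (at_left 0)"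
      by (rule tendsto_eventually) (auto simp: eventually_at_filter flat_def)
    moreover have "((\<lambda>h. flat p h / h) \<longlongrightarrow> 0) (at_right 0)"
    proof -
      \<comment> \<open>Dividing by \<open>h\<close> multiplies the polynomial in 1/h by X, and 1/h
        tends to infinity from the right; the exponential wins.\<close>
      have "((\<lambda>h. poly (pCons 0 p) (inverse h) * exp (- inverse h)) \<longlongrightarrow> 0) (at_right (0::real))"
        by (rule filterlim_compose[OF poly_exp_tendsto_0 filterlim_inverse_at_top_right])
      then show ?thesis
        by (rule Lim_transform_eventually)
           (auto simp: eventually_at_filter flat_def field_simps)
    qed
    ultimately have "((\<lambda>h. flat p h / h) \<longlongrightarrow> 0) (at 0)"
      by (simp add: filterlim_at_split)
    then show ?thesis
      using 3 by (simp add: DERIV_def flat_def)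
  qed
qed

lemma C_k_flat: "C_k k (flat p)"
proof (induction k arbitrary: p)
  case 0
  have "isCont (flat p) t" for t using flat_has_derivative by (rule DERIV_isCont)
  then show ?case by (simp add: continuous_at_imp_continuous_on)
next
  case (Suc k)
  \<comment> \<open>The directional derivative along \<open>v\<close> is again a member of the
    family, so the induction hypothesis for all polynomials covers it.\<close>
  have "flat (smult v p) x = flat p x * v" for v p x by (simp add: flat_def)
  then have "C_k k (\<lambda>x. flat p x * v)" for p v
    using Suc.IH[of "smult v p"] by (simp add: ext)
  then show ?case
    using flat_has_derivative[of p] unfolding has_field_derivative_def
    by (auto intro!: exI[of _ "\<lambda>x v. flat ([:0, 0, 1:] * (p - pderiv p)) x * v"])
qed

text \<open>A product over the coordinates is positive exactly on the open box. Boxes rather than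
  balls, because they form an intersection-stable generator of the Borel sets.\<close>

definition bump :: "real^'n \<Rightarrow> real^'n \<Rightarrow> real^'n \<Rightarrow> real" where
  "bump a b x = (\<Prod>j\<in>UNIV. flat 1 (x$j - a$j) * flat 1 (b$j - x$j))"

lemma flat1_nonneg: "0 \<le> flat 1 t" and flat1_pos: "0 < t \<Longrightarrow> 0 < flat 1 t"
  and flat1_eq_0: "t \<le> 0 \<Longrightarrow> flat 1 t = 0"
  by (auto simp: flat_def)

lemma bump_nonneg: "0 \<le> bump a b x"
  unfolding bump_def by (intro prod_nonneg) (simp add: flat1_nonneg)

lemma bump_pos: "x \<in> box a b \<Longrightarrow> 0 < bump a b x"
  unfolding bump_def by (intro prod_pos) (auto simp: mem_box_cart flat1_pos)

lemma bump_eq_0: assumes "x \<notin> box a b" shows "bump a b x = 0"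
proof -
  obtain i where "x$i - a$i \<le> 0 \<or> b$i - x$i \<le> 0" using assms by (auto simp: mem_box_cart not_less)
  then have "flat 1 (x$i - a$i) * flat 1 (b$i - x$i) = 0" using flat1_eq_0 by auto
  then show ?thesis unfolding bump_def by (intro prod_zero) auto
qed

lemma C_k_bump: fixes a b :: "real^'n" shows "C_k k (bump a b)"
proof -
  have 1: "C_k k (\<lambda>x::real^'n. flat 1 (x$j - a$j))" for j
    using C_k_affine[OF bounded_linear_vec_nth, of k "flat 1" j "- a$j"] C_k_flat by simp
  have "bounded_linear (\<lambda>x::real^'n. - x $ j)" for j
    by (intro bounded_linear_minus bounded_linear_vec_nth)
  from C_k_affine[OF this, of k "flat 1" _ "b $ _"]
  have 2: "C_k k (\<lambda>x::real^'n. flat 1 (b$j - x$j))" for j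
    using C_k_flat by (simp add: add.commute)
  show ?thesis unfolding bump_def by (intro C_k_prod C_k_mult 1 2)
qed

text \<open>Applying s -> 1 - exp(-n s) to the bump gives smooth functions with values in [0, 1)
  that vanish outside the box and tend to 1 at each of its points as \<open>n\<close> grows: they
  converge to its indicator under a fixed majorant.\<close>

definition plateau :: "nat \<Rightarrow> real^3 \<Rightarrow> real^3 \<Rightarrow> real^3 \<Rightarrow> complex" where
  "plateau n a b x = of_real (1 - exp (- (real n * bump a b x)))"

section \<open>Stability properties of test functions\<close>

lemma compact_support_I:
  fixes \<eta> :: "'a::euclidean_space \<Rightarrow> 'b::real_normed_vector"
  assumes "compact K" "\<And>x. x \<notin> K \<Longrightarrow> \<eta> x = 0"
  shows "compact (closure {x. \<eta> x \<noteq> 0})" "closure {x. \<eta> x \<noteq> 0} \<subseteq> K"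
proof -
  show *: "closure {x. \<eta> x \<noteq> 0} \<subseteq> K"
    using assms by (intro closure_minimal) (auto intro: compact_imp_closed)
  then show "compact (closure {x. \<eta> x \<noteq> 0})"
    using assms(1) by (metis closed_closure compact_Int_closed inf.absorb_iff2)
qed

lemma test_functionI:
  fixes \<eta> :: "'a::euclidean_space \<Rightarrow> 'b::real_normed_vector"
  assumes "\<And>k. C_k k \<eta>" "compact K" "\<And>x. x \<notin> K \<Longrightarrow> \<eta> x = 0"
  shows "\<eta> \<in> test_functions UNIV"
  using assms compact_support_I[OF assms(2,3)] by (simp add: test_functions_def)

lemma test_support:
  fixes \<eta> :: "'a::euclidean_space \<Rightarrow> 'b::real_normed_vector"
  assumes "\<eta> \<in> test_functions \<Omega>"
  shows "\<exists>K. compact K \<and> K \<subseteq> \<Omega> \<and> (\<forall>x. x \<notin> K \<longrightarrow> \<eta> x = 0)"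
proof (intro exI conjI allI impI)
  let ?K = "closure {x. \<eta> x \<noteq> 0}"
  show "compact ?K" "?K \<subseteq> \<Omega>" using assms by (simp_all add: test_functions_def)
  show "\<eta> x = 0" if "x \<notin> ?K" for x using that closure_subset[of "{x. \<eta> x \<noteq> 0}"] by auto
qed

lemma test_C_k: "\<eta> \<in> test_functions \<Omega> \<Longrightarrow> C_k k \<eta>"
  by (simp add: test_functions_def)

lemma plateau_test: "plateau n a b \<in> test_functions UNIV"
proof (rule test_functionI)
  show "C_k k (plateau n a b)" for k
  proof -
    have "C_k k (\<lambda>x. 1 + (- exp ((- real n) * bump a b x)))"
      by (intro C_k_add C_k_const C_k_exp C_k_bounded_linear[OF bounded_linear_mult_right]
          C_k_bounded_linear[OF bounded_linear_minus[OF bounded_linear_ident]] C_k_bump)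
    from C_k_bounded_linear[OF bounded_linear_of_real this] show ?thesis
      by (simp add: plateau_def[abs_def])
  qed
  show "compact (cbox a b)" by (rule compact_cbox)
  show "plateau n a b x = 0" if "x \<notin> cbox a b" for x
    using that bump_eq_0[of x a b] box_subset_cbox[of a b] by (auto simp: plateau_def)
qed

lemma test_has_derivative:
  assumes "\<eta> \<in> test_functions \<Omega>"
  shows "(\<eta> has_derivative frechet_derivative \<eta> (at x)) (at x)"
proof -
  have "C_k (Suc 0) \<eta>" using assms by (rule test_C_k)
  then show ?thesis
    by (metis C_k.simps(2) differentiableI frechet_derivative_works)
qed

lemma test_continuous: "\<eta> \<in> test_functions \<Omega> \<Longrightarrow> continuous_on S \<eta>"
  using test_C_k[of \<eta> \<Omega> 0] by (auto intro: continuous_on_subset)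

lemma test_partial:
  fixes \<eta> :: "'a::euclidean_space \<Rightarrow> 'b::real_normed_vector"
  assumes "\<eta> \<in> test_functions \<Omega>"
  shows "(\<lambda>x. frechet_derivative \<eta> (at x) v) \<in> test_functions \<Omega>"
proof -
  obtain K where K: "compact K" "K \<subseteq> \<Omega>" "\<And>x. x \<notin> K \<Longrightarrow> \<eta> x = 0"
    using test_support[OF assms] by blast
  have "C_k k (\<lambda>x. frechet_derivative \<eta> (at x) v)" for k
  proof -
    obtain f' where f': "\<And>x. (\<eta> has_derivative f' x) (at x)" "\<And>v. C_k k (\<lambda>x. f' x v)"
      using test_C_k[OF assms, of "Suc k"] by auto
    have "frechet_derivative \<eta> (at x) = f' x" for x
      using frechet_derivative_at[OF f'(1)] by simp
    then show ?thesis using f'(2) by simp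
  qed
  moreover have "frechet_derivative \<eta> (at x) v = 0" if "x \<notin> K" for x
  proof -
    have "((\<lambda>_. 0) has_derivative (\<lambda>_. 0)) (at x)" by simp
    then have "(\<eta> has_derivative (\<lambda>_. 0)) (at x)"
      by (rule has_derivative_transform_within_open[OF _ open_Compl[OF compact_imp_closed[OF K(1)]]])
         (use K that in auto)
    then have "frechet_derivative \<eta> (at x) = (\<lambda>_. 0)"
      using frechet_derivative_at by fastforce
    then show ?thesis by simp
  qed
  ultimately show ?thesis
    using compact_support_I[OF K(1), of "\<lambda>x. frechet_derivative \<eta> (at x) v"] K(2)
    by (auto simp: test_functions_def)
qed

lemma test_add:
  fixes \<eta> :: "'a::euclidean_space \<Rightarrow> 'b::real_normed_vector"
  assumes "\<eta> \<in> test_functions UNIV" "\<zeta> \<in> test_functions UNIV"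
  shows "(\<lambda>x. \<eta> x + \<zeta> x) \<in> test_functions UNIV"
proof -
  obtain K where K: "compact K" "\<And>x. x \<notin> K \<Longrightarrow> \<eta> x = 0"
    using test_support[OF assms(1)] by blast
  obtain K' where K': "compact K'" "\<And>x. x \<notin> K' \<Longrightarrow> \<zeta> x = 0"
    using test_support[OF assms(2)] by blast
  show ?thesis
    by (rule test_functionI[where K="K \<union> K'"])
       (use K K' assms in \<open>auto intro: C_k_add test_C_k\<close>)
qed

lemma test_cmul:
  fixes \<eta> :: "'a::euclidean_space \<Rightarrow> 'b::real_normed_algebra"
  assumes "\<eta> \<in> test_functions UNIV"
  shows "(\<lambda>x. c * \<eta> x) \<in> test_functions UNIV"
proof -
  obtain K where K: "compact K" "\<And>x. x \<notin> K \<Longrightarrow> \<eta> x = 0"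
    using test_support[OF assms(1)] by blast
  show ?thesis
    by (rule test_functionI[OF _ K(1)])
       (use K assms in \<open>auto intro: C_k_bounded_linear[OF bounded_linear_mult_right] test_C_k\<close>)
qed

lemma test_translate:
  fixes \<eta> :: "'a::euclidean_space \<Rightarrow> 'b::real_normed_vector"
  assumes "\<eta> \<in> test_functions UNIV"
  shows "(\<lambda>x. \<eta> (x + a)) \<in> test_functions UNIV"
proof -
  obtain K where K: "compact K" "\<And>x. x \<notin> K \<Longrightarrow> \<eta> x = 0"
    using test_support[OF assms(1)] by blast
  show ?thesis
  proof (rule test_functionI)
    show "C_k k (\<lambda>x. \<eta> (x + a))" for k
      using C_k_affine[OF bounded_linear_ident test_C_k[OF assms]] .
    show "compact ((\<lambda>x. x - a) ` K)"
      by (intro compact_continuous_image K continuous_intros)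
    show "\<eta> (x + a) = 0" if "x \<notin> (\<lambda>x. x - a) ` K" for x
      using that by (intro K) force
  qed
qed

lemma continuous_compact_support_L2:
  assumes "continuous_on UNIV \<eta>" "compact K" "\<And>x. x \<notin> K \<Longrightarrow> \<eta> x = 0"
  shows "\<eta> \<in> L2"
proof (rule L2_I)
  show "\<eta> \<in> borel_measurable borel" using assms(1) by (rule borel_measurable_continuous_onI)
  have "integrable lborel (\<lambda>x. indicator K x *\<^sub>R (cmod (\<eta> x))\<^sup>2)"
    using assms by (intro borel_integrable_compact)
      (auto intro!: continuous_intros intro: continuous_on_subset)
  moreover have "(\<lambda>x. indicator K x *\<^sub>R (cmod (\<eta> x))\<^sup>2) = (\<lambda>x. (cmod (\<eta> x))\<^sup>2)"
  proof
    show "indicator K x *\<^sub>R (cmod (\<eta> x))\<^sup>2 = (cmod (\<eta> x))\<^sup>2" for x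
      using assms(3)[of x] by (cases "x \<in> K") auto
  qed
  ultimately show "integrable lborel (\<lambda>x. (cmod (\<eta> x))\<^sup>2)" by simp
qed

lemma test_L2: "\<eta> \<in> test_functions UNIV \<Longrightarrow> \<eta> \<in> L2"
  using test_support[of \<eta> UNIV] by (auto intro: continuous_compact_support_L2 test_continuous)

section \<open>From boxes to Borel sets to arbitrary square-integrable functions\<close>

lemma L2_indicator:
  assumes "A \<in> sets borel" "emeasure lborel A < \<infinity>"
  shows "(\<lambda>x. indicator A x) \<in> L2"
proof (rule L2_I)
  have "integrable lborel (\<lambda>x. indicator A x :: real)"
    using assms by (intro integrable_real_indicator) auto
  moreover have "(cmod (indicator A x))\<^sup>2 = indicator A x" for x
    by (simp add: indicator_def)
  ultimately show "integrable lborel (\<lambda>x. (cmod (indicator A x))\<^sup>2)" by simp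
qed (use assms in measurable)

definition test_closure :: "l2 set" where
  "test_closure = closure (abs_l2 ` test_functions UNIV)"

lemma test_closure_test: "\<eta> \<in> test_functions UNIV \<Longrightarrow> abs_l2 \<eta> \<in> test_closure"
  unfolding test_closure_def by (intro subsetD[OF closure_subset] imageI)

lemma test_closure_lim: "(\<And>n. f n \<in> test_closure) \<Longrightarrow> f \<longlonglongrightarrow> l \<Longrightarrow> l \<in> test_closure"
  unfolding test_closure_def using closed_sequentially[OF closed_closure] by blast

lemma test_closure_add: assumes "a \<in> test_closure" "b \<in> test_closure" shows "a + b \<in> test_closure"
proof -
  obtain f g where f: "\<And>n. f n \<in> abs_l2 ` test_functions UNIV" "f \<longlonglongrightarrow> a"
    and g: "\<And>n. g n \<in> abs_l2 ` test_functions UNIV" "g \<longlonglongrightarrow> b"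
    using assms unfolding test_closure_def closure_sequential by blast
  have "f n + g n \<in> test_closure" for n
  proof -
    obtain u v where "u \<in> test_functions UNIV" "f n = abs_l2 u" "v \<in> test_functions UNIV" "g n = abs_l2 v"
      using f(1) g(1) by blast
    then show ?thesis
      using test_closure_test[OF test_add, of u v] by (simp add: abs_add test_L2)
  qed
  then show ?thesis by (rule test_closure_lim[OF _ tendsto_add[OF f(2) g(2)]])
qed

lemma test_closure_cmul: assumes "a \<in> test_closure" shows "cmul c a \<in> test_closure"
proof -
  obtain f where f: "\<And>n. f n \<in> abs_l2 ` test_functions UNIV" "f \<longlonglongrightarrow> a"
    using assms unfolding test_closure_def closure_sequential by blast
  have "cmul c (f n) \<in> test_closure" for n
  proof -
    obtain u where "u \<in> test_functions UNIV" "f n = abs_l2 u"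
      using f(1) by blast
    then show ?thesis
      using test_closure_test[OF test_cmul, of u c] by (simp add: abs_cmul test_L2)
  qed
  then show ?thesis
    by (rule test_closure_lim) (rule bounded_linear.tendsto[OF bounded_linear_cmul f(2)])
qed

lemma test_closure_0: "0 \<in> test_closure"
proof -
  have "(\<lambda>_. 0) \<in> test_functions UNIV"
    by (rule test_functionI[where K="{}"]) (auto simp: C_k_const)
  from test_closure_test[OF this] show ?thesis by (simp add: abs_zero)
qed

lemma test_closure_diff: "a \<in> test_closure \<Longrightarrow> b \<in> test_closure \<Longrightarrow> a - b \<in> test_closure"
  using test_closure_add[OF _ test_closure_cmul[of b "-1"], of a] cmul_of_real[of "-1" b] by simp

lemma test_closure_sum: "(\<And>i. i \<in> A \<Longrightarrow> f i \<in> test_closure) \<Longrightarrow> sum f A \<in> test_closure"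
  by (induction A rule: infinite_finite_induct) (auto simp: test_closure_0 test_closure_add)

lemma L2_indicator_box: "A \<in> sets borel \<Longrightarrow> (\<lambda>x. indicator (A \<inter> box a b) x) \<in> L2"
proof (rule L2_indicator)
  assume "A \<in> sets borel"
  have "emeasure lborel (A \<inter> box a b) \<le> emeasure lborel (box a b)"
    by (rule emeasure_mono) auto
  also have "\<dots> < \<infinity>" using emeasure_lborel_box_finite by simp
  finally show "emeasure lborel (A \<inter> box a b) < \<infinity>" .
qed auto

lemma test_closure_box: "abs_l2 (\<lambda>x. indicator (box a b) x) \<in> test_closure"
proof (rule test_closure_lim[OF _ L2_dominated_convergence(2)])
  show "abs_l2 (plateau n a b) \<in> test_closure" for n
    by (rule test_closure_test[OF plateau_test])
  show "plateau n a b \<in> L2" for n by (rule test_L2[OF plateau_test])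
  show box: "(\<lambda>x. indicator (box a b) x) \<in> L2"
    using L2_indicator_box[of UNIV a b] by simp
  show "(\<lambda>x. indicator (box a b) x :: complex) \<in> borel_measurable borel" by measurable
  show "AE x in lborel. (\<lambda>n. plateau n a b x) \<longlonglongrightarrow> indicator (box a b) x"
  proof (rule AE_I2)
    fix x
    show "(\<lambda>n. plateau n a b x) \<longlonglongrightarrow> indicator (box a b) x"
    proof (cases "x \<in> box a b")
      case True
      have "norm (exp (- bump a b x)) < 1" using bump_pos[OF True] by simp
      then have "(\<lambda>n. exp (- bump a b x) ^ n) \<longlonglongrightarrow> 0" by (rule LIMSEQ_power_zero)
      then have "(\<lambda>n. complex_of_real (1 - exp (- bump a b x) ^ n)) \<longlonglongrightarrow> complex_of_real (1 - 0)"
        by (intro tendsto_of_real tendsto_diff tendsto_const)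
      then show ?thesis
        using True by (simp add: plateau_def flip: exp_of_nat_mult)
    next
      case False
      then show ?thesis by (simp add: plateau_def bump_eq_0)
    qed
  qed
  show "AE x in lborel. cmod (plateau n a b x) \<le> cmod (indicator (box a b) x)" for n
  proof (rule AE_I2)
    fix x
    show "cmod (plateau n a b x) \<le> cmod (indicator (box a b) x)"
    proof (cases "x \<in> box a b")
      case True
      have "exp (- (real n * bump a b x)) \<le> 1" using bump_nonneg[of a b x] by simp
      then show ?thesis unfolding plateau_def using True
        by (simp only: norm_of_real) (simp add: abs_if)
    next
      case False
      then show ?thesis by (simp add: plateau_def bump_eq_0)
    qed
  qed
qed

text \<open>A Dynkin argument: the sets \<open>A\<close> with this property contain the
  intersection-stable family of boxes and are stable under complements and disjoint countable
  unions. Cutting with a fixed box keeps all measures finite, so that complements stay in L2 and its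
  indicator dominates the unions.\<close>

lemma test_closure_Int_box:
  assumes "A \<in> sets borel"
  shows "abs_l2 (\<lambda>x. indicator (A \<inter> box a b) x) \<in> test_closure"
proof -
  let ?G = "range (\<lambda>(a, b). box a b :: (real^3) set)"
  have sets: "sigma_sets UNIV ?G = sets borel"
    by (subst borel_eq_box) simp
  have "Int_stable ?G" by (auto simp: Int_stable_def box_Int_box)
  moreover have "?G \<subseteq> Pow UNIV" by simp
  moreover have "A \<in> sigma_sets UNIV ?G" using assms sets by simp
  ultimately show ?thesis
  proof (induction rule: sigma_sets_induct_disjoint)
    case (basic A)
    then obtain c d where "A = box c d" by auto
    then show ?case using test_closure_box by (auto simp: box_Int_box)
  next
    case empty
    then show ?case by (simp add: test_closure_0 abs_zero)
  next
    case (compl A)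
    have A: "A \<in> sets borel" using compl sets by simp
    have eq: "indicator ((UNIV - A) \<inter> box a b) = (\<lambda>x. indicator (box a b) x - (indicator (A \<inter> box a b) x :: complex))"
      by (auto simp: indicator_def)
    have "abs_l2 (\<lambda>x. indicator ((UNIV - A) \<inter> box a b) x) =
        abs_l2 (\<lambda>x. indicator (box a b) x) - abs_l2 (\<lambda>x. indicator (A \<inter> box a b) x)"
      unfolding eq using L2_indicator_box[of UNIV a b] L2_indicator_box[OF A, of a b]
      by (intro abs_diff) auto
    then show ?case using test_closure_diff[OF test_closure_box compl(2)] by simp
  next
    case (union A)
    have A: "A i \<in> sets borel" for i using union sets by auto
    have "abs_l2 (\<lambda>x. indicator ((\<Union>i<n. A i) \<inter> box a b) x) \<in> test_closure" for n
    proof -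
      have eq: "indicator ((\<Union>i<n. A i) \<inter> box a b) x = (\<Sum>i<n. indicator (A i \<inter> box a b) x :: complex)" for x
      proof -
        have "indicator (\<Union>i<n. A i) x = (\<Sum>i<n. indicator (A i) x :: complex)"
          using union(1) by (intro indicator_UN_disjoint) (auto simp: disjoint_family_on_def)
        then show ?thesis by (simp add: indicator_inter_arith sum_distrib_right)
      qed
      have "abs_l2 (\<lambda>x. \<Sum>i<n. indicator (A i \<inter> box a b) x) =
          (\<Sum>i<n. abs_l2 (\<lambda>x. indicator (A i \<inter> box a b) x))
          \<and> (\<lambda>x. \<Sum>i<n. indicator (A i \<inter> box a b) x) \<in> L2"
        by (induction n) (auto simp: abs_zero abs_add L2_add L2_indicator_box A)
      then show ?thesis
        unfolding eq using union(3) by (simp add: test_closure_sum)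
    qed
    then show ?case
    proof (rule test_closure_lim[OF _ L2_dominated_convergence(2)])
      show "(\<lambda>x. indicator ((\<Union>i<n. A i) \<inter> box a b) x) \<in> L2" for n
        using A by (intro L2_indicator_box) auto
      show "(\<lambda>x. indicator (box a b) x) \<in> L2"
        using L2_indicator_box[of UNIV a b] by simp
      show "(\<lambda>x. indicator ((\<Union>i. A i) \<inter> box a b) x :: complex) \<in> borel_measurable borel"
        using A by measurable
      show "AE x in lborel. (\<lambda>n. indicator ((\<Union>i<n. A i) \<inter> box a b) x :: complex)
          \<longlonglongrightarrow> indicator ((\<Union>i. A i) \<inter> box a b) x"
        using LIMSEQ_indicator_UN[of "A", where 'a=complex]
        by (intro AE_I2) (auto simp: indicator_inter_arith intro!: tendsto_intros)
    qed (auto simp: indicator_def)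
  qed
qed

text \<open>Simple functions converging pointwise to \<open>f\<close> with modulus at most 2 |f| are
  cut off to growing cubes. Each is a finite combination of indicators already treated, and 2 |f| is
  a majorant in L2.\<close>

lemma test_closure_UNIV: "a \<in> test_closure"
proof -
  define f where "f = rep_l2 a"
  have f: "f \<in> L2" by (simp add: f_def)
  obtain F where F: "\<And>i. simple_function borel (F i)" "\<And>x. (\<lambda>i. F i x) \<longlonglongrightarrow> f x"
    "\<And>i x. cmod (F i x) \<le> 2 * cmod (f x)"
    using borel_measurable_implies_sequence_metric[OF L2_measurable[OF f], of 0] by auto
  \<comment> \<open>The cubes exhaust the space, so at a given point the cutoff is eventually
    invisible.\<close>
  define K :: "nat \<Rightarrow> (real^3) set" where "K n = box (\<chi> i. - real n) (\<chi> i. real n)" for n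
  define g where "g n x = indicator (K n) x * F n x" for n x
  have Fm [measurable]: "F n \<in> borel_measurable borel" for n
    using F(1) by (rule borel_measurable_simple_function)
  have bound: "cmod (g n x) \<le> cmod (2 * f x)" for n x
    using F(3)[of n x] by (auto simp: g_def indicator_def norm_mult)
  have gL2: "g n \<in> L2" for n
    by (rule L2_dominated[OF _ L2_cmul[OF f, of 2]])
       (use bound in \<open>auto simp: g_def[abs_def] K_def\<close>)
  have "abs_l2 (g n) \<in> test_closure" for n
  proof -
    have fin: "finite (range (F n))" using simple_functionD(1)[OF F(1), of n] by simp
    have sets: "F n -` {y} \<in> sets borel" for y
      using simple_functionD(2)[OF F(1), of n "{y}"] by simp
    have L: "(\<lambda>x. y * indicator (F n -` {y} \<inter> K n) x) \<in> L2" for y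
      unfolding K_def by (intro L2_cmul L2_indicator_box sets)
    have "g n x = (\<Sum>y\<in>range (F n). y * indicator (F n -` {y} \<inter> K n) x)" for x
    proof -
      have "(\<Sum>y\<in>range (F n). y * indicator (F n -` {y} \<inter> K n) x)
          = (\<Sum>y\<in>range (F n). if y = F n x then F n x * indicator (K n) x else 0)"
        by (rule sum.cong) (auto simp: indicator_def)
      then show ?thesis using fin by (simp add: g_def mult.commute)
    qed
    then have eq: "g n = (\<lambda>x. \<Sum>y\<in>range (F n). y * indicator (F n -` {y} \<inter> K n) x)" by (rule ext)
    define u where "u y x = y * indicator (F n -` {y} \<inter> K n) x" for y x
    have u: "u y \<in> L2" for y using L by (simp add: u_def[abs_def])
    have au: "abs_l2 (u y) \<in> test_closure" for y
      unfolding u_def[abs_def] K_def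
      by (simp only: abs_cmul[OF L2_indicator_box[OF sets]])
         (intro test_closure_cmul test_closure_Int_box sets)
    have "finite B \<Longrightarrow> abs_l2 (\<lambda>x. \<Sum>y\<in>B. u y x) \<in> test_closure \<and> (\<lambda>x. \<Sum>y\<in>B. u y x) \<in> L2" for B
      by (induction B rule: finite_induct)
         (auto simp: abs_zero test_closure_0 abs_add u L2_add au test_closure_add)
    then show ?thesis
      unfolding eq using fin by (simp add: u_def)
  qed
  then have "abs_l2 f \<in> test_closure"
  proof (rule test_closure_lim[OF _ L2_dominated_convergence(2)[OF gL2 L2_measurable[OF f] L2_cmul[OF f, of 2]]])
    show "AE x in lborel. (\<lambda>n. g n x) \<longlonglongrightarrow> f x"
    proof (rule AE_I2)
      fix x :: "real^3"
      obtain N where N: "norm x < real N" using reals_Archimedean2 by blast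
      have "x \<in> K n" if "n \<ge> N" for n
        unfolding K_def mem_box_cart
      proof
        fix i
        have "\<bar>x $ i\<bar> < real n" using N that component_le_norm_cart[of x i] by linarith
        then show "(\<chi> i. - real n) $ i < x $ i \<and> x $ i < (\<chi> i. real n) $ i" by auto
      qed
      then have "\<forall>\<^sub>F n in sequentially. F n x = g n x"
        by (intro eventually_sequentiallyI[of N]) (simp add: g_def)
      then show "(\<lambda>n. g n x) \<longlonglongrightarrow> f x"
        by (rule Lim_transform_eventually[OF F(2)])
    qed
  qed (use bound in auto)
  then show ?thesis by (simp add: f_def)
qed

lemma test_dense: "closure (abs_l2 ` test_functions UNIV) = UNIV"
  using test_closure_UNIV by (auto simp: test_closure_def)

lemma test_approx:
  assumes "0 < e" obtains \<eta> where "\<eta> \<in> test_functions UNIV" "norm (a - abs_l2 \<eta>) < e"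
proof -
  have "a \<in> closure (abs_l2 ` test_functions UNIV)" by (simp add: test_dense)
  then obtain y where "y \<in> abs_l2 ` test_functions UNIV" "dist y a < e"
    using assms closure_approachable by blast
  then show thesis using that by (auto simp: dist_norm norm_minus_commute)
qed

section \<open>Translations and weak derivatives\<close>

lemma integrable_translate:
  fixes f :: "'a::euclidean_space \<Rightarrow> 'b::{banach, second_countable_topology}"
  assumes "f \<in> borel_measurable borel"
  shows "integrable lborel (\<lambda>x. f (x + a)) \<longleftrightarrow> integrable lborel f"
proof -
  have "integrable lborel f \<longleftrightarrow> integrable (distr lborel borel ((+) a)) f"
    by (simp only: lborel_distr_plus)
  also have "\<dots> \<longleftrightarrow> integrable lborel (\<lambda>x. f (a + x))"
    using assms by (intro integrable_distr_eq) auto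
  finally show ?thesis by (simp add: add.commute)
qed

lemma integral_translate:
  fixes f :: "'a::euclidean_space \<Rightarrow> 'b::{banach, second_countable_topology}"
  assumes "f \<in> borel_measurable borel"
  shows "(LINT x|lborel. f (x + a)) = (LINT x|lborel. f x)"
proof -
  have "(LINT x|lborel. f x) = (LINT x|distr lborel borel ((+) a). f x)"
    by (simp only: lborel_distr_plus)
  also have "\<dots> = (LINT x|lborel. f (a + x))"
    using assms by (intro integral_distr) auto
  finally show ?thesis by (simp add: add.commute)
qed

lemma AE_translate:
  fixes a :: "'a::euclidean_space"
  assumes "AE x in lborel. P x" shows "AE x in lborel. P (x + a)"
proof -
  have "AE x in distr lborel borel ((+) a). P x" using assms by (simp only: lborel_distr_plus)
  then have "AE x in lborel. P (a + x)"
    by (rule AE_distrD[rotated]) simp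
  then show ?thesis by (simp add: add.commute)
qed

lemma L2_translate: "f \<in> L2 \<Longrightarrow> (\<lambda>x. f (x + a)) \<in> L2"
  using integrable_translate[of "\<lambda>x. (cmod (f x))\<^sup>2" a]
  by (intro L2_I) (auto simp: L2_def)

lift_definition transl :: "real^3 \<Rightarrow> l2 \<Rightarrow> l2" is "\<lambda>a f x. f (x + a)"
proof (elim conjE, intro conjI L2_translate)
  show "AE x in lborel. f (x + a) = g (x + a)" if "AE x in lborel. f x = g x" for a :: "real^3" and f g :: "real^3 \<Rightarrow> complex"
    using that by (rule AE_translate)
qed

lemma transl_abs: "f \<in> L2 \<Longrightarrow> transl a (abs_l2 f) = abs_l2 (\<lambda>x. f (x + a))"
  by (simp add: transl.abs_eq)
lemma rep_transl: "AE x in lborel. rep_l2 (transl a f) x = rep_l2 f (x + a)"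
  using rep_abs[OF L2_translate[of "rep_l2 f" a]] by (simp flip: transl_abs)
lemma transl_add: "transl a (f + g) = transl a f + transl a g"
  by transfer (auto simp: L2_add L2_translate)
lemma transl_diff: "transl a (f - g) = transl a f - transl a g"
  by transfer (auto simp: L2_diff L2_translate)
lemma transl_scaleR: "transl a (r *\<^sub>R f) = r *\<^sub>R transl a f"
  by transfer (auto simp: L2_cmul L2_translate)
lemma transl_cmul: "transl a (cmul c f) = cmul c (transl a f)"
  by transfer (auto simp: L2_cmul L2_translate)
lemma transl_transl: "transl a (transl b f) = transl (a + b) f"
  by transfer (auto simp: L2_translate add.assoc)
lemma transl_0 [simp]: "transl 0 f = f"
  by transfer auto
lemma norm_transl [simp]: "norm (transl a f) = norm f"
proof transfer
  fix a f assume "f \<in> L2 \<and> f \<in> L2 \<and> (AE x in lborel. f x = f x)"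
  then show "norm_L2 (\<lambda>x. f (x + a)) = norm_L2 f"
    using integral_translate[of "\<lambda>x. (cmod (f x))\<^sup>2" a]
    by (simp add: norm_L2_def L2_measurable)
qed
lemma pair_transl: "pair (transl a f) g = pair f (transl (- a) g)"
proof transfer
  fix a f g assume "f \<in> L2 \<and> f \<in> L2 \<and> (AE x in lborel. f x = f x)"
    "g \<in> L2 \<and> g \<in> L2 \<and> (AE x in lborel. g x = g x)"
  then show "(LINT x|lborel. f (x + a) * g x) = (LINT x|lborel. f x * g (x + - a))"
    using integral_translate[of "\<lambda>x. f x * g (x - a)" a] L2_measurable[of f] L2_measurable[of g]
    by simp
qed
lemma inner_transl: "inner (transl a f) g = inner f (transl (- a) g)"
proof transfer
  fix a f g assume "f \<in> L2 \<and> f \<in> L2 \<and> (AE x in lborel. f x = f x)"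
    "g \<in> L2 \<and> g \<in> L2 \<and> (AE x in lborel. g x = g x)"
  then show "Re (LINT x|lborel. f (x + a) * cnj (g x)) = Re (LINT x|lborel. f x * cnj (g (x + - a)))"
    using integral_translate[of "\<lambda>x. f x * cnj (g (x - a))" a]
      L2_measurable[of f] L2_measurable[OF L2_cnj, of g]
    by (simp add: measurable_compose[of "\<lambda>x. x - a" borel borel "\<lambda>x. cnj (g x)"])
qed
lemma bounded_linear_transl: "bounded_linear (transl a)"
  by (rule bounded_linear_intro[where K=1]) (simp_all add: transl_add transl_scaleR)

text \<open>Restricting to sequences with |X n| at most 1 keeps all translated supports inside one
  bounded set, so that a single majorant serves in the dominated convergence of
  \<open>gen_test\<close>.\<close>

lemma tendsto_at_0_bounded_seq:
  fixes f :: "real \<Rightarrow> 'a::topological_space"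
  assumes "\<And>X. (\<And>n. X n \<noteq> 0) \<Longrightarrow> (\<And>n. \<bar>X n\<bar> \<le> 1) \<Longrightarrow> X \<longlonglongrightarrow> 0 \<Longrightarrow> (\<lambda>n. f (X n)) \<longlonglongrightarrow> l"
  shows "(f \<longlongrightarrow> l) (at 0)"
  unfolding tendsto_at_iff_sequentially
proof (intro allI impI)
  fix X :: "nat \<Rightarrow> real" assume X: "\<forall>i. X i \<in> UNIV - {0}" "X \<longlonglongrightarrow> 0"
  have "\<forall>\<^sub>F n in sequentially. \<bar>X n\<bar> < 1"
    using X(2) by (intro order_tendstoD(2)[OF tendsto_rabs_zero]) auto
  then obtain N where N: "\<And>n. n \<ge> N \<Longrightarrow> \<bar>X n\<bar> < 1" by (auto simp: eventually_sequentially)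
  have "(\<lambda>n. f (X (n + N))) \<longlonglongrightarrow> l"
    using X N by (intro assms) (auto intro: less_imp_le LIMSEQ_ignore_initial_segment)
  then show "(f \<circ> X) \<longlonglongrightarrow> l" by (simp add: comp_def LIMSEQ_offset)
qed

lemma has_vector_derivative_iff_quotient:
  "(f has_vector_derivative d) (at s) \<longleftrightarrow> ((\<lambda>h. (f (s + h) - f s) /\<^sub>R h) \<longlongrightarrow> d) (at 0)"
proof -
  have "(f has_vector_derivative d) (at s) \<longleftrightarrow>
      ((\<lambda>h. norm (f (s + h) - f s - h *\<^sub>R d) / norm h) \<longlongrightarrow> 0) (at 0)"
    by (simp add: has_vector_derivative_def has_derivative_at bounded_linear_scaleR_left)
  also have "\<dots> \<longleftrightarrow> ((\<lambda>h. norm ((f (s + h) - f s) /\<^sub>R h - d)) \<longlongrightarrow> 0) (at 0)"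
  proof (rule tendsto_cong)
    have "norm (f (s + h) - f s - h *\<^sub>R d) / norm h = norm ((f (s + h) - f s) /\<^sub>R h - d)" if "h \<noteq> 0" for h
    proof -
      have "(f (s + h) - f s) /\<^sub>R h - d = (f (s + h) - f s - h *\<^sub>R d) /\<^sub>R h"
        using that by (simp add: scaleR_diff_right)
      then show ?thesis by (simp add: divide_inverse mult.commute)
    qed
    then show "\<forall>\<^sub>F h in at 0. norm (f (s + h) - f s - h *\<^sub>R d) / norm h = norm ((f (s + h) - f s) /\<^sub>R h - d)"
      by (auto simp: eventually_at_filter)
  qed
  finally show ?thesis by (simp add: tendsto_norm_zero_iff LIM_zero_iff)
qed

lemma has_vector_derivative_bound:
  fixes f :: "real \<Rightarrow> 'a::real_normed_vector"
  assumes "convex S" "\<And>s. s \<in> S \<Longrightarrow> (f has_vector_derivative f' s) (at s within S)"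
    "\<And>s. s \<in> S \<Longrightarrow> norm (f' s) \<le> B" "a \<in> S" "b \<in> S"
  shows "norm (f a - f b) \<le> B * \<bar>a - b\<bar>"
proof -
  have "norm (f a - f b) \<le> B * norm (a - b)"
  proof (rule differentiable_bound[OF assms(1) _ _ assms(4,5)])
    show "(f has_derivative (\<lambda>k. k *\<^sub>R f' s)) (at s within S)" if "s \<in> S" for s
      using assms(2)[OF that] by (simp add: has_vector_derivative_def)
    show "onorm (\<lambda>k. k *\<^sub>R f' s) \<le> B" if "s \<in> S" for s
      using assms(3)[OF that]
      by (intro onorm_le) (simp add: mult.commute[of "\<bar>_\<bar>"] mult_right_mono)
  qed
  then show ?thesis by simp
qed

section \<open>Difference quotients and the generators of translations\<close>

definition dq :: "real^3 \<Rightarrow> real \<Rightarrow> l2 \<Rightarrow> l2" where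
  "dq v h f = (1 / h) *\<^sub>R (transl (h *\<^sub>R v) f - f)"

text \<open>The generator of the translation group along \<open>v\<close>, an unbounded operator,
  written as the relation "\<open>f\<close> lies in the domain and is mapped to \<open>g\<close>".
  \<open>gen_iff_weak\<close> identifies it with the weak directional derivative.\<close>

definition gen :: "real^3 \<Rightarrow> l2 \<Rightarrow> l2 \<Rightarrow> bool" where
  "gen v f g \<longleftrightarrow> ((\<lambda>h. dq v h f) \<longlongrightarrow> g) (at 0)"

lemma gen_test:
  assumes \<eta>: "\<eta> \<in> test_functions UNIV"
  shows "gen v (abs_l2 \<eta>) (abs_l2 (\<lambda>x. frechet_derivative \<eta> (at x) v))"
  unfolding gen_def
proof (rule tendsto_at_0_bounded_seq)
  fix X :: "nat \<Rightarrow> real"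
  assume X: "\<And>n. X n \<noteq> 0" "\<And>n. \<bar>X n\<bar> \<le> 1" "X \<longlonglongrightarrow> 0"
  define d where "d x = frechet_derivative \<eta> (at x) v" for x
  have d: "d \<in> test_functions UNIV" unfolding d_def by (rule test_partial[OF \<eta>])
  obtain K where K: "compact K" "\<And>x. x \<notin> K \<Longrightarrow> \<eta> x = 0" using test_support[OF \<eta>] by blast
  obtain K' where K': "compact K'" "\<And>x. x \<notin> K' \<Longrightarrow> d x = 0" using test_support[OF d] by blast
  obtain B where B: "\<And>x. cmod (d x) \<le> B" "0 \<le> B"
  proof -
    have "bounded (d ` K')"
      by (intro compact_imp_bounded compact_continuous_image test_continuous[OF d] K')
    then obtain B where "\<And>x. x \<in> K' \<Longrightarrow> cmod (d x) \<le> B" by (auto simp: bounded_iff)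
    then have "cmod (d x) \<le> max B 0" for x using K'(2)[of x] by (cases "x \<in> K'") force+
    then show thesis by (intro that[of "max B 0"]) auto
  qed
  \<comment> \<open>One box contains every translate of the support by \<open>s\<close> times
    \<open>v\<close> with |s| at most 1. Outside it all quotients vanish; inside, the mean value
    inequality bounds them by \<open>B\<close>.\<close>
  have "bounded ((\<lambda>(x, s). x - s *\<^sub>R v) ` (K \<times> {-1..1}))"
    by (intro compact_imp_bounded compact_continuous_image compact_Times K)
       (auto intro!: continuous_intros simp: split_beta)
  then obtain a b where ab: "(\<lambda>(x, s). x - s *\<^sub>R v) ` (K \<times> {-1..1}) \<subseteq> box a b"
    using bounded_subset_box_symmetric by metis
  define w where "w x = of_real B * (indicator (box a b) x :: complex)" for x
  have w: "w \<in> L2" unfolding w_def using L2_indicator_box[of UNIV a b] by (intro L2_cmul) simp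
  have deriv: "((\<lambda>s. \<eta> (x + s *\<^sub>R v)) has_vector_derivative d (x + s *\<^sub>R v)) (at s)" for x s
  proof -
    have "((\<lambda>s. x + s *\<^sub>R v) has_derivative (\<lambda>k. k *\<^sub>R v)) (at s)"
      by (auto intro!: derivative_eq_intros)
    from has_derivative_compose[OF this test_has_derivative[OF \<eta>]]
    have "((\<lambda>s. \<eta> (x + s *\<^sub>R v)) has_derivative (\<lambda>k. frechet_derivative \<eta> (at (x + s *\<^sub>R v)) (k *\<^sub>R v))) (at s)" .
    moreover have "frechet_derivative \<eta> (at y) (k *\<^sub>R v) = k *\<^sub>R d y" for y k
      unfolding d_def using linear_frechet_derivative test_has_derivative[OF \<eta>]
      by (metis differentiableI linear_cmul)
    ultimately show ?thesis by (simp add: has_vector_derivative_def)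
  qed
  define q where "q n x = of_real (1 / X n) * (\<eta> (x + X n *\<^sub>R v) - \<eta> x)" for n x
  have \<eta>2: "\<eta> \<in> L2" by (rule test_L2[OF \<eta>])
  have q: "q n \<in> L2" for n
    unfolding q_def by (intro L2_cmul L2_diff L2_translate \<eta>2)
  have "dq v (X n) (abs_l2 \<eta>) = abs_l2 (q n)" for n
    unfolding dq_def q_def by (simp only: transl_abs \<eta>2 abs_diff abs_scaleR L2_translate L2_diff)
  moreover have "(\<lambda>n. abs_l2 (q n)) \<longlonglongrightarrow> abs_l2 d"
  proof (rule L2_dominated_convergence(2)[OF q _ w])
    show "d \<in> borel_measurable borel" by (rule L2_measurable[OF test_L2[OF d]])
    show "AE x in lborel. (\<lambda>n. q n x) \<longlonglongrightarrow> d x"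
    proof (rule AE_I2)
      fix x
      have "((\<lambda>h. (\<eta> (x + h *\<^sub>R v) - \<eta> x) /\<^sub>R h) \<longlongrightarrow> d x) (at 0)"
        using deriv[of x 0] by (simp add: has_vector_derivative_iff_quotient)
      then have "(\<lambda>n. (\<eta> (x + X n *\<^sub>R v) - \<eta> x) /\<^sub>R X n) \<longlonglongrightarrow> d x"
        using X by (auto simp: tendsto_at_iff_sequentially comp_def)
      then show "(\<lambda>n. q n x) \<longlonglongrightarrow> d x"
        by (simp add: q_def scaleR_conv_of_real divide_inverse)
    qed
    fix n
    show "AE x in lborel. cmod (q n x) \<le> cmod (w x)"
    proof (rule AE_I2)
      fix x
      show "cmod (q n x) \<le> cmod (w x)"
      proof (cases "x \<in> box a b")
        case True
        have "cmod (\<eta> (x + X n *\<^sub>R v) - \<eta> (x + 0 *\<^sub>R v)) \<le> B * \<bar>X n - 0\<bar>"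
          by (rule has_vector_derivative_bound[OF convex_UNIV deriv]) (use B in auto)
        then show ?thesis
          using True B(2) X(1)[of n] by (simp add: q_def w_def norm_mult norm_divide field_simps)
      next
        case False
        have "x + s *\<^sub>R v \<notin> K" if "\<bar>s\<bar> \<le> 1" for s
        proof
          assume "x + s *\<^sub>R v \<in> K"
          then have "(x + s *\<^sub>R v) - s *\<^sub>R v \<in> (\<lambda>(x, s). x - s *\<^sub>R v) ` (K \<times> {-1..1})"
            using that by (intro image_eqI[where x="(x + s *\<^sub>R v, s)"]) auto
          then show False using False ab by auto
        qed
        from this[of "X n"] this[of 0] have "q n x = 0" using X(2)[of n] K(2) by (simp add: q_def)
        then show ?thesis by simp
      qed
    qed
  qed
  ultimately show "(\<lambda>n. dq v (X n) (abs_l2 \<eta>)) \<longlonglongrightarrow> abs_l2 (\<lambda>x. frechet_derivative \<eta> (at x) v)"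
    by (simp add: d_def[abs_def])
qed

lemma tendsto_transl_0_of_gen:
  assumes "gen v f g" shows "((\<lambda>h. transl (h *\<^sub>R v) f) \<longlongrightarrow> f) (at 0)"
proof -
  have "((\<lambda>h. f + h *\<^sub>R dq v h f) \<longlongrightarrow> f + 0 *\<^sub>R g) (at 0)"
    using assms unfolding gen_def by (intro tendsto_intros)
  then have "((\<lambda>h. f + h *\<^sub>R dq v h f) \<longlongrightarrow> f) (at 0)" by simp
  then show ?thesis
    by (rule Lim_transform_eventually) (auto simp: dq_def eventually_at_filter)
qed

text \<open>True for test functions, where even the difference quotients converge; it extends to all
  of L2 because translations are isometric and test functions dense.\<close>

lemma tendsto_transl_0: "((\<lambda>h. transl (h *\<^sub>R v) f) \<longlongrightarrow> f) (at 0)"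
proof (rule tendstoI)
  fix e :: real assume "0 < e"
  then obtain \<eta> where \<eta>: "\<eta> \<in> test_functions UNIV" "norm (f - abs_l2 \<eta>) < e / 3"
    using test_approx[of "e / 3"] by auto
  have "\<forall>\<^sub>F h in at 0. dist (transl (h *\<^sub>R v) (abs_l2 \<eta>)) (abs_l2 \<eta>) < e / 3"
    using tendsto_transl_0_of_gen[OF gen_test[OF \<eta>(1)]] \<open>0 < e\<close> by (intro tendstoD) auto
  then show "\<forall>\<^sub>F h in at 0. dist (transl (h *\<^sub>R v) f) f < e"
  proof eventually_elim
    case (elim h)
    have "transl (h *\<^sub>R v) f - f = transl (h *\<^sub>R v) (f - abs_l2 \<eta>) + (transl (h *\<^sub>R v) (abs_l2 \<eta>) - abs_l2 \<eta>) - (f - abs_l2 \<eta>)"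
      by (simp add: transl_diff)
    then have "norm (transl (h *\<^sub>R v) f - f) \<le> norm (transl (h *\<^sub>R v) (f - abs_l2 \<eta>))
        + norm (transl (h *\<^sub>R v) (abs_l2 \<eta>) - abs_l2 \<eta>) + norm (f - abs_l2 \<eta>)"
      by (simp only:) (rule order_trans[OF norm_triangle_ineq4 add_right_mono[OF norm_triangle_ineq]])
    then show ?case using elim \<eta>(2) by (simp add: dist_norm)
  qed
qed

lemma dq_add: "dq v h (f + g) = dq v h f + dq v h g"
  by (simp add: dq_def transl_add algebra_simps)
lemma dq_diff: "dq v h (f - g) = dq v h f - dq v h g"
  by (simp add: dq_def transl_diff algebra_simps)
lemma dq_scaleR: "dq v h (r *\<^sub>R f) = r *\<^sub>R dq v h f"
  by (simp add: dq_def transl_scaleR algebra_simps)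
lemma dq_cmul: "dq v h (cmul c f) = cmul c (dq v h f)"
  by (simp add: dq_def transl_cmul cmul_diff cmul_scaleR)
lemma dq_transl: "dq v h (transl a f) = transl a (dq v h f)"
  by (simp add: dq_def transl_transl transl_diff transl_scaleR add.commute)
lemma bounded_linear_dq: "bounded_linear (dq v h)"
  unfolding dq_def
  by (intro bounded_linear_intros bounded_linear_compose[OF bounded_linear_transl])

lemma gen_unique: "gen v f g \<Longrightarrow> gen v f g' \<Longrightarrow> g = g'"
  unfolding gen_def by (rule tendsto_unique) auto
lemma gen_add: "gen v f g \<Longrightarrow> gen v f' g' \<Longrightarrow> gen v (f + f') (g + g')"
  unfolding gen_def dq_add by (rule tendsto_add)
lemma gen_diff: "gen v f g \<Longrightarrow> gen v f' g' \<Longrightarrow> gen v (f - f') (g - g')"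
  unfolding gen_def dq_diff by (rule tendsto_diff)
lemma gen_scaleR: "gen v f g \<Longrightarrow> gen v (r *\<^sub>R f) (r *\<^sub>R g)"
  unfolding gen_def dq_scaleR by (intro tendsto_intros)
lemma gen_cmul: "gen v f g \<Longrightarrow> gen v (cmul c f) (cmul c g)"
  unfolding gen_def dq_cmul by (rule bounded_linear.tendsto[OF bounded_linear_cmul])
lemma gen_0: "gen v 0 0"
  using gen_scaleR[of v 0 _ 0] gen_test[OF plateau_test, of v 0 0 0] gen_scaleR[of v _ _ 0] by fastforce
text \<open>An operator commuting with translations commutes with difference quotients and, being
  continuous, with their limit. This is how the free group comes to act on weak gradients.\<close>

lemma gen_bounded_linear:
  assumes "bounded_linear L" "\<And>a f. L (transl a f) = transl a (L f)" "gen v f g"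
  shows "gen v (L f) (L g)"
proof -
  interpret L: bounded_linear L by fact
  have "L (dq v h f) = dq v h (L f)" for h
    by (simp add: dq_def L.scaleR L.diff assms(2))
  then show ?thesis
    using L.tendsto[OF assms(3)[unfolded gen_def]] by (simp add: gen_def)
qed
lemma gen_transl: "gen v f g \<Longrightarrow> gen v (transl a f) (transl a g)"
  by (rule gen_bounded_linear[OF bounded_linear_transl]) (simp_all add: transl_transl add.commute)
lemma gen_dq: "gen v f g \<Longrightarrow> gen v (dq w h f) (dq w h g)"
  by (rule gen_bounded_linear[OF bounded_linear_dq]) (simp_all add: dq_transl)

lemma gen_has_vector_derivative:
  assumes "gen v f g"
  shows "((\<lambda>s. transl (s *\<^sub>R v) f) has_vector_derivative transl (s *\<^sub>R v) g) (at s within S)"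
proof -
  have "((\<lambda>h. dq v h (transl (s *\<^sub>R v) f)) \<longlongrightarrow> transl (s *\<^sub>R v) g) (at 0)"
    using gen_transl[OF assms] by (simp add: gen_def)
  then have "((\<lambda>h. (transl ((s + h) *\<^sub>R v) f - transl (s *\<^sub>R v) f) /\<^sub>R h) \<longlongrightarrow> transl (s *\<^sub>R v) g) (at 0)"
    by (simp add: dq_def transl_transl scaleR_add_left add.commute inverse_eq_divide)
  then have "((\<lambda>s. transl (s *\<^sub>R v) f) has_vector_derivative transl (s *\<^sub>R v) g) (at s)"
    by (simp add: has_vector_derivative_iff_quotient)
  then show ?thesis by (rule has_vector_derivative_at_within)
qed

text \<open>The mean value inequality along the orbit of \<open>f\<close> under translations. The
  bound is uniform in \<open>h\<close>, which makes it the majorant in later limits.\<close>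

lemma norm_dq_le: assumes "gen v f g" shows "norm (dq v h f) \<le> norm g"
proof -
  have "norm (transl (h *\<^sub>R v) f - transl (0 *\<^sub>R v) f) \<le> norm g * \<bar>h - 0\<bar>"
    by (rule has_vector_derivative_bound[OF convex_UNIV gen_has_vector_derivative[OF assms]]) auto
  then show ?thesis unfolding dq_def norm_scaleR by (cases "h = 0") (simp_all add: divide_simps mult.commute)
qed

text \<open>The difference dq f - g lies in the domain of the generator, with image dq g - k. Hence
  by \<open>norm_dq_le\<close> a further quotient of it is at most |dq g - k|, which tends to
  zero.\<close>

lemma tendsto_dq_dq:
  assumes "gen v f g" "gen v g k" shows "((\<lambda>h. dq v h (dq v h f)) \<longlongrightarrow> k) (at 0)"
proof -
  have "((\<lambda>h. dq v h (dq v h f) - dq v h g) \<longlongrightarrow> 0) (at 0)"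
  proof (rule Lim_null_comparison)
    show "\<forall>\<^sub>F h in at 0. norm (dq v h (dq v h f) - dq v h g) \<le> norm (dq v h g - k)"
      using norm_dq_le[OF gen_diff[OF gen_dq[OF assms(1)] assms(2)]]
      by (intro always_eventually) (simp add: dq_diff)
    show "((\<lambda>h. norm (dq v h g - k)) \<longlongrightarrow> 0) (at 0)"
      using assms(2) unfolding gen_def by (intro tendsto_norm_zero LIM_zero)
  qed
  from tendsto_add[OF this assms(2)[unfolded gen_def]] show ?thesis by simp
qed

text \<open>By density the bound holds against every \<open>b\<close>; for \<open>b\<close> the
  complex conjugate of \<open>a\<close> the pairing is the square of the norm.\<close>

lemma norm_le_pair_test:
  assumes "\<And>\<eta>. \<eta> \<in> test_functions UNIV \<Longrightarrow> cmod (pair a (abs_l2 \<eta>)) \<le> C * norm (abs_l2 \<eta>)"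
    and "0 \<le> C"
  shows "norm a \<le> C"
proof -
  have "closed {b. cmod (pair a b) \<le> C * norm b}"
    by (intro closed_Collect_le continuous_intros bounded_linear.continuous_on[OF pair.bounded_linear_right])
  then have "closure (abs_l2 ` test_functions UNIV) \<subseteq> {b. cmod (pair a b) \<le> C * norm b}"
    using assms by (intro closure_minimal) auto
  then have le: "cmod (pair a b) \<le> C * norm b" for b by (auto simp: test_dense)
  define b where "b = abs_l2 (\<lambda>x. cnj (rep_l2 a x))"
  have nb: "norm b = norm a"
    unfolding b_def norm_abs[OF L2_cnj[OF rep_in_L2]] norm_rep[of a] norm_L2_def by simp
  have "pair (abs_l2 (rep_l2 a)) b = (LINT x|lborel. rep_l2 a x * cnj (rep_l2 a x))"
    unfolding b_def by (rule pair_abs) (auto simp: L2_cnj)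
  then have "pair a b = of_real ((norm a)\<^sup>2)" by (simp add: inner_self_integral norm_sq_l2)
  with le[of b] nb have "norm a * norm a \<le> C * norm a" by (simp add: power2_eq_square norm_mult)
  then show ?thesis using \<open>0 \<le> C\<close> by (cases "norm a = 0") (auto simp: mult_le_cancel_right)
qed

lemma frechet_derivative_translate:
  assumes "\<eta> \<in> test_functions UNIV"
  shows "frechet_derivative (\<lambda>x. \<eta> (x + a)) (at x) v = frechet_derivative \<eta> (at (x + a)) v"
proof -
  have "((\<lambda>x. x + a) has_derivative (\<lambda>v. v)) (at x)" by (auto intro!: derivative_eq_intros)
  from has_derivative_compose[OF this test_has_derivative[OF assms]]
  show ?thesis using frechet_derivative_at by fastforce
qed

text \<open>From left to right, the quotient is moved onto the test function, where it becomes the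
  quotient with the opposite step. Conversely, the weak identity for all translates of a test
  function shows that s -> pair f (T_s eta) + s pair g eta has derivative -pair (T_-s g - g) eta.
  This is small, uniformly relative to |eta|, by continuity of translation, and duality turns the
  resulting increment bound into a bound on dq f - g.\<close>

lemma gen_iff_weak:
  "gen v f g \<longleftrightarrow> (\<forall>\<eta>\<in>test_functions UNIV.
     pair f (abs_l2 (\<lambda>x. frechet_derivative \<eta> (at x) v)) = - pair g (abs_l2 \<eta>))"
proof
  assume *: "gen v f g"
  show "\<forall>\<eta>\<in>test_functions UNIV. pair f (abs_l2 (\<lambda>x. frechet_derivative \<eta> (at x) v)) = - pair g (abs_l2 \<eta>)"
  proof
    fix \<eta> :: "real^3 \<Rightarrow> complex" assume \<eta>: "\<eta> \<in> test_functions UNIV"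
    let ?d = "abs_l2 (\<lambda>x. frechet_derivative \<eta> (at x) v)"
    have "((\<lambda>h. pair f (dq v h (abs_l2 \<eta>))) \<longlongrightarrow> pair f ?d) (at 0)"
      using gen_test[OF \<eta>, of v] unfolding gen_def
      by (rule bounded_linear.tendsto[OF pair.bounded_linear_right])
    moreover have "((\<lambda>h. pair f (dq v h (abs_l2 \<eta>))) \<longlongrightarrow> - pair g (abs_l2 \<eta>)) (at 0)"
    proof -
      have "((\<lambda>h. dq v (- h) f) \<longlongrightarrow> g) (at 0)"
      proof (rule filterlim_compose[OF *[unfolded gen_def]])
        show "filterlim uminus (at 0) (at (0::real))"
          by (rule filterlim_atI) (auto intro!: tendsto_eq_intros simp: eventually_at_filter)
      qed
      then have "((\<lambda>h. - pair (dq v (- h) f) (abs_l2 \<eta>)) \<longlongrightarrow> - pair g (abs_l2 \<eta>)) (at 0)"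
        by (intro tendsto_minus bounded_linear.tendsto[OF pair.bounded_linear_left])
      moreover have "- pair (dq v (- h) f) (abs_l2 \<eta>) = pair f (dq v h (abs_l2 \<eta>))" for h
        by (simp add: dq_def pair.scaleR_left pair.scaleR_right pair.diff_left pair.diff_right pair.minus_left pair_transl algebra_simps)
      ultimately show ?thesis by simp
    qed
    ultimately show "pair f ?d = - pair g (abs_l2 \<eta>)" by (rule tendsto_unique[rotated]) simp
  qed
next
  assume weak: "\<forall>\<eta>\<in>test_functions UNIV. pair f (abs_l2 (\<lambda>x. frechet_derivative \<eta> (at x) v)) = - pair g (abs_l2 \<eta>)"
  show "gen v f g"
    unfolding gen_def
  proof (rule tendstoI)
    fix e :: real assume "0 < e"
    then have "\<forall>\<^sub>F h in at 0. dist (transl (h *\<^sub>R v) g) g < e / 2"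
      by (intro tendstoD[OF tendsto_transl_0]) auto
    then obtain d where d: "0 < d" "\<And>s. s \<noteq> 0 \<Longrightarrow> \<bar>s\<bar> < d \<Longrightarrow> dist (transl (s *\<^sub>R v) g) g < e / 2"
      by (auto simp: eventually_at)
    then have d': "norm (transl (s *\<^sub>R v) g - g) \<le> e / 2" if "\<bar>s\<bar> < d" for s
      using that \<open>0 < e\<close> by (cases "s = 0") (auto simp: dist_norm less_imp_le)
    have "norm (dq v h f - g) \<le> e / 2" if h: "h \<noteq> 0" "\<bar>h\<bar> < d" for h
    proof (rule norm_le_pair_test)
      fix \<eta> :: "real^3 \<Rightarrow> complex" assume \<eta>: "\<eta> \<in> test_functions UNIV"
      let ?d = "abs_l2 (\<lambda>x. frechet_derivative \<eta> (at x) v)" and ?e = "abs_l2 \<eta>"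
      \<comment> \<open>The linear term subtracts the expected increment, so that the derivative is
        small instead of merely bounded.\<close>
      define \<phi> where "\<phi> s = pair f (transl (s *\<^sub>R v) ?e) + s *\<^sub>R pair g ?e" for s
      have "(\<phi> has_vector_derivative - pair (transl (- (s *\<^sub>R v)) g - g) ?e) (at s within {-\<bar>h\<bar>..\<bar>h\<bar>})" for s
      proof -
        have "pair f (transl (s *\<^sub>R v) ?d) = - pair g (transl (s *\<^sub>R v) ?e)"
          using bspec[OF weak test_translate[OF \<eta>, of "s *\<^sub>R v"]]
          by (simp add: frechet_derivative_translate[OF \<eta>] transl_abs test_L2 \<eta> test_partial)
        then have "pair f (transl (s *\<^sub>R v) ?d) + pair g ?e = - pair (transl (- (s *\<^sub>R v)) g - g) ?e"
          by (simp add: pair_transl pair.diff_left)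
        moreover have "(\<phi> has_vector_derivative pair f (transl (s *\<^sub>R v) ?d) + pair g ?e) (at s within {-\<bar>h\<bar>..\<bar>h\<bar>})"
          unfolding \<phi>_def
          by (auto intro!: derivative_eq_intros
              bounded_linear.has_vector_derivative[OF pair.bounded_linear_right]
              gen_has_vector_derivative gen_test[OF \<eta>])
        ultimately show ?thesis by simp
      qed
      then have le: "norm (\<phi> (- h) - \<phi> 0) \<le> (e / 2 * norm ?e) * \<bar>- h - 0\<bar>"
      proof (rule has_vector_derivative_bound[rotated])
        show "norm (- pair (transl (- (s *\<^sub>R v)) g - g) ?e) \<le> e / 2 * norm ?e" if "s \<in> {-\<bar>h\<bar>..\<bar>h\<bar>}" for s
        proof -
          have "norm (- pair (transl (- (s *\<^sub>R v)) g - g) ?e) \<le> norm (transl ((- s) *\<^sub>R v) g - g) * norm ?e"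
            by (simp add: norm_pair_le)
          also have "\<dots> \<le> e / 2 * norm ?e"
            using that h by (intro mult_right_mono d') auto
          finally show ?thesis .
        qed
      qed auto
      \<comment> \<open>Evaluation at -h, because a translation by \<open>h\<close> changes sign
        when it passes from \<open>f\<close> to the test function.\<close>
      have eq: "\<phi> (- h) - \<phi> 0 = h *\<^sub>R pair (dq v h f - g) ?e"
        using h by (simp add: \<phi>_def dq_def pair.scaleR_left pair.diff_left pair_transl scaleR_diff_right)
      have "\<bar>h\<bar> * cmod (pair (dq v h f - g) ?e) \<le> \<bar>h\<bar> * (e / 2 * norm ?e)"
        using le unfolding eq norm_scaleR diff_0_right abs_minus_cancel
        by (simp only: mult.commute[of "e / 2 * norm ?e" "\<bar>h\<bar>"] real_norm_def)
      then show "cmod (pair (dq v h f - g) ?e) \<le> e / 2 * norm ?e"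
        by (rule mult_left_le_imp_le) (use h in simp)
    qed (use \<open>0 < e\<close> in simp)
    then have "dist (dq v h f) g < e" if "h \<noteq> 0" "\<bar>h\<bar> < d" for h
      using le_less_trans[of "norm (dq v h f - g)" "e / 2" e] that \<open>0 < e\<close> by (simp add: dist_norm)
    then show "\<forall>\<^sub>F h in at 0. dist (dq v h f) g < e"
      unfolding eventually_at using d(1) by (intro exI[of _ d]) simp
  qed
qed

text \<open>The weak form is linear and continuous in \<open>f\<close> and \<open>g\<close>, so it
  survives norm limits. Closedness of \<open>sobolev\<close>, on which the fixed point argument
  rests, follows.\<close>

lemma gen_closed:
  assumes "\<And>n. gen v (f n) (g n)" "f \<longlonglongrightarrow> f'" "g \<longlonglongrightarrow> g'" shows "gen v f' g'"
  unfolding gen_iff_weak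
proof
  fix \<eta> :: "real^3 \<Rightarrow> complex" assume \<eta>: "\<eta> \<in> test_functions UNIV"
  let ?d = "abs_l2 (\<lambda>x. frechet_derivative \<eta> (at x) v)"
  have "(\<lambda>n. pair (f n) ?d) \<longlonglongrightarrow> pair f' ?d"
    by (rule bounded_linear.tendsto[OF pair.bounded_linear_left assms(2)])
  moreover have "(\<lambda>n. - pair (g n) (abs_l2 \<eta>)) \<longlonglongrightarrow> - pair g' (abs_l2 \<eta>)"
    by (intro tendsto_minus bounded_linear.tendsto[OF pair.bounded_linear_left assms(3)])
  moreover have "pair (f n) ?d = - pair (g n) (abs_l2 \<eta>)" for n
    using assms(1)[of n] \<eta> unfolding gen_iff_weak by blast
  ultimately show "pair f' ?d = - pair g' (abs_l2 \<eta>)" by (simp add: LIMSEQ_unique)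
qed

section \<open>Exponentials of skew operators and their limits\<close>

definition opexp :: "('a::banach \<Rightarrow> 'a) \<Rightarrow> real \<Rightarrow> 'a \<Rightarrow> 'a" where
  "opexp B t x = (\<Sum>k. (t ^ k / fact k) *\<^sub>R (B ^^ k) x)"

lemma opexp_0 [simp]: "opexp B 0 x = x"
proof -
  have "(\<lambda>k. (0 ^ k / fact k) *\<^sub>R (B ^^ k) x) sums (\<Sum>k\<in>{0}. (0 ^ k / fact k) *\<^sub>R (B ^^ k) x)"
    by (rule sums_finite) auto
  then show ?thesis by (simp add: opexp_def sums_iff)
qed

lemma funpow_commute_arg:
  assumes "\<And>x. L (B x) = B (L x)" shows "L ((B ^^ k) x) = (B ^^ k) (L x)"
  by (induction k) (auto simp: assms)

text \<open>Termwise differentiation of the power series: the derivatives of the partial sums are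
  the shifted partial sums at \<open>B x\<close>, and these converge uniformly on bounded intervals
  by the Weierstrass test.\<close>

lemma opexp_has_vector_derivative:
  fixes B :: "'a::banach \<Rightarrow> 'a"
  assumes B: "bounded_linear B"
  shows "((\<lambda>t. opexp B t x) has_vector_derivative B (opexp B t x)) (at t)"
proof -
  interpret B: bounded_linear B by fact
  obtain K where K: "0 \<le> K" "\<And>x. norm (B x) \<le> norm x * K" using B.nonneg_bounded by blast
  define u where "u y k t = (t ^ k / fact k) *\<^sub>R (B ^^ k) y" for y k and t :: real
  have normB: "norm ((B ^^ k) y) \<le> K ^ k * norm y" for k y
  proof (induction k)
    case (Suc k)
    have "norm ((B ^^ Suc k) y) \<le> norm ((B ^^ k) y) * K" using K(2) by simp
    also have "\<dots> \<le> (K ^ k * norm y) * K" by (rule mult_right_mono[OF Suc K(1)])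
    finally show ?case by (simp add: mult_ac)
  qed simp
  have bound: "norm (u y k s) \<le> (R * K) ^ k / fact k * norm y" if "\<bar>s\<bar> \<le> R" for y k s R
  proof -
    have "norm (u y k s) \<le> \<bar>s\<bar> ^ k / fact k * (K ^ k * norm y)"
      unfolding u_def by (simp add: power_abs mult_left_mono normB divide_right_mono)
    also have "\<dots> \<le> R ^ k / fact k * (K ^ k * norm y)"
      using that K(1) by (intro mult_right_mono divide_right_mono power_mono) auto
    finally show ?thesis by (simp add: power_mult_distrib)
  qed
  have summ: "summable (\<lambda>k. (R * K) ^ k / fact k * norm y)" for R y
    using summable_exp[of "R * K"] by (intro summable_mult2) (simp add: divide_inverse mult.commute)
  have conv: "(\<lambda>k. u y k s) sums opexp B s y" for y s
  proof -
    have "summable (\<lambda>k. u y k s)"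
      by (rule summable_comparison_test'[OF summ[of "\<bar>s\<bar>" y]]) (rule bound, simp)
    then show ?thesis by (simp add: opexp_def u_def summable_sums)
  qed
  have Bexp: "B (opexp B s y) = opexp B s (B y)" for s y
  proof -
    have "(\<lambda>k. B (u y k s)) sums B (opexp B s y)" using B.sums[OF conv] .
    moreover have "B (u y k s) = u (B y) k s" for k
      by (simp add: u_def B.scaleR funpow_commute_arg[of B B])
    ultimately show ?thesis using conv[of "B y" s] by (simp add: sums_unique2)
  qed
  have unif: "uniform_limit {-R..R} (\<lambda>n s. \<Sum>k<n. u (B x) k s) (\<lambda>s. opexp B s (B x)) sequentially" for R
  proof -
    have "uniform_limit {-R..R} (\<lambda>n s. \<Sum>k<n. u (B x) k s) (\<lambda>s. suminf (\<lambda>k. u (B x) k s)) sequentially"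
      by (rule Weierstrass_m_test[OF bound summ[of R]]) auto
    then show ?thesis by (simp add: sums_unique[OF conv, symmetric])
  qed
  \<comment> \<open>Larger than |t|, so that \<open>t\<close> is interior and the derivative within
    the interval is a full derivative.\<close>
  define R where "R = \<bar>t\<bar> + 1"
  have "\<exists>g. \<forall>s\<in>{-R..R}. (\<lambda>n. \<Sum>k\<le>n. u x k s) \<longlonglongrightarrow> g s \<and>
      (g has_derivative (\<lambda>h. h *\<^sub>R opexp B s (B x))) (at s within {-R..R})"
  proof (rule has_derivative_sequence)
    show "convex {-R..R}" by simp
    show "0 \<in> {-R..R}" by (simp add: R_def)
    show "(\<lambda>n. \<Sum>k\<le>n. u x k 0) \<longlonglongrightarrow> opexp B 0 x"
      using conv[of x 0] by (simp add: sums_def_le)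
    show "((\<lambda>s. \<Sum>k\<le>n. u x k s) has_derivative (\<lambda>h. h *\<^sub>R (\<Sum>k<n. u (B x) k s))) (at s within {-R..R})" for n s
    proof (induction n)
      case 0
      then show ?case by (simp add: u_def)
    next
      case (Suc n)
      have "((\<lambda>s. s ^ Suc n / fact (Suc n)) has_real_derivative (real (Suc n) * s ^ n / fact (Suc n))) (at s within {-R..R})"
        using DERIV_pow[of "Suc n" s "{-R..R}"] by (intro DERIV_cdivide) simp
      moreover have "real (Suc n) * s ^ n / fact (Suc n) = s ^ n / fact n"
        by (simp add: fact_Suc del: of_nat_Suc)
      ultimately have "((\<lambda>s. s ^ Suc n / fact (Suc n)) has_real_derivative (s ^ n / fact n)) (at s within {-R..R})"
        by (simp only:)
      then have "((\<lambda>s. (s ^ Suc n / fact (Suc n)) *\<^sub>R (B ^^ Suc n) x) has_derivative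
          (\<lambda>h. ((s ^ n / fact n) * h) *\<^sub>R (B ^^ Suc n) x)) (at s within {-R..R})"
        unfolding has_field_derivative_def by (intro has_derivative_scaleR_left)
      then have "((\<lambda>s. u x (Suc n) s) has_derivative (\<lambda>h. h *\<^sub>R u (B x) n s)) (at s within {-R..R})"
        by (simp add: u_def funpow_swap1 mult.commute)
      from has_derivative_add[OF Suc.IH this] show ?case by (simp add: scaleR_add_right)
    qed
    fix e :: real assume "e > 0"
    then have "\<forall>\<^sub>F n in sequentially. \<forall>s\<in>{-R..R}. dist (\<Sum>k<n. u (B x) k s) (opexp B s (B x)) < e"
      by (rule uniform_limitD[OF unif])
    then show "\<forall>\<^sub>F n in sequentially. \<forall>s\<in>{-R..R}. \<forall>h. norm (h *\<^sub>R (\<Sum>k<n. u (B x) k s) - h *\<^sub>R opexp B s (B x)) \<le> e * norm h"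
    proof eventually_elim
      case (elim n)
      show ?case
      proof (intro ballI allI)
        fix s h assume "s \<in> {-R..R}"
        then have "norm ((\<Sum>k<n. u (B x) k s) - opexp B s (B x)) \<le> e"
          using elim by (auto simp: dist_norm intro: less_imp_le)
        then show "norm (h *\<^sub>R (\<Sum>k<n. u (B x) k s) - h *\<^sub>R opexp B s (B x)) \<le> e * norm h"
          by (simp add: mult.commute[of e] mult_left_mono flip: scaleR_diff_right)
      qed
    qed
  qed
  then obtain g where g: "\<And>s. s \<in> {-R..R} \<Longrightarrow> (\<lambda>n. \<Sum>k\<le>n. u x k s) \<longlonglongrightarrow> g s"
    "\<And>s. s \<in> {-R..R} \<Longrightarrow> (g has_derivative (\<lambda>h. h *\<^sub>R opexp B s (B x))) (at s within {-R..R})" by blast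
  have g_eq: "opexp B s x = g s" if "s \<in> {-R..R}" for s
    using LIMSEQ_unique[OF g(1)[OF that]] conv[of x s] by (simp add: sums_def_le)
  have t: "t \<in> {-R<..<R}" by (auto simp: R_def)
  then have "(g has_derivative (\<lambda>h. h *\<^sub>R opexp B t (B x))) (at t within {-R<..<R})"
    by (intro has_derivative_subset[OF g(2)]) auto
  then have "(g has_derivative (\<lambda>h. h *\<^sub>R opexp B t (B x))) (at t)"
    by (simp only: at_within_open[OF t open_greaterThanLessThan])
  then have "((\<lambda>t. opexp B t x) has_derivative (\<lambda>h. h *\<^sub>R opexp B t (B x))) (at t)"
    by (rule has_derivative_transform_within_open[OF _ open_greaterThanLessThan t]) (simp add: g_eq)
  then show ?thesis by (simp add: has_vector_derivative_def Bexp)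
qed

text \<open>The derivative of |y|^2 is 2 <B y, y> = 0. Applied to the difference of two solutions
  this is uniqueness.\<close>

lemma skew_norm_constant:
  fixes B :: "'a::real_inner \<Rightarrow> 'a"
  assumes "\<And>x. inner (B x) x = 0" "\<And>t. (y has_vector_derivative B (y t)) (at t)"
  shows "norm (y t) = norm (y 0)"
proof -
  have "((\<lambda>t. inner (y t) (y t)) has_vector_derivative 0) (at t)" for t
  proof -
    have "((\<lambda>t. inner (y t) (y t)) has_vector_derivative (inner (y t) (B (y t)) + inner (B (y t)) (y t))) (at t)"
      using bounded_bilinear.has_vector_derivative[OF bounded_bilinear_inner assms(2) assms(2)] .
    then show ?thesis using assms(1) by (simp add: inner_commute[of "y t" "B (y t)"])
  qed
  then obtain c where "\<And>t. inner (y t) (y t) = c"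
    using has_vector_derivative_zero_constant[of UNIV "\<lambda>t. inner (y t) (y t)"] by auto
  then show ?thesis by (simp add: norm_eq_sqrt_inner)
qed

lemma skew_ode_unique:
  fixes B :: "'a::real_inner \<Rightarrow> 'a"
  assumes "bounded_linear B" "\<And>x. inner (B x) x = 0"
    "\<And>t. (y has_vector_derivative B (y t)) (at t)" "\<And>t. (z has_vector_derivative B (z t)) (at t)"
    "y 0 = z 0"
  shows "y t = z t"
proof -
  interpret B: bounded_linear B by fact
  have "((\<lambda>t. y t - z t) has_vector_derivative B (y t - z t)) (at t)" for t
    unfolding B.diff by (intro has_vector_derivative_diff assms)
  from skew_norm_constant[OF assms(2) this, of t] show ?thesis using assms(5) by simp
qed

text \<open>The algebraic properties of the exponential (linearity, group law, commutation) are all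
  obtained in one way: both sides solve y' = B y with the same initial value.\<close>

locale skew =
  fixes B :: "'a::{real_inner,banach} \<Rightarrow> 'a"
  assumes bl: "bounded_linear B" and skew: "\<And>x. inner (B x) x = 0"
begin

sublocale B: bounded_linear B by (rule bl)

lemmas deriv = opexp_has_vector_derivative[OF bl]
lemmas unique = skew_ode_unique[OF bl skew]

lemma norm_opexp [simp]: "norm (opexp B t x) = norm x"
  using skew_norm_constant[OF skew deriv] by simp

lemma opexp_add: "opexp B t (x + y) = opexp B t x + opexp B t y"
  by (rule unique[of "\<lambda>t. opexp B t (x + y)" "\<lambda>t. opexp B t x + opexp B t y"])
     (auto intro!: deriv has_vector_derivative_add simp: B.add)

lemma opexp_scaleR: "opexp B t (r *\<^sub>R x) = r *\<^sub>R opexp B t x"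
  by (rule unique[of "\<lambda>t. opexp B t (r *\<^sub>R x)" "\<lambda>t. r *\<^sub>R opexp B t x"])
     (auto intro!: deriv bounded_linear.has_vector_derivative[OF bounded_linear_scaleR_right] simp: B.scaleR)

lemma bounded_linear_opexp: "bounded_linear (opexp B t)"
  by (rule bounded_linear_intro[where K=1]) (simp_all add: opexp_add opexp_scaleR)

lemma opexp_opexp: "opexp B t (opexp B s x) = opexp B (t + s) x"
proof (rule unique[of "\<lambda>t. opexp B t (opexp B s x)" "\<lambda>t. opexp B (t + s) x"])
  show "((\<lambda>t. opexp B (t + s) x) has_vector_derivative B (opexp B (t + s) x)) (at t)" for t
  proof -
    have "((\<lambda>t. t + s) has_vector_derivative 1) (at t)" by (auto intro!: derivative_eq_intros)
    from vector_diff_chain_at[OF this deriv] show ?thesis by (simp add: comp_def)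
  qed
qed (auto intro: deriv)

lemma opexp_commute:
  assumes L: "bounded_linear L" "\<And>x. L (B x) = B (L x)"
  shows "L (opexp B t x) = opexp B t (L x)"
proof (rule unique[of "\<lambda>t. L (opexp B t x)" "\<lambda>t. opexp B t (L x)"])
  show "((\<lambda>t. L (opexp B t x)) has_vector_derivative B (L (opexp B t x))) (at t)" for t
    unfolding L(2)[symmetric] by (rule bounded_linear.has_vector_derivative[OF L(1) deriv])
qed (auto intro: deriv)

end

text \<open>The difference w of the two evolutions satisfies w' = B w + exp(t C) (B x - C x).
  Skewness removes the first term from the derivative of |w|^2, and |w| is at most 2 |x|. Only the
  distance of \<open>B x\<close> and \<open>C x\<close> enters, so the estimate remains useful for
  operators whose norms blow up.\<close>

lemma skew_opexp_diff_le:
  fixes B :: "'a::{real_inner,banach} \<Rightarrow> 'a"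
  assumes "skew B" "skew C" and comm: "\<And>x. B (C x) = C (B x)"
  shows "(norm (opexp B t x - opexp C t x))\<^sup>2 \<le> (4 * \<bar>t\<bar> * norm x) * norm (B x - C x)"
proof -
  interpret B: skew B by fact
  interpret C: skew C by fact
  define w where "w t = opexp B t x - opexp C t x" for t
  have w': "(w has_vector_derivative B (w t) + opexp C t (B x - C x)) (at t)" for t
  proof -
    have "opexp C t (B x - C x) = B (opexp C t x) - C (opexp C t x)"
      by (simp add: C.opexp_commute[OF B.bl comm] C.opexp_commute[OF C.bl refl]
          linear_diff[OF bounded_linear.linear[OF C.bounded_linear_opexp]])
    then have eq: "B (w t) + opexp C t (B x - C x) = B (opexp B t x) - C (opexp C t x)"
      by (simp add: w_def B.B.diff)
    show ?thesis unfolding eq unfolding w_def by (intro has_vector_derivative_diff B.deriv C.deriv)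
  qed
  have skew': "inner y (B y) = 0" for y by (subst inner_commute) (rule B.skew)
  have nw: "norm (w t) \<le> 2 * norm x" for t
    unfolding w_def using norm_triangle_ineq4[of "opexp B t x" "opexp C t x"] by simp
  have "norm (inner (w t) (w t) - inner (w 0) (w 0)) \<le> 4 * norm (B x - C x) * norm x * \<bar>t - 0\<bar>"
  proof (rule has_vector_derivative_bound[OF convex_UNIV, where f="\<lambda>t. inner (w t) (w t)"])
    show "((\<lambda>t. inner (w t) (w t)) has_vector_derivative 2 * inner (opexp C t (B x - C x)) (w t)) (at t)" for t
      using bounded_bilinear.has_vector_derivative[OF bounded_bilinear_inner w'[of t] w'[of t]]
      by (simp add: inner_add_left inner_add_right B.skew skew' inner_commute[of "w t" "opexp C t _"])
    show "norm (2 * inner (opexp C t (B x - C x)) (w t)) \<le> 4 * norm (B x - C x) * norm x" for t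
    proof -
      have "\<bar>inner (opexp C t (B x - C x)) (w t)\<bar> \<le> norm (B x - C x) * norm (w t)"
        using Cauchy_Schwarz_ineq2[of "opexp C t (B x - C x)" "w t"] by simp
      also have "\<dots> \<le> norm (B x - C x) * (2 * norm x)" by (intro mult_left_mono nw) simp
      finally show ?thesis by simp
    qed
  qed auto
  then show ?thesis by (simp add: w_def power2_norm_eq_inner mult_ac)
qed

section \<open>Strong limits of commuting isometric groups\<close>

locale skew_approximation =
  fixes B :: "nat \<Rightarrow> 'a::{real_inner,banach} \<Rightarrow> 'a" and D :: "'a set"
  assumes sk: "\<And>n. skew (B n)"
    and comm: "\<And>m n x. B m (B n x) = B n (B m x)"
    and dense: "closure D = UNIV"
    and conv: "\<And>x. x \<in> D \<Longrightarrow> convergent (\<lambda>n. B n x)"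
begin

definition U :: "real \<Rightarrow> 'a \<Rightarrow> 'a" where "U t x = lim (\<lambda>n. opexp (B n) t x)"

lemma approx: assumes "0 < e" obtains y where "y \<in> D" "norm (x - y) < e"
proof -
  have "x \<in> closure D" by (simp add: dense)
  then obtain y where "y \<in> D" "dist y x < e" using assms closure_approachable by blast
  then show thesis using that by (auto simp: dist_norm norm_minus_commute)
qed

lemma opexp_diff: "opexp (B n) t (x - y) = opexp (B n) t x - opexp (B n) t y"
  by (rule linear_diff[OF bounded_linear.linear[OF skew.bounded_linear_opexp[OF sk]]])

text \<open>On \<open>D\<close> the generators converge, so \<open>skew_opexp_diff_le\<close> gives
  a Cauchy sequence; isometry extends this to the closure of \<open>D\<close> by a three-epsilon
  argument.\<close>

lemma U_lim: "(\<lambda>n. opexp (B n) t x) \<longlonglongrightarrow> U t x"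
proof -
  have D: "Cauchy (\<lambda>n. opexp (B n) t y)" if "y \<in> D" for y
  proof (rule metric_CauchyI)
    fix e :: real assume e: "0 < e"
    \<comment> \<open>The summand 1 keeps the divisor positive when \<open>t\<close> or
      \<open>y\<close> is zero.\<close>
    define c where "c = 4 * \<bar>t\<bar> * norm y + 1"
    have c: "0 < c" by (simp add: c_def add_nonneg_pos)
    have "Cauchy (\<lambda>n. B n y)" using conv[OF that] by (rule convergent_Cauchy)
    moreover have "0 < e\<^sup>2 / c" using e c by simp
    ultimately obtain N where N: "\<And>m n. m \<ge> N \<Longrightarrow> n \<ge> N \<Longrightarrow> norm (B m y - B n y) < e\<^sup>2 / c"
      unfolding Cauchy_def dist_norm by blast
    have "dist (opexp (B m) t y) (opexp (B n) t y) < e" if "m \<ge> N" "n \<ge> N" for m n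
    proof -
      have "(norm (opexp (B m) t y - opexp (B n) t y))\<^sup>2 \<le> (4 * \<bar>t\<bar> * norm y) * norm (B m y - B n y)"
        by (rule skew_opexp_diff_le[of "B m" "B n", OF sk sk comm])
      also have "\<dots> \<le> c * norm (B m y - B n y)"
        by (rule mult_right_mono) (simp_all add: c_def)
      also have "\<dots> < e\<^sup>2" using N[OF that] c by (simp add: pos_less_divide_eq mult.commute)
      finally show ?thesis using e by (simp add: dist_norm power_less_imp_less_base)
    qed
    then show "\<exists>N. \<forall>m\<ge>N. \<forall>n\<ge>N. dist (opexp (B m) t y) (opexp (B n) t y) < e" by blast
  qed
  have "Cauchy (\<lambda>n. opexp (B n) t x)"
  proof (rule metric_CauchyI)
    fix e :: real assume e: "0 < e"
    then obtain y where y: "y \<in> D" "norm (x - y) < e / 3" using approx[of "e / 3" x] by auto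
    obtain N where N: "\<And>m n. m \<ge> N \<Longrightarrow> n \<ge> N \<Longrightarrow> dist (opexp (B m) t y) (opexp (B n) t y) < e / 3"
      using metric_CauchyD[OF D[OF y(1)], of "e / 3"] e by auto
    have xy: "dist (opexp (B n) t x) (opexp (B n) t y) < e / 3" for n
      using y(2) skew.norm_opexp[OF sk, of n t "x - y"] by (simp add: dist_norm opexp_diff)
    have "dist (opexp (B m) t x) (opexp (B n) t x) < e" if "m \<ge> N" "n \<ge> N" for m n
      using xy[of m] xy[of n] N[OF that]
        dist_triangle[of "opexp (B m) t x" "opexp (B n) t x" "opexp (B m) t y"]
        dist_triangle[of "opexp (B m) t y" "opexp (B n) t x" "opexp (B n) t y"]
        dist_commute[of "opexp (B n) t x" "opexp (B n) t y"] by linarith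
    then show "\<exists>N. \<forall>m\<ge>N. \<forall>n\<ge>N. dist (opexp (B m) t x) (opexp (B n) t x) < e" by blast
  qed
  then show ?thesis by (simp add: U_def Cauchy_convergent_iff convergent_LIMSEQ_iff)
qed

lemma U_eqI: "(\<lambda>n. opexp (B n) t x) \<longlonglongrightarrow> y \<Longrightarrow> U t x = y"
  by (rule LIMSEQ_unique[OF U_lim])

lemma norm_U [simp]: "norm (U t x) = norm x"
  using LIMSEQ_unique[OF tendsto_norm[OF U_lim]] skew.norm_opexp[OF sk] by simp

lemma U_0 [simp]: "U 0 x = x"
  by (rule U_eqI) simp

lemma U_add: "U t (x + y) = U t x + U t y"
  by (rule U_eqI) (simp add: skew.opexp_add[OF sk] tendsto_add U_lim)

lemma U_scaleR: "U t (r *\<^sub>R x) = r *\<^sub>R U t x"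
  by (rule U_eqI) (simp add: skew.opexp_scaleR[OF sk] tendsto_scaleR U_lim)

lemma bounded_linear_U: "bounded_linear (U t)"
  by (rule bounded_linear_intro[where K=1]) (simp_all add: U_add U_scaleR)

lemma U_diff: "U t (x - y) = U t x - U t y"
  by (rule linear_diff[OF bounded_linear.linear[OF bounded_linear_U]])

lemma U_commute:
  assumes L: "bounded_linear L" "\<And>n x. L (B n x) = B n (L x)"
  shows "L (U t x) = U t (L x)"
proof (rule U_eqI[symmetric])
  have "L (opexp (B n) t x) = opexp (B n) t (L x)" for n
    by (rule skew.opexp_commute[OF sk[of n] L(1)]) (rule L(2))
  then show "(\<lambda>n. opexp (B n) t (L x)) \<longlonglongrightarrow> L (U t x)"
    using bounded_linear.tendsto[OF L(1) U_lim[of t x]] by simp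
qed

text \<open>Before the limit the group law is exact: applying the n-th exponential to U(-t) x -
  exp(-t B_n) x leaves the norm of this difference unchanged, and it tends to zero.\<close>

lemma U_inverse: "U t (U (- t) x) = x"
proof (rule U_eqI)
  have "(\<lambda>n. opexp (B n) t (U (- t) x) - x) \<longlonglongrightarrow> 0"
  proof (rule Lim_null_comparison)
    show "\<forall>\<^sub>F n in sequentially. norm (opexp (B n) t (U (- t) x) - x) \<le> norm (U (- t) x - opexp (B n) (- t) x)"
    proof (rule always_eventually, rule allI)
      fix n
      have "opexp (B n) t (U (- t) x) - x = opexp (B n) t (U (- t) x - opexp (B n) (- t) x)"
        by (simp add: opexp_diff skew.opexp_opexp[OF sk])
      then show "norm (opexp (B n) t (U (- t) x) - x) \<le> norm (U (- t) x - opexp (B n) (- t) x)"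
        by (simp add: skew.norm_opexp[OF sk])
    qed
    show "(\<lambda>n. norm (U (- t) x - opexp (B n) (- t) x)) \<longlonglongrightarrow> 0"
      using tendsto_norm[OF tendsto_diff[OF tendsto_const[of "U (- t) x"] U_lim[of "- t" x]]] by simp
  qed
  then show "(\<lambda>n. opexp (B n) t (U (- t) x)) \<longlonglongrightarrow> x" by (rule LIM_zero_cancel)
qed

lemma U_Lipschitz: assumes "x \<in> D" obtains C where "0 \<le> C" "\<And>s t. norm (U t x - U s x) \<le> C * \<bar>t - s\<bar>"
proof -
  obtain C where C: "\<And>n. norm (B n x) \<le> C"
    using convergent_imp_Bseq[OF conv[OF assms]] unfolding Bseq_def by blast
  have "norm (opexp (B n) t x - opexp (B n) s x) \<le> C * \<bar>t - s\<bar>" for n s t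
  proof (rule has_vector_derivative_bound[OF convex_UNIV skew.deriv[OF sk]])
    show "norm (B n (opexp (B n) u x)) \<le> C" for u
      using skew.opexp_commute[OF sk[of n] skew.bl[OF sk[of n]] refl, of u x] C[of n] by (simp add: skew.norm_opexp[OF sk])
  qed auto
  then have "norm (U t x - U s x) \<le> C * \<bar>t - s\<bar>" for s t
    by (intro LIMSEQ_le_const2[OF tendsto_norm[OF tendsto_diff[OF U_lim U_lim]]]) auto
  moreover have "0 \<le> C" using C[of 0] norm_ge_zero order_trans by blast
  ultimately show thesis using that by blast
qed

lemma isCont_U: "isCont (\<lambda>t. U t x) t"
  unfolding isCont_def
proof (rule tendstoI)
  fix e :: real assume e: "0 < e"
  then obtain y where y: "y \<in> D" "norm (x - y) < e / 3" using approx[of "e / 3" x] by auto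
  obtain C where C: "0 \<le> C" "\<And>s t. norm (U t y - U s y) \<le> C * \<bar>t - s\<bar>" using U_Lipschitz[OF y(1)] by blast
  have "((\<lambda>s. C * \<bar>s - t\<bar>) \<longlongrightarrow> C * \<bar>t - t\<bar>) (at t)" by (intro tendsto_intros)
  then have "\<forall>\<^sub>F s in at t. C * \<bar>s - t\<bar> < e / 3" using e by (intro order_tendstoD) auto
  then show "\<forall>\<^sub>F s in at t. dist (U s x) (U t x) < e"
  proof eventually_elim
    case (elim s)
    have xy: "dist (U s x) (U s y) < e / 3" for s
      using y(2) norm_U[of s "x - y"] by (simp add: dist_norm U_diff)
    show ?case using xy[of s] xy[of t] C(2)[of s t] elim
        dist_triangle[of "U s x" "U t x" "U s y"] dist_triangle[of "U s y" "U t x" "U t y"]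
        dist_commute[of "U t x" "U t y"] by (simp add: dist_norm)
  qed
qed

text \<open>Time and argument may vary together: isometry controls the change of the argument and
  strong continuity the change of time.\<close>

lemma tendsto_U:
  fixes z :: "real \<Rightarrow> 'a"
  assumes z: "(z \<longlongrightarrow> y) (at t within S)" and f: "(f \<longlongrightarrow> s) (at t within S)"
  shows "((\<lambda>r. U (f r) (z r)) \<longlongrightarrow> U s y) (at t within S)"
proof (rule LIM_zero_cancel, rule Lim_null_comparison)
  show "\<forall>\<^sub>F r in at t within S. norm (U (f r) (z r) - U s y) \<le> norm (z r - y) + norm (U (f r) y - U s y)"
  proof (rule always_eventually, rule allI)
    fix r
    have "U (f r) (z r) - U s y = U (f r) (z r - y) + (U (f r) y - U s y)" by (simp add: U_diff)
    then show "norm (U (f r) (z r) - U s y) \<le> norm (z r - y) + norm (U (f r) y - U s y)"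
      by (metis norm_triangle_ineq norm_U)
  qed
  have "((\<lambda>r. norm (z r - y) + norm (U (f r) y - U s y)) \<longlongrightarrow> norm (y - y) + norm (U s y - U s y)) (at t within S)"
    by (intro tendsto_intros z isCont_tendsto_compose[OF isCont_U f])
  then show "((\<lambda>r. norm (z r - y) + norm (U (f r) y - U s y)) \<longlongrightarrow> 0) (at t within S)" by simp
qed

end

section \<open>The free Schroedinger group\<close>

definition mesh :: "nat \<Rightarrow> real" where "mesh n = 1 / real (Suc n)"

lemma mesh_nz: "mesh n \<noteq> 0" and mesh_lim: "mesh \<longlonglongrightarrow> 0"
  using LIMSEQ_inverse_real_of_nat by (simp_all add: mesh_def[abs_def] inverse_eq_divide)

lemma tendsto_mesh: "(f \<longlongrightarrow> l) (at 0) \<Longrightarrow> (\<lambda>n. f (mesh n)) \<longlonglongrightarrow> l"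
  using mesh_nz mesh_lim unfolding tendsto_at_iff_sequentially comp_def by auto

text \<open>The translation back by one step makes this the symmetric second difference f(x+h) - 2
  f(x) + f(x-h), divided by h^2, in each coordinate. Equivalently, it is minus the adjoint of
  \<open>dq\<close> composed with \<open>dq\<close>, which is the content of
  \<open>pair_diff_lap\<close> and \<open>inner_diff_lap\<close>.\<close>

definition diff_lap :: "real \<Rightarrow> l2 \<Rightarrow> l2" where
  "diff_lap h x = (\<Sum>j\<in>UNIV. transl (- (h *\<^sub>R axis j 1)) (dq (axis j 1) h (dq (axis j 1) h x)))"

definition skew_lap :: "real \<Rightarrow> nat \<Rightarrow> l2 \<Rightarrow> l2" where
  "skew_lap a n x = cmul (\<i> * of_real a) (diff_lap (mesh n) x)"

lemma pair_transl_transl: "pair (transl a u) (transl a y) = pair u y"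
  by (simp add: pair_transl transl_transl)

lemma inner_transl_transl: "inner (transl a u) (transl a y) = inner u y"
  by (simp add: inner_transl transl_transl)

lemma pair_transl_minus: "pair (transl (- a) u) y = pair u (transl a y)"
  by (simp add: pair_transl)

lemma inner_transl_minus: "inner (transl (- a) u) y = inner u (transl a y)"
  by (simp add: inner_transl)

lemma pair_diff_lap: "pair (diff_lap h x) y = - (\<Sum>j\<in>UNIV. pair (dq (axis j 1) h x) (dq (axis j 1) h y))"
proof -
  have "pair (transl (- (h *\<^sub>R v)) (dq v h u)) y = - pair u (dq v h y)" for u v
    by (simp add: pair_transl_minus dq_def[of v h] pair.scaleR_left pair.scaleR_right pair.diff_left
        pair.diff_right pair_transl_transl algebra_simps)
  then show ?thesis by (simp add: diff_lap_def pair.sum_left sum_negf)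
qed

lemma inner_diff_lap: "inner (diff_lap h x) y = - (\<Sum>j\<in>UNIV. inner (dq (axis j 1) h x) (dq (axis j 1) h y))"
proof -
  have "inner (transl (- (h *\<^sub>R v)) (dq v h u)) y = - inner u (dq v h y)" for u v
    by (simp add: inner_transl_minus dq_def[of v h] inner_diff_left
        inner_diff_right inner_transl_transl algebra_simps)
  then show ?thesis by (simp add: diff_lap_def inner_sum_left sum_negf)
qed

lemma bounded_linear_diff_lap: "bounded_linear (diff_lap h)"
  unfolding diff_lap_def
  by (intro bounded_linear_sum bounded_linear_compose[OF bounded_linear_transl]
      bounded_linear_compose[OF bounded_linear_dq] bounded_linear_dq)

lemma diff_lap_commute:
  assumes "bounded_linear L" "\<And>a f. L (transl a f) = transl a (L f)"
  shows "L (diff_lap h x) = diff_lap h (L x)"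
proof -
  interpret L: bounded_linear L by fact
  have "L (dq v h y) = dq v h (L y)" for v y
    by (simp add: dq_def L.scaleR L.diff assms(2))
  then show ?thesis by (simp add: diff_lap_def L.sum assms(2))
qed

lemma diff_lap_transl: "diff_lap h (transl a x) = transl a (diff_lap h x)"
  by (rule diff_lap_commute[OF bounded_linear_transl, symmetric]) (simp add: transl_transl add.commute)

lemma diff_lap_cmul: "diff_lap h (cmul c x) = cmul c (diff_lap h x)"
  by (rule diff_lap_commute[OF bounded_linear_cmul, symmetric]) (simp add: transl_cmul)

lemma skew_lap_commute:
  assumes "bounded_linear L" "\<And>a f. L (transl a f) = transl a (L f)" "\<And>c f. L (cmul c f) = cmul c (L f)"
  shows "L (skew_lap a n x) = skew_lap a n (L x)"
  unfolding skew_lap_def by (simp add: assms(3) diff_lap_commute[OF assms(1,2)])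

lemma inner_cmul_i_self: "inner y (cmul \<i> y) = 0"
  using inner_cmul_i[of y y] inner_commute[of y "cmul \<i> y"] by linarith

text \<open>After summation by parts each term is the inner product of a difference quotient with
  \<open>\<i>\<close> times itself, hence zero.\<close>

lemma skew_skew_lap: "skew (skew_lap a n)"
proof (rule skew.intro)
  show "bounded_linear (skew_lap a n)"
    unfolding skew_lap_def[abs_def] by (rule bounded_linear_compose[OF bounded_linear_cmul bounded_linear_diff_lap])
  fix x
  have "skew_lap a n x = a *\<^sub>R cmul \<i> (diff_lap (mesh n) x)"
    by (simp add: skew_lap_def cmul_cmul mult.commute flip: cmul_of_real)
  moreover have "inner (cmul \<i> (diff_lap (mesh n) x)) x = 0"
    by (simp add: inner_cmul_i inner_diff_lap dq_cmul inner_cmul_i_self)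
  ultimately show "inner (skew_lap a n x) x = 0" by simp
qed

lemma tendsto_transl_seq:
  assumes "y \<longlonglongrightarrow> k" "s \<longlonglongrightarrow> 0" "\<And>n. s n \<noteq> 0"
  shows "(\<lambda>n. transl (s n *\<^sub>R v) (y n)) \<longlonglongrightarrow> k"
proof -
  have "(\<lambda>n. transl (s n *\<^sub>R v) k) \<longlonglongrightarrow> k"
    using tendsto_transl_0[of v k] assms(2,3) unfolding tendsto_at_iff_sequentially comp_def by auto
  moreover have "(\<lambda>n. transl (s n *\<^sub>R v) (y n - k)) \<longlonglongrightarrow> 0"
    by (rule Lim_null_comparison[OF _ tendsto_norm_zero[OF LIM_zero[OF assms(1)]]]) simp
  ultimately have "(\<lambda>n. transl (s n *\<^sub>R v) (y n - k) + transl (s n *\<^sub>R v) k) \<longlonglongrightarrow> 0 + k"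
    by (intro tendsto_add)
  then show ?thesis by (simp add: transl_diff)
qed

lemma tendsto_diff_lap:
  assumes "\<And>j. gen (axis j 1) x (g j)" "\<And>j. gen (axis j 1) (g j) (k j)"
  shows "(\<lambda>n. diff_lap (mesh n) x) \<longlonglongrightarrow> (\<Sum>j\<in>UNIV. k j)"
  unfolding diff_lap_def
proof (rule tendsto_sum)
  fix j
  have "(\<lambda>n. transl ((- mesh n) *\<^sub>R axis j 1) (dq (axis j 1) (mesh n) (dq (axis j 1) (mesh n) x))) \<longlonglongrightarrow> k j"
    using mesh_nz tendsto_minus[OF mesh_lim]
    by (intro tendsto_transl_seq tendsto_mesh[OF tendsto_dq_dq[OF assms]]) auto
  then show "(\<lambda>n. transl (- (mesh n *\<^sub>R axis j 1)) (dq (axis j 1) (mesh n) (dq (axis j 1) (mesh n) x))) \<longlonglongrightarrow> k j" by simp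
qed

text \<open>Convergence on test functions is \<open>tendsto_diff_lap\<close>, since partial
  derivatives of test functions are again test functions. Commutation holds because all these
  operators are built from translations and complex scalars.\<close>

interpretation sch: skew_approximation "skew_lap a" "abs_l2 ` test_functions UNIV" for a
proof (rule skew_approximation.intro)
  show "skew (skew_lap a n)" for n by (rule skew_skew_lap)
  show "skew_lap a m (skew_lap a n x) = skew_lap a n (skew_lap a m x)" for m n x
    by (rule skew_lap_commute[OF skew.bl[OF skew_skew_lap]])
       (simp_all add: skew_lap_def diff_lap_transl transl_cmul diff_lap_cmul cmul_cmul mult.commute)
  show "closure (abs_l2 ` test_functions UNIV) = UNIV" by (rule test_dense)
  show "convergent (\<lambda>n. skew_lap a n x)" if x: "x \<in> abs_l2 ` test_functions UNIV" for x
  proof -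
    obtain \<eta> where \<eta>: "\<eta> \<in> test_functions UNIV" "x = abs_l2 \<eta>" using x by blast
    let ?L = "\<Sum>j\<in>UNIV. abs_l2 (\<lambda>x. frechet_derivative (\<lambda>x. frechet_derivative \<eta> (at x) (axis j 1)) (at x) (axis j 1))"
    have "(\<lambda>n. diff_lap (mesh n) x) \<longlonglongrightarrow> ?L"
      unfolding \<eta>(2) by (rule tendsto_diff_lap[OF gen_test[OF \<eta>(1)] gen_test[OF test_partial[OF \<eta>(1)]]])
    then have "(\<lambda>n. skew_lap a n x) \<longlonglongrightarrow> cmul (\<i> * of_real a) ?L"
      unfolding skew_lap_def by (rule bounded_linear.tendsto[OF bounded_linear_cmul])
    then show ?thesis by (rule convergentI)
  qed
qed

abbreviation schr :: "real \<Rightarrow> real \<Rightarrow> l2 \<Rightarrow> l2" where "schr a \<equiv> sch.U a"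

lemma schr_commute:
  assumes "bounded_linear L" "\<And>a f. L (transl a f) = transl a (L f)" "\<And>c f. L (cmul c f) = cmul c (L f)"
  shows "L (schr a t x) = schr a t (L x)"
  by (rule sch.U_commute[OF assms(1)]) (rule skew_lap_commute[OF assms])

lemma schr_transl: "schr a t (transl b x) = transl b (schr a t x)"
  by (rule schr_commute[symmetric]) (simp_all add: bounded_linear_transl transl_transl transl_cmul add.commute)

lemma gen_schr: "gen v f g \<Longrightarrow> gen v (schr a t f) (schr a t g)"
  by (rule gen_bounded_linear[OF sch.bounded_linear_U]) (simp_all add: schr_transl)

section \<open>The free group under the bilinear pairing\<close>

lemma opexp_skew_lap_dq: "opexp (skew_lap a n) t (dq v h x) = dq v h (opexp (skew_lap a n) t x)"
  by (rule skew.opexp_commute[OF skew_skew_lap bounded_linear_dq, symmetric])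
     (rule skew_lap_commute[OF bounded_linear_dq], simp_all add: dq_transl dq_cmul)

text \<open>Symmetric, not skew: without conjugation the factor \<open>\<i>\<close> moves from one
  side to the other with its sign unchanged.\<close>

lemma pair_skew_lap: "pair (skew_lap a n x) y = pair x (skew_lap a n y)"
  by (simp add: skew_lap_def pair_cmul_left pair_cmul_right pair_diff_lap pair_commute[of x] pair_commute[of "dq _ _ x"])

text \<open>Let the time \<open>r\<close> pass from one factor to the other: the derivative of pair
  (E_r x) (E_(t-r) y) vanishes by symmetry of the generator, and r = t, r = 0 give the two
  sides.\<close>

lemma pair_opexp_skew_lap: "pair (opexp (skew_lap a n) t x) y = pair x (opexp (skew_lap a n) t y)"
proof -
  let ?E = "opexp (skew_lap a n)"
  have d: "((\<lambda>t. ?E t x) has_vector_derivative skew_lap a n (?E t x)) (at t)" for t x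
    by (rule skew.deriv[OF skew_skew_lap])
  have "((\<lambda>r. pair (?E r x) (?E (t - r) y)) has_vector_derivative 0) (at r within UNIV)" for r
  proof -
    have "((\<lambda>r. t - r) has_vector_derivative -1) (at r)" by (auto intro!: derivative_eq_intros)
    from vector_diff_chain_at[OF this d]
    have "((\<lambda>r. ?E (t - r) y) has_vector_derivative - skew_lap a n (?E (t - r) y)) (at r)"
      by (simp add: comp_def)
    from bounded_bilinear.has_vector_derivative[OF bounded_bilinear_pair d this]
    show ?thesis by (simp add: pair.minus_right pair_skew_lap)
  qed
  then obtain c where c: "\<And>r. pair (?E r x) (?E (t - r) y) = c"
    using has_vector_derivative_zero_constant[of UNIV "\<lambda>r. pair (?E r x) (?E (t - r) y)"] by auto
  show ?thesis using c[of t] c[of 0] by simp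
qed

lemma pair_schr: "pair (schr a t x) y = pair x (schr a t y)"
proof -
  have "(\<lambda>n. pair (opexp (skew_lap a n) t x) y) \<longlonglongrightarrow> pair (schr a t x) y"
    by (rule bounded_linear.tendsto[OF pair.bounded_linear_left sch.U_lim])
  moreover have "(\<lambda>n. pair x (opexp (skew_lap a n) t y)) \<longlonglongrightarrow> pair x (schr a t y)"
    by (rule bounded_linear.tendsto[OF pair.bounded_linear_right sch.U_lim])
  ultimately show ?thesis by (simp add: pair_opexp_skew_lap LIMSEQ_unique)
qed

text \<open>The argument varies with \<open>n\<close> because it will be a difference quotient whose
  step shrinks together with that of the approximating Laplacian.\<close>

lemma tendsto_opexp_skew_lap:
  assumes "y \<longlonglongrightarrow> z" shows "(\<lambda>n. opexp (skew_lap a n) t (y n)) \<longlonglongrightarrow> schr a t z"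
proof -
  have "(\<lambda>n. opexp (skew_lap a n) t (y n - z)) \<longlonglongrightarrow> 0"
    by (rule Lim_null_comparison[OF _ tendsto_norm_zero[OF LIM_zero[OF assms]]])
       (simp add: skew.norm_opexp[OF skew_skew_lap])
  from tendsto_add[OF this sch.U_lim[of a t z]] show ?thesis by (simp add: sch.opexp_diff)
qed

text \<open>For the approximants the derivative is exact, and summation by parts puts one difference
  quotient on each side, so that first-order regularity of \<open>x\<close> and \<open>v\<close>
  suffices for the limit. Since derivatives do not pass to pointwise limits, the identity is
  integrated in time, passed to the limit by dominated convergence and differentiated again.\<close>

lemma schr_weak_equation:
  assumes x: "\<And>j. gen (axis j 1) x (xg j)" and v: "\<And>j. gen (axis j 1) v (vg j)"
  shows "((\<lambda>t. pair (schr a t x) v) has_vector_derivative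
     - (\<i> * of_real a) * (\<Sum>j\<in>UNIV. pair (schr a t (xg j)) (vg j))) (at t)"
proof -
  define q where "q n t = - (\<i> * of_real a) * (\<Sum>j\<in>UNIV. pair (opexp (skew_lap a n) t (dq (axis j 1) (mesh n) x)) (dq (axis j 1) (mesh n) v))" for n t
  define q' where "q' t = - (\<i> * of_real a) * (\<Sum>j\<in>UNIV. pair (schr a t (xg j)) (vg j))" for t
  define p where "p n t = pair (opexp (skew_lap a n) t x) v" for n t
  define p' where "p' t = pair (schr a t x) v" for t
  have p: "(p n has_vector_derivative q n s) (at s)" for n s
  proof -
    have "pair (skew_lap a n (opexp (skew_lap a n) s x)) v = q n s"
      by (simp add: skew_lap_def pair_cmul_left pair_diff_lap q_def opexp_skew_lap_dq[unfolded skew_lap_def[abs_def]] opexp_skew_lap_dq)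
    moreover have "(p n has_vector_derivative pair (skew_lap a n (opexp (skew_lap a n) s x)) v) (at s)"
      unfolding p_def
      by (rule bounded_linear.has_vector_derivative[OF pair.bounded_linear_left skew.deriv[OF skew_skew_lap]])
    ultimately show ?thesis by simp
  qed
  have p_lim: "(\<lambda>n. p n s) \<longlonglongrightarrow> p' s" for s
    unfolding p_def p'_def by (rule bounded_linear.tendsto[OF pair.bounded_linear_left sch.U_lim])
  have q_lim: "(\<lambda>n. q n s) \<longlonglongrightarrow> q' s" for s
    unfolding q_def q'_def
    by (intro tendsto_mult tendsto_const tendsto_sum bounded_bilinear.tendsto[OF bounded_bilinear_pair]
        tendsto_opexp_skew_lap tendsto_mesh x[unfolded gen_def] v[unfolded gen_def])
  \<comment> \<open>A majorant independent of \<open>n\<close> and \<open>s\<close>: the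
    exponentials are isometric and \<open>norm_dq_le\<close> bounds every quotient by the
    corresponding derivative.\<close>
  define C where "C = \<bar>a\<bar> * (\<Sum>j\<in>UNIV. norm (xg j) * norm (vg j))"
  have q_bound: "norm (q n s) \<le> C" for n s
  proof -
    have "norm (\<Sum>j\<in>UNIV. pair (opexp (skew_lap a n) s (dq (axis j 1) (mesh n) x)) (dq (axis j 1) (mesh n) v))
        \<le> (\<Sum>j\<in>UNIV. norm (xg j) * norm (vg j))"
    proof (rule sum_norm_le)
      fix j
      have "norm (pair (opexp (skew_lap a n) s (dq (axis j 1) (mesh n) x)) (dq (axis j 1) (mesh n) v))
          \<le> norm (dq (axis j 1) (mesh n) x) * norm (dq (axis j 1) (mesh n) v)"
        using norm_pair_le[of "opexp (skew_lap a n) s (dq (axis j 1) (mesh n) x)"]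
        by (simp add: skew.norm_opexp[OF skew_skew_lap])
      also have "\<dots> \<le> norm (xg j) * norm (vg j)"
        by (intro mult_mono norm_dq_le x v) auto
      finally show "norm (pair (opexp (skew_lap a n) s (dq (axis j 1) (mesh n) x)) (dq (axis j 1) (mesh n) v)) \<le> norm (xg j) * norm (vg j)" .
    qed
    then show ?thesis by (simp add: q_def C_def norm_mult mult_left_mono)
  qed
  have int: "(q n has_integral (p n u - p n s)) {s..u}" if "s \<le> u" for n s u
    using that by (intro fundamental_theorem_of_calculus) (auto intro: has_vector_derivative_at_within p)
  have int': "p' u - p' s = integral {s..u} q'" if "s \<le> u" for s u
  proof (rule LIMSEQ_unique)
    show "(\<lambda>n. p n u - p n s) \<longlonglongrightarrow> p' u - p' s" by (intro tendsto_diff p_lim)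
    have "(\<lambda>n. integral {s..u} (q n)) \<longlonglongrightarrow> integral {s..u} q'"
      by (rule dominated_convergence(2)[where h="\<lambda>_. C"])
         (use int[OF that] q_bound q_lim in \<open>auto simp: has_integral_integrable\<close>)
    then show "(\<lambda>n. p n u - p n s) \<longlonglongrightarrow> integral {s..u} q'"
      by (simp add: integral_unique[OF int[OF that]])
  qed
  have "isCont q' s" for s
    unfolding q'_def isCont_def
    by (intro tendsto_mult tendsto_const tendsto_sum bounded_linear.tendsto[OF pair.bounded_linear_left]
        sch.isCont_U[unfolded isCont_def])
  \<comment> \<open>Integration starts at \<open>t - 1\<close>, so that \<open>t\<close> lies in the
    interior and the one-sided setting of the fundamental theorem yields a two-sided
    derivative.\<close>
  then have "((\<lambda>u. integral {t - 1..u} q') has_vector_derivative q' t) (at t within {t - 1..t + 1})"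
    by (intro integral_has_vector_derivative continuous_at_imp_continuous_on) auto
  then have "((\<lambda>u. p' (t - 1) + integral {t - 1..u} q') has_vector_derivative q' t) (at t within {t - 1..t + 1})"
    using has_vector_derivative_add[OF has_vector_derivative_const] by fastforce
  then have "(p' has_vector_derivative q' t) (at t within {t - 1..t + 1})"
    by (rule has_vector_derivative_transform[rotated 2]) (auto simp flip: int')
  then have "(p' has_vector_derivative q' t) (at t within {t - 1<..<t + 1})"
    by (rule has_vector_derivative_within_subset) auto
  then have "(p' has_vector_derivative q' t) (at t)"
    by (subst (asm) at_within_open) auto
  then show ?thesis unfolding p'_def[abs_def] q'_def .
qed

section \<open>Hardy's inequality\<close>

definition mulr :: "(real^3 \<Rightarrow> real) \<Rightarrow> l2 \<Rightarrow> l2" where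
  "mulr \<phi> f = abs_l2 (\<lambda>x. of_real (\<phi> x) * rep_l2 f x)"

lemma L2_mulr:
  assumes "\<phi> \<in> borel_measurable borel" "\<And>x. \<bar>\<phi> x\<bar> \<le> C" "f \<in> L2"
  shows "(\<lambda>x. of_real (\<phi> x) * f x) \<in> L2"
proof (rule L2_dominated[OF _ L2_cmul[OF assms(3), of "of_real C"]])
  show "(\<lambda>x. of_real (\<phi> x) * f x) \<in> borel_measurable borel"
    using assms(1) L2_measurable[OF assms(3)] by measurable
  have "\<bar>\<phi> x\<bar> * cmod (f x) \<le> \<bar>C\<bar> * cmod (f x)" for x
    using assms(2)[of x] by (intro mult_right_mono) auto
  then show "AE x in lborel. cmod (of_real (\<phi> x) * f x) \<le> cmod (of_real C * f x)"
    by (simp add: norm_mult)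
qed

lemma inner_mulr:
  assumes "\<phi> \<in> borel_measurable borel" "\<And>x. \<bar>\<phi> x\<bar> \<le> C"
  shows "inner (mulr \<phi> f) g = Re (LINT x|lborel. of_real (\<phi> x) * rep_l2 f x * cnj (rep_l2 g x))"
proof -
  have "inner (mulr \<phi> f) (abs_l2 (rep_l2 g)) = Re (LINT x|lborel. of_real (\<phi> x) * rep_l2 f x * cnj (rep_l2 g x))"
    unfolding mulr_def using L2_mulr[OF assms rep_in_L2] by (intro inner_l2.abs_eq) auto
  then show ?thesis by simp
qed

lemma norm_mulr_sq:
  assumes "\<phi> \<in> borel_measurable borel" "\<And>x. \<bar>\<phi> x\<bar> \<le> C"
  shows "(norm (mulr \<phi> f))\<^sup>2 = (LINT x|lborel. (\<phi> x)\<^sup>2 * (cmod (rep_l2 f x))\<^sup>2)"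
  unfolding mulr_def norm_abs[OF L2_mulr[OF assms rep_in_L2]] norm_L2_sq
  by (simp add: norm_mult power_mult_distrib)

lemma inner_mulr_commute:
  assumes "\<phi> \<in> borel_measurable borel" "\<And>x. \<bar>\<phi> x\<bar> \<le> C"
  shows "inner (mulr \<phi> f) g = inner f (mulr \<phi> g)"
proof -
  have "inner f (mulr \<phi> g) = Re (LINT x|lborel. of_real (\<phi> x) * rep_l2 g x * cnj (rep_l2 f x))"
    by (simp add: inner_commute[of f] inner_mulr[OF assms])
  also have "(LINT x|lborel. of_real (\<phi> x) * rep_l2 g x * cnj (rep_l2 f x)) =
      cnj (LINT x|lborel. of_real (\<phi> x) * rep_l2 f x * cnj (rep_l2 g x))"
    by (simp add: mult.assoc mult.commute[of "rep_l2 g _"] flip: Bochner_Integration.integral_cnj)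
  finally show ?thesis by (simp add: inner_mulr[OF assms])
qed

lemma bounded_linear_mulr:
  assumes "\<phi> \<in> borel_measurable borel" "\<And>x. \<bar>\<phi> x\<bar> \<le> C"
  shows "bounded_linear (mulr \<phi>)"
proof (rule bounded_linear_intro[where K="\<bar>C\<bar>"])
  fix f g :: l2 and r :: real
  note L = L2_mulr[OF assms rep_in_L2]
  have [measurable]: "\<phi> \<in> borel_measurable borel" by fact
  show "mulr \<phi> (f + g) = mulr \<phi> f + mulr \<phi> g"
    unfolding mulr_def abs_add[OF L L, symmetric] using rep_add[of f g]
    by (intro abs_eqI L L2_add) (auto elim!: eventually_mono simp: distrib_left)
  show "mulr \<phi> (r *\<^sub>R f) = r *\<^sub>R mulr \<phi> f"
    unfolding mulr_def abs_scaleR[OF L, symmetric] using rep_scaleR[of r f]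
    by (intro abs_eqI L L2_cmul) (auto elim!: eventually_mono)
  have "(norm (mulr \<phi> f))\<^sup>2 \<le> (LINT x|lborel. \<bar>C\<bar>\<^sup>2 * (cmod (rep_l2 f x))\<^sup>2)"
    unfolding norm_mulr_sq[OF assms]
  proof (rule integral_mono)
    show "integrable lborel (\<lambda>x. (\<phi> x)\<^sup>2 * (cmod (rep_l2 f x))\<^sup>2)"
      using L2_integrable[OF L] by (simp add: norm_mult power_mult_distrib)
    show "integrable lborel (\<lambda>x. \<bar>C\<bar>\<^sup>2 * (cmod (rep_l2 f x))\<^sup>2)"
      by (simp add: L2_integrable)
    show "(\<phi> x)\<^sup>2 * (cmod (rep_l2 f x))\<^sup>2 \<le> \<bar>C\<bar>\<^sup>2 * (cmod (rep_l2 f x))\<^sup>2" for x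
    proof (rule mult_right_mono)
      have "\<bar>\<phi> x\<bar> \<le> \<bar>C\<bar>" using assms(2)[of x] by linarith
      then show "(\<phi> x)\<^sup>2 \<le> \<bar>C\<bar>\<^sup>2" using power_mono[of "\<bar>\<phi> x\<bar>" "\<bar>C\<bar>" 2] by simp
    qed simp
  qed
  also have "\<dots> = (norm f * \<bar>C\<bar>)\<^sup>2" by (simp add: norm_sq_l2 power_mult_distrib)
  finally show "norm (mulr \<phi> f) \<le> norm f * \<bar>C\<bar>" by (rule power2_le_imp_le) simp
qed

lemma inner_mulr_self:
  assumes "\<phi> \<in> borel_measurable borel" "\<And>x. \<bar>\<phi> x\<bar> \<le> C"
  shows "inner (mulr \<phi> f) f = (LINT x|lborel. \<phi> x * (cmod (rep_l2 f x))\<^sup>2)"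
proof -
  have "of_real (\<phi> x) * rep_l2 f x * cnj (rep_l2 f x) = of_real (\<phi> x * (cmod (rep_l2 f x))\<^sup>2)" for x
    by (simp only: mult.assoc of_real_mult complex_norm_square)
  then show ?thesis unfolding inner_mulr[OF assms] by (simp only: integral_complex_of_real Re_complex_of_real)
qed

lemma integrable_mulr_sq:
  assumes "\<phi> \<in> borel_measurable borel" "\<And>x. \<bar>\<phi> x\<bar> \<le> C" "f \<in> L2"
  shows "integrable lborel (\<lambda>x. \<phi> x * (cmod (f x))\<^sup>2)"
proof (rule Bochner_Integration.integrable_bound)
  show "integrable lborel (\<lambda>x. C * (cmod (f x))\<^sup>2)" by (simp add: L2_integrable assms)
  show "(\<lambda>x. \<phi> x * (cmod (f x))\<^sup>2) \<in> borel_measurable lborel"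
    using assms(1) L2_measurable[OF assms(3)] by measurable
  show "AE x in lborel. norm (\<phi> x * (cmod (f x))\<^sup>2) \<le> norm (C * (cmod (f x))\<^sup>2)"
  proof (rule AE_I2)
    fix x
    have "\<bar>\<phi> x\<bar> \<le> \<bar>C\<bar>" using assms(2)[of x] by linarith
    then show "norm (\<phi> x * (cmod (f x))\<^sup>2) \<le> norm (C * (cmod (f x))\<^sup>2)"
      by (simp add: abs_mult mult_right_mono)
  qed
qed

text \<open>Summation by parts for difference quotients replaces the approximation of \<open>f\<close> by
  smooth functions.\<close>

lemma integral_by_parts_square:
  assumes f: "gen v f g" and \<phi>: "\<phi> \<in> borel_measurable borel" "\<And>x. \<bar>\<phi> x\<bar> \<le> C"
    and d: "\<And>x s. ((\<lambda>s. \<phi> (x + s *\<^sub>R v)) has_real_derivative d (x + s *\<^sub>R v)) (at s)"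
    and dm: "d \<in> borel_measurable borel" "\<And>x. \<bar>d x\<bar> \<le> C'"
  shows "(LINT x|lborel. d x * (cmod (rep_l2 f x))\<^sup>2) = - 2 * inner (mulr \<phi> g) f"
proof (rule LIMSEQ_unique)
  let ?u = "rep_l2 f"
  \<comment> \<open>A backward quotient of the weight: translating the integral of its shifted half
    turns it into a forward quotient of |f|^2.\<close>
  define A where "A n = (LINT x|lborel. ((\<phi> x - \<phi> (x + (- mesh n) *\<^sub>R v)) / mesh n) * (cmod (?u x))\<^sup>2)" for n
  have [measurable]: "\<phi> \<in> borel_measurable borel" "d \<in> borel_measurable borel" by fact+
  show "A \<longlonglongrightarrow> (LINT x|lborel. d x * (cmod (?u x))\<^sup>2)"
    unfolding A_def
  proof (rule Bochner_Integration.integral_dominated_convergence)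
    show "integrable lborel (\<lambda>x. C' * (cmod (?u x))\<^sup>2)" by (simp add: L2_integrable)
    show "AE x in lborel. (\<lambda>n. ((\<phi> x - \<phi> (x + (- mesh n) *\<^sub>R v)) / mesh n) * (cmod (?u x))\<^sup>2) \<longlonglongrightarrow> d x * (cmod (?u x))\<^sup>2"
    proof (rule AE_I2)
      fix x
      have "((\<lambda>h. (\<phi> (x + h *\<^sub>R v) - \<phi> x) / h) \<longlongrightarrow> d x) (at 0)"
        using d[of x 0] by (simp add: DERIV_def)
      then have "(\<lambda>n. (\<phi> (x + (- mesh n) *\<^sub>R v) - \<phi> x) / (- mesh n)) \<longlonglongrightarrow> d x"
        using mesh_nz tendsto_minus[OF mesh_lim] unfolding tendsto_at_iff_sequentially comp_def
        by (auto dest!: spec[of _ "\<lambda>n. - mesh n"])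
      then have "(\<lambda>n. (\<phi> x - \<phi> (x + (- mesh n) *\<^sub>R v)) / mesh n) \<longlonglongrightarrow> d x"
        by (simp only: minus_diff_eq[of "\<phi> (_ + _)", symmetric] divide_minus_left divide_minus_right)
      then show "(\<lambda>n. ((\<phi> x - \<phi> (x + (- mesh n) *\<^sub>R v)) / mesh n) * (cmod (?u x))\<^sup>2) \<longlonglongrightarrow> d x * (cmod (?u x))\<^sup>2"
        by (intro tendsto_intros)
    qed
    show "AE x in lborel. norm (((\<phi> x - \<phi> (x + (- mesh n) *\<^sub>R v)) / mesh n) * (cmod (?u x))\<^sup>2) \<le> C' * (cmod (?u x))\<^sup>2" for n
    proof (rule AE_I2)
      fix x
      have "norm (\<phi> (x + 0 *\<^sub>R v) - \<phi> (x + (- mesh n) *\<^sub>R v)) \<le> C' * \<bar>0 - (- mesh n)\<bar>"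
        by (rule has_vector_derivative_bound[OF convex_UNIV, of "\<lambda>s. \<phi> (x + s *\<^sub>R v)" "\<lambda>s. d (x + s *\<^sub>R v)"])
           (use d dm in \<open>auto simp flip: has_real_derivative_iff_has_vector_derivative\<close>)
      then have "\<bar>(\<phi> x - \<phi> (x + (- mesh n) *\<^sub>R v)) / mesh n\<bar> \<le> C'"
        using mesh_nz[of n] by (simp add: field_simps)
      then show "norm (((\<phi> x - \<phi> (x + (- mesh n) *\<^sub>R v)) / mesh n) * (cmod (?u x))\<^sup>2) \<le> C' * (cmod (?u x))\<^sup>2"
        unfolding norm_mult using abs_ge_zero[of "d x"] dm(2)[of x] by (intro mult_mono) auto
    qed
  qed measurable
  have A_eq: "A n = - inner (mulr \<phi> (dq v (mesh n) f)) (transl (mesh n *\<^sub>R v) f + f)" for n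
  proof -
    let ?h = "mesh n" and ?Tf = "transl (mesh n *\<^sub>R v) f"
    interpret M: bounded_linear "mulr \<phi>" by (rule bounded_linear_mulr[OF \<phi>])
    have int1: "integrable lborel (\<lambda>x. \<phi> x * (cmod (?u x))\<^sup>2)"
      by (rule integrable_mulr_sq[OF \<phi>]) simp
    have int2: "integrable lborel (\<lambda>x. \<phi> (x + (- ?h) *\<^sub>R v) * (cmod (?u x))\<^sup>2)"
      by (rule integrable_mulr_sq[where C=C]) (use \<phi>(2) in auto)
    have "A n = (LINT x|lborel. (1 / ?h) * (\<phi> x * (cmod (?u x))\<^sup>2 - \<phi> (x + (- ?h) *\<^sub>R v) * (cmod (?u x))\<^sup>2))"
      unfolding A_def by (simp add: diff_divide_distrib left_diff_distrib)
    also have "\<dots> = (1 / ?h) * ((LINT x|lborel. \<phi> x * (cmod (?u x))\<^sup>2) -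
        (LINT x|lborel. \<phi> (x + (- ?h) *\<^sub>R v) * (cmod (?u x))\<^sup>2))"
      by (simp only: integral_mult_right_zero Bochner_Integration.integral_diff[OF int1 int2])
    also have "(LINT x|lborel. \<phi> (x + (- ?h) *\<^sub>R v) * (cmod (?u x))\<^sup>2) =
        (LINT x|lborel. \<phi> x * (cmod (?u (x + ?h *\<^sub>R v)))\<^sup>2)"
      using integral_translate[of "\<lambda>x. \<phi> (x + (- ?h) *\<^sub>R v) * (cmod (?u x))\<^sup>2" "?h *\<^sub>R v"] by simp
    also have "\<dots> = (LINT x|lborel. \<phi> x * (cmod (rep_l2 ?Tf x))\<^sup>2)"
      using rep_transl[of "?h *\<^sub>R v" f] by (intro integral_cong_AE) (auto elim!: eventually_mono)
    also have "\<dots> = inner (mulr \<phi> ?Tf) ?Tf" by (simp add: inner_mulr_self[OF \<phi>])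
    also have "(LINT x|lborel. \<phi> x * (cmod (?u x))\<^sup>2) = inner (mulr \<phi> f) f"
      by (simp add: inner_mulr_self[OF \<phi>])
    \<comment> \<open>A difference of squares for the symmetric form given by the weight. In the
      limit the second factor becomes 2 f, the source of the factor 2 in the claim.\<close>
    also have "inner (mulr \<phi> f) f - inner (mulr \<phi> ?Tf) ?Tf = - inner (mulr \<phi> (?Tf - f)) (?Tf + f)"
      using inner_mulr_commute[OF \<phi>, of f ?Tf]
      by (simp add: M.diff inner_diff_left inner_add_right inner_commute[of f])
    finally show ?thesis by (simp add: dq_def M.scaleR)
  qed
  have "(\<lambda>n. - inner (mulr \<phi> (dq v (mesh n) f)) (transl (mesh n *\<^sub>R v) f + f)) \<longlonglongrightarrow> - inner (mulr \<phi> g) (f + f)"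
    by (intro tendsto_intros bounded_linear.tendsto[OF bounded_linear_mulr[OF \<phi>]]
        tendsto_mesh[OF f[unfolded gen_def]] tendsto_mesh[OF tendsto_transl_0])
  then show "A \<longlonglongrightarrow> - 2 * inner (mulr \<phi> g) f" by (simp add: A_eq[abs_def] inner_add_right)
qed

lemma norm_sq_vec3: "(norm (y::real^3))\<^sup>2 = (\<Sum>j\<in>UNIV. (y$j)\<^sup>2)"
  by (simp add: norm_vec_def L2_set_def sum_nonneg)

text \<open>The vector field \<open>y / (\<bar>y\<bar>\<^sup>2 + \<epsilon>\<^sup>2)\<close> has divergence at least \<open>1 / (\<bar>y\<bar>\<^sup>2 + \<epsilon>\<^sup>2)\<close>, and its
  square is at most that weight.\<close>

lemma hardy_regularized:
  assumes f: "\<And>j. gen (axis j 1) f (g j)" and \<epsilon>: "\<epsilon> > 0"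
  shows "(LINT y|lborel. (cmod (rep_l2 f y))\<^sup>2 / ((norm y)\<^sup>2 + \<epsilon>\<^sup>2)) \<le> 4 * (\<Sum>j\<in>UNIV. (norm (g j))\<^sup>2)"
proof -
  let ?u = "rep_l2 f"
  define K where "K y = 1 / ((norm y)\<^sup>2 + \<epsilon>\<^sup>2)" for y :: "real^3"
  define \<phi> where "\<phi> j y = y$j * K y" for j and y :: "real^3"
  \<comment> \<open>This is the j-th partial derivative of the j-th component. Over three
    coordinates the sum is 3 K minus twice a quantity of at most K, hence at least K.\<close>
  define d where "d j y = K y - 2 * (\<phi> j y)\<^sup>2" for j and y :: "real^3"
  have pos: "(norm y)\<^sup>2 + \<epsilon>\<^sup>2 > 0" for y :: "real^3" using \<epsilon> by (simp add: add_nonneg_pos)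
  have K0: "0 \<le> K y" for y using pos[of y] by (simp add: K_def)
  have K1: "K y \<le> 1 / \<epsilon>\<^sup>2" for y using \<epsilon> by (simp add: K_def frac_le)
  have Km [measurable]: "K \<in> borel_measurable borel" unfolding K_def by measurable
  have \<phi>m [measurable]: "\<phi> j \<in> borel_measurable borel" for j
    unfolding \<phi>_def by (intro borel_measurable_times Km borel_measurable_continuous_onI continuous_intros)
  have dm [measurable]: "d j \<in> borel_measurable borel" for j unfolding d_def by measurable
  have sum\<phi>: "(\<Sum>j\<in>UNIV. (\<phi> j y)\<^sup>2) \<le> K y" for y
  proof -
    have "(\<Sum>j\<in>UNIV. (\<phi> j y)\<^sup>2) = (\<Sum>j\<in>UNIV. (y$j)\<^sup>2) * (K y)\<^sup>2"
      by (simp add: \<phi>_def power_mult_distrib sum_distrib_right)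
    also have "\<dots> = (norm y)\<^sup>2 * K y * K y"
      by (simp add: norm_sq_vec3 power2_eq_square[of "K y"] mult.assoc)
    also have "\<dots> \<le> 1 * K y"
      using pos[of y] by (intro mult_right_mono K0) (simp add: K_def)
    finally show ?thesis by simp
  qed
  have \<phi>sq: "(\<phi> j y)\<^sup>2 \<le> K y" for j y
    using sum\<phi>[of y] member_le_sum[of j UNIV "\<lambda>j. (\<phi> j y)\<^sup>2"] by simp
  have \<phi>b: "\<bar>\<phi> j y\<bar> \<le> 1 / \<epsilon>" for j y
  proof -
    have "\<bar>\<phi> j y\<bar>\<^sup>2 \<le> (1 / \<epsilon>)\<^sup>2" using \<phi>sq[of j y] K1[of y] by (simp add: power_divide)
    then show ?thesis by (rule power2_le_imp_le) (use \<epsilon> in simp)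
  qed
  have db: "\<bar>d j y\<bar> \<le> 2 / \<epsilon>\<^sup>2" for j y
  proof -
    have "2 / \<epsilon>\<^sup>2 = 2 * (1 / \<epsilon>\<^sup>2)" by simp
    then show ?thesis
      using \<phi>sq[of j y] K1[of y] K0[of y] zero_le_power2[of "\<phi> j y"] unfolding d_def abs_le_iff by linarith
  qed
  have deriv: "((\<lambda>s. \<phi> j (y + s *\<^sub>R axis j 1)) has_real_derivative d j (y + s *\<^sub>R axis j 1)) (at s)" for j y s
  proof -
    define N where "N s = (norm y)\<^sup>2 + 2 * s * y$j + s\<^sup>2 + \<epsilon>\<^sup>2" for s
    have N: "(norm (y + s *\<^sub>R axis j 1))\<^sup>2 + \<epsilon>\<^sup>2 = N s" for s
      unfolding N_def power2_norm_eq_inner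
      by (simp add: inner_add_left inner_add_right inner_commute[of "axis j 1" y]
          inner_axis power2_eq_square inner_axis_axis algebra_simps)
    have Npos: "N s > 0" for s using pos[of "y + s *\<^sub>R axis j 1"] by (simp add: N)
    have "((\<lambda>s. (y$j + s) / N s) has_real_derivative 1 / N s - 2 * ((y$j + s) / N s)\<^sup>2) (at s)"
      using Npos[of s] unfolding N_def
      by (auto intro!: derivative_eq_intros simp: divide_simps power2_eq_square)
    moreover have "\<phi> j (y + s *\<^sub>R axis j 1) = (y$j + s) / N s" for s
    proof -
      have "(y + s *\<^sub>R axis j 1) $ j = y$j + s" by (simp add: axis_def)
      then show ?thesis unfolding \<phi>_def K_def N by simp
    qed
    ultimately show ?thesis by (simp add: d_def K_def N)
  qed
  have parts: "(LINT y|lborel. d j y * (cmod (?u y))\<^sup>2) = - 2 * inner (mulr (\<phi> j) (g j)) f" for j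
    by (rule integral_by_parts_square[OF f \<phi>m \<phi>b deriv dm db])
  have intd: "integrable lborel (\<lambda>y. d j y * (cmod (?u y))\<^sup>2)" for j
    by (rule integrable_mulr_sq[OF dm db]) simp
  have int\<phi>: "integrable lborel (\<lambda>y. (\<phi> j y)\<^sup>2 * (cmod (?u y))\<^sup>2)" for j
    by (rule integrable_mulr_sq[where C="1 / \<epsilon>\<^sup>2"]) (use order_trans[OF \<phi>sq K1] in auto)
  have intK: "integrable lborel (\<lambda>y. K y * (cmod (?u y))\<^sup>2)"
    by (rule integrable_mulr_sq[where C="1 / \<epsilon>\<^sup>2"]) (use K0 K1 in auto)
  define k where "k = (LINT y|lborel. K y * (cmod (?u y))\<^sup>2)"
  have "(\<Sum>j\<in>UNIV. (norm (mulr (\<phi> j) f))\<^sup>2) = (LINT y|lborel. (\<Sum>j\<in>UNIV. (\<phi> j y)\<^sup>2 * (cmod (?u y))\<^sup>2))"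
    by (simp add: norm_mulr_sq[OF \<phi>m \<phi>b] Bochner_Integration.integral_sum[OF int\<phi>])
  also have "\<dots> \<le> k"
    unfolding k_def
  proof (rule integral_mono[OF _ intK])
    show "integrable lborel (\<lambda>y. \<Sum>j\<in>UNIV. (\<phi> j y)\<^sup>2 * (cmod (?u y))\<^sup>2)"
      by (intro Bochner_Integration.integrable_sum int\<phi>)
    show "(\<Sum>j\<in>UNIV. (\<phi> j y)\<^sup>2 * (cmod (?u y))\<^sup>2) \<le> K y * (cmod (?u y))\<^sup>2" for y
      using sum\<phi>[of y] by (simp add: mult_right_mono flip: sum_distrib_right)
  qed
  finally have sum_le: "(\<Sum>j\<in>UNIV. (norm (mulr (\<phi> j) f))\<^sup>2) \<le> k" .
  have "k \<le> (LINT y|lborel. (\<Sum>j\<in>UNIV. d j y * (cmod (?u y))\<^sup>2))"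
    unfolding k_def
  proof (rule integral_mono[OF intK])
    show "integrable lborel (\<lambda>y. \<Sum>j\<in>UNIV. d j y * (cmod (?u y))\<^sup>2)"
      by (intro Bochner_Integration.integrable_sum intd)
    fix y
    have "K y \<le> (\<Sum>j\<in>UNIV. d j y)"
      using sum\<phi>[of y] by (simp add: d_def sum_subtractf flip: sum_distrib_left)
    then show "K y * (cmod (?u y))\<^sup>2 \<le> (\<Sum>j\<in>UNIV. d j y * (cmod (?u y))\<^sup>2)"
      by (simp add: mult_right_mono flip: sum_distrib_right)
  qed
  also have "\<dots> = (\<Sum>j\<in>UNIV. - 2 * inner (mulr (\<phi> j) (g j)) f)"
    by (simp add: Bochner_Integration.integral_sum[OF intd] parts)
  also have "\<dots> \<le> (\<Sum>j\<in>UNIV. 2 * (norm (g j))\<^sup>2 + (norm (mulr (\<phi> j) f))\<^sup>2 / 2)"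
  proof (rule sum_mono)
    fix j
    have "- 2 * inner (mulr (\<phi> j) (g j)) f = - 2 * inner (g j) (mulr (\<phi> j) f)"
      by (simp add: inner_mulr_commute[OF \<phi>m \<phi>b])
    also have "\<dots> \<le> 2 * (norm (g j) * norm (mulr (\<phi> j) f))"
      using Cauchy_Schwarz_ineq2[of "g j" "mulr (\<phi> j) f"] by linarith
    \<comment> \<open>The weights 2 and 1/2 are chosen so that the last sum contributes at most half
      of the left-hand side. Absorbing it doubles the remaining factor 2 to 4, the classical
      constant in dimension three.\<close>
    also have "\<dots> \<le> 2 * (norm (g j))\<^sup>2 + (norm (mulr (\<phi> j) f))\<^sup>2 / 2"
      using zero_le_power2[of "2 * norm (g j) - norm (mulr (\<phi> j) f)"]
      by (simp add: power2_eq_square algebra_simps)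
    finally show "- 2 * inner (mulr (\<phi> j) (g j)) f \<le> 2 * (norm (g j))\<^sup>2 + (norm (mulr (\<phi> j) f))\<^sup>2 / 2" .
  qed
  also have "\<dots> = 2 * (\<Sum>j\<in>UNIV. (norm (g j))\<^sup>2) + (\<Sum>j\<in>UNIV. (norm (mulr (\<phi> j) f))\<^sup>2) / 2"
    by (simp only: sum.distrib sum_distrib_left sum_divide_distrib)
  finally have "k \<le> 4 * (\<Sum>j\<in>UNIV. (norm (g j))\<^sup>2)" using sum_le by simp
  then show ?thesis by (simp add: k_def K_def)
qed

text \<open>Fatou's lemma removes the regularisation, along epsilon = 1 / (n + 1).\<close>

lemma hardy_at_0:
  assumes f: "\<And>j. gen (axis j 1) f (g j)"
  shows "(\<integral>\<^sup>+y. ennreal ((cmod (rep_l2 f y) / norm y)\<^sup>2) \<partial>lborel) \<le> ennreal (4 * (\<Sum>j\<in>UNIV. (norm (g j))\<^sup>2))"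
proof -
  let ?u = "rep_l2 f" and ?C = "4 * (\<Sum>j\<in>UNIV. (norm (g j))\<^sup>2)"
  have pos: "(norm y)\<^sup>2 + (mesh n)\<^sup>2 > 0" for y :: "real^3" and n using mesh_nz[of n] by (simp add: add_nonneg_pos)
  have "(\<integral>\<^sup>+y. ennreal ((cmod (?u y) / norm y)\<^sup>2) \<partial>lborel)
      \<le> (\<integral>\<^sup>+y. liminf (\<lambda>n. ennreal ((cmod (?u y))\<^sup>2 / ((norm y)\<^sup>2 + (mesh n)\<^sup>2))) \<partial>lborel)"
  proof (rule nn_integral_mono)
    fix y
    show "ennreal ((cmod (?u y) / norm y)\<^sup>2) \<le> liminf (\<lambda>n. ennreal ((cmod (?u y))\<^sup>2 / ((norm y)\<^sup>2 + (mesh n)\<^sup>2)))"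
    \<comment> \<open>At the origin the quotient on the left is zero by the convention for division,
      so the inequality is trivial there.\<close>
    proof (cases "y = 0")
      case False
      have "(\<lambda>n. ennreal ((cmod (?u y))\<^sup>2 / ((norm y)\<^sup>2 + (mesh n)\<^sup>2))) \<longlonglongrightarrow> ennreal ((cmod (?u y))\<^sup>2 / ((norm y)\<^sup>2 + 0\<^sup>2))"
        by (intro tendsto_ennrealI tendsto_intros mesh_lim) (use False in simp)
      then have "liminf (\<lambda>n. ennreal ((cmod (?u y))\<^sup>2 / ((norm y)\<^sup>2 + (mesh n)\<^sup>2))) = ennreal ((cmod (?u y))\<^sup>2 / ((norm y)\<^sup>2 + 0\<^sup>2))"
        by (rule lim_imp_Liminf[rotated]) simp
      then show ?thesis by (simp add: power_divide)
    qed simp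
  qed
  also have "\<dots> \<le> liminf (\<lambda>n. \<integral>\<^sup>+y. ennreal ((cmod (?u y))\<^sup>2 / ((norm y)\<^sup>2 + (mesh n)\<^sup>2)) \<partial>lborel)"
    by (rule nn_integral_liminf) measurable
  also have "\<dots> \<le> ennreal ?C"
  proof (rule Liminf_le)
    show "\<forall>\<^sub>F n in sequentially. (\<integral>\<^sup>+y. ennreal ((cmod (?u y))\<^sup>2 / ((norm y)\<^sup>2 + (mesh n)\<^sup>2)) \<partial>lborel) \<le> ennreal ?C"
    proof (rule always_eventually, rule allI)
      fix n
      have h: "mesh n > 0" by (simp add: mesh_def)
      have "integrable lborel (\<lambda>y. (1 / ((norm y)\<^sup>2 + (mesh n)\<^sup>2)) * (cmod (?u y))\<^sup>2)"
      proof (rule integrable_mulr_sq[where C="1 / (mesh n)\<^sup>2"])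
        show "\<bar>1 / ((norm y)\<^sup>2 + (mesh n)\<^sup>2)\<bar> \<le> 1 / (mesh n)\<^sup>2" for y :: "real^3"
          using h by (simp add: frac_le)
      qed auto
      then have "(\<integral>\<^sup>+y. ennreal ((cmod (?u y))\<^sup>2 / ((norm y)\<^sup>2 + (mesh n)\<^sup>2)) \<partial>lborel)
          = ennreal (LINT y|lborel. (cmod (?u y))\<^sup>2 / ((norm y)\<^sup>2 + (mesh n)\<^sup>2))"
        using pos by (intro nn_integral_eq_integral) (auto simp: less_imp_le)
      also have "\<dots> \<le> ennreal ?C" by (intro ennreal_leI hardy_regularized f h)
      finally show "(\<integral>\<^sup>+y. ennreal ((cmod (?u y))\<^sup>2 / ((norm y)\<^sup>2 + (mesh n)\<^sup>2)) \<partial>lborel) \<le> ennreal ?C" .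
    qed
  qed simp
  finally show ?thesis .
qed

definition sobolev :: "(l2 \<times> (l2^3)) set" where
  "sobolev = {w. \<forall>j. gen (axis j 1) (fst w) (snd w $ j)}"

text \<open>Translation moves the pole from \<open>x\<close> to the origin and leaves the norm of
  the gradient unchanged; hence a bound uniform in \<open>x\<close>.\<close>

theorem hardy:
  assumes w: "w \<in> sobolev"
  shows "(\<lambda>y. rep_l2 (fst w) y / of_real (norm (x - y))) \<in> L2" (is "?q \<in> L2")
    and "norm_L2 (\<lambda>y. rep_l2 (fst w) y / of_real (norm (x - y))) \<le> 2 * norm (snd w)"
proof -
  define f where "f = fst w"
  let ?C = "4 * (\<Sum>j\<in>UNIV. (norm (snd w $ j))\<^sup>2)"
  have qm [measurable]: "?q \<in> borel_measurable borel" by measurable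
  have "(\<integral>\<^sup>+y. ennreal ((cmod (?q y))\<^sup>2) \<partial>lborel) = (\<integral>\<^sup>+y. ennreal ((cmod (?q y))\<^sup>2) \<partial>distr lborel borel ((+) x))"
    by (simp only: lborel_distr_plus)
  also have "\<dots> = (\<integral>\<^sup>+y. ennreal ((cmod (?q (x + y)))\<^sup>2) \<partial>lborel)"
    by (rule nn_integral_distr) measurable
  also have "\<dots> = (\<integral>\<^sup>+y. ennreal ((cmod (rep_l2 (transl x f) y) / norm y)\<^sup>2) \<partial>lborel)"
    using rep_transl[of x f] by (intro nn_integral_cong_AE)
      (auto elim!: eventually_mono simp: f_def norm_divide add.commute)
  also have "\<dots> \<le> ennreal (4 * (\<Sum>j\<in>UNIV. (norm (transl x (snd w $ j)))\<^sup>2))"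
    by (rule hardy_at_0) (use w in \<open>auto simp: sobolev_def f_def intro: gen_transl\<close>)
  finally have le: "(\<integral>\<^sup>+y. ennreal ((cmod (?q y))\<^sup>2) \<partial>lborel) \<le> ennreal ?C" by simp
  have int: "integrable lborel (\<lambda>y. (cmod (?q y))\<^sup>2)"
  proof (rule integrableI_bounded)
    show "(\<integral>\<^sup>+y. ennreal (norm ((cmod (?q y))\<^sup>2)) \<partial>lborel) < \<infinity>"
      using le by (auto simp: le_less_trans)
  qed measurable
  then show "?q \<in> L2" by (intro L2_I) measurable
  have "ennreal (LINT y|lborel. (cmod (?q y))\<^sup>2) \<le> ennreal ?C"
    using le nn_integral_eq_integral[OF int] by simp
  then have "(norm_L2 ?q)\<^sup>2 \<le> ?C" by (simp add: norm_L2_sq sum_nonneg)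
  also have "?C = (2 * norm (snd w))\<^sup>2"
    by (simp add: norm_vec_def L2_set_def power_mult_distrib sum_nonneg)
  finally show "norm_L2 ?q \<le> 2 * norm (snd w)" by (rule power2_le_imp_le) simp
qed

section \<open>The nonlinearity\<close>

lemma sobolev_gen: "w \<in> sobolev \<Longrightarrow> gen (axis j 1) (fst w) (snd w $ j)"
  by (simp add: sobolev_def)
lemma sobolev_0: "0 \<in> sobolev"
  by (simp add: sobolev_def gen_0)
lemma sobolev_add: "w \<in> sobolev \<Longrightarrow> w' \<in> sobolev \<Longrightarrow> w + w' \<in> sobolev"
  by (simp add: sobolev_def gen_add)
lemma sobolev_diff: "w \<in> sobolev \<Longrightarrow> w' \<in> sobolev \<Longrightarrow> w - w' \<in> sobolev"
  by (simp add: sobolev_def gen_diff)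
lemma sobolev_scaleR: "w \<in> sobolev \<Longrightarrow> r *\<^sub>R w \<in> sobolev"
  by (simp add: sobolev_def gen_scaleR)
lemma closed_sobolev: "closed sobolev"
  unfolding closed_sequential_limits
proof (intro allI impI, elim conjE)
  fix w l assume w: "\<forall>n. w n \<in> sobolev" "w \<longlonglongrightarrow> l"
  show "l \<in> sobolev"
    unfolding sobolev_def
  proof (intro CollectI allI)
    fix j
    show "gen (axis j 1) (fst l) (snd l $ j)"
      by (rule gen_closed[of "axis j 1" "\<lambda>n. fst (w n)" "\<lambda>n. snd (w n) $ j"])
         (use w in \<open>auto intro: sobolev_gen intro!: tendsto_intros\<close>)
  qed
qed

definition transl_pair :: "real^3 \<Rightarrow> l2 \<times> (l2^3) \<Rightarrow> l2 \<times> (l2^3)" where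
  "transl_pair v w = (transl v (fst w), \<chi> j. transl v (snd w $ j))"

lemma fst_transl_pair [simp]: "fst (transl_pair v w) = transl v (fst w)"
  by (simp add: transl_pair_def)
lemma snd_transl_pair [simp]: "snd (transl_pair v w) $ j = transl v (snd w $ j)"
  by (simp add: transl_pair_def)
lemma transl_pair_sobolev: "w \<in> sobolev \<Longrightarrow> transl_pair v w \<in> sobolev"
  by (simp add: sobolev_def gen_transl)
lemma norm_snd_transl_pair [simp]: "norm (snd (transl_pair v w)) = norm (snd w)"
  by (simp add: norm_vec_def)
lemma tendsto_transl_pair: "((\<lambda>h. transl_pair (h *\<^sub>R v) w) \<longlongrightarrow> w) (at 0)"
proof -
  have "((\<lambda>h. transl_pair (h *\<^sub>R v) w) \<longlongrightarrow> (fst w, \<chi> j. snd w $ j)) (at 0)"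
    unfolding transl_pair_def by (intro tendsto_intros tendsto_transl_0)
  then show ?thesis by simp
qed

text \<open>Integrability is recorded separately: the integral of a non-integrable function is zero
  by convention, so additivity of \<open>pot\<close> in its densities cannot be inferred from its
  values.\<close>

definition pot_valid :: "l2 \<Rightarrow> l2 \<Rightarrow> bool" where
  "pot_valid a b \<longleftrightarrow> (\<forall>x. integrable lborel (\<lambda>y. rep_l2 a y * cnj (rep_l2 b y) / of_real (norm (x - y))))"

definition pot :: "l2 \<Rightarrow> l2 \<Rightarrow> real^3 \<Rightarrow> complex" where
  "pot a b x = (LINT y|lborel. rep_l2 a y * cnj (rep_l2 b y) / of_real (norm (x - y)))"

text \<open>The cubic Hartree term with its three slots separated; \<open>g1\<close> is its
  diagonal. It is conjugate-linear in the second slot, but differences and real multiples behave as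
  for a trilinear map.\<close>

definition tau :: "l2 \<Rightarrow> l2 \<Rightarrow> l2 \<Rightarrow> l2" where
  "tau a b c = abs_l2 (\<lambda>x. pot a b x * rep_l2 c x)"

definition pot_bounded :: "l2 \<Rightarrow> l2 \<Rightarrow> bool" where
  "pot_bounded a b \<longleftrightarrow> pot_valid a b \<and> (\<exists>C. \<forall>x. cmod (pot a b x) \<le> C)"

section \<open>Bounds and multilinearity of the potential\<close>

lemma cnj_measurable [measurable]: "cnj \<in> borel_measurable borel"
  by (intro borel_measurable_continuous_onI continuous_intros)

lemma pot_measurable [measurable]: "pot a b \<in> borel_measurable borel"
  unfolding pot_def[abs_def] by measurable

text \<open>The singular weight is attached to the factor with a gradient, where Hardy's inequality
  applies, and the other factor is only in L2. Both this and \<open>pot_right\<close> are required,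
  because the product rule differentiates either density.\<close>

lemma pot_left:
  assumes w: "w \<in> sobolev"
  shows "pot_valid (fst w) b" "cmod (pot (fst w) b x) \<le> 2 * norm (snd w) * norm b"
proof -
  have eq: "rep_l2 (fst w) y * cnj (rep_l2 b y) / of_real (norm (x - y)) =
      rep_l2 (fst w) y / of_real (norm (x - y)) * cnj (rep_l2 b y)" for x y by simp
  note h = hardy[OF w]
  show "pot_valid (fst w) b"
    unfolding pot_valid_def eq by (intro allI L2_mult_integrable h L2_cnj rep_in_L2)
  have "cmod (pot (fst w) b x) \<le> norm_L2 (\<lambda>y. rep_l2 (fst w) y / of_real (norm (x - y))) * norm_L2 (\<lambda>y. cnj (rep_l2 b y))"
    unfolding pot_def eq by (rule L2_Cauchy_Schwarz') (intro h L2_cnj rep_in_L2)+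
  also have "norm_L2 (\<lambda>y. cnj (rep_l2 b y)) = norm b" by (simp add: norm_rep norm_L2_def)
  also have "norm_L2 (\<lambda>y. rep_l2 (fst w) y / of_real (norm (x - y))) * norm b \<le> 2 * norm (snd w) * norm b"
    by (intro mult_right_mono h) simp
  finally show "cmod (pot (fst w) b x) \<le> 2 * norm (snd w) * norm b" .
qed

lemma pot_right:
  assumes w: "w \<in> sobolev"
  shows "pot_valid a (fst w)" "cmod (pot a (fst w) x) \<le> 2 * norm a * norm (snd w)"
proof -
  have eq: "rep_l2 a y * cnj (rep_l2 (fst w) y) / of_real (norm (x - y)) =
      rep_l2 a y * cnj (rep_l2 (fst w) y / of_real (norm (x - y)))" for x y by simp
  note h = hardy[OF w]
  show "pot_valid a (fst w)"
    unfolding pot_valid_def eq by (intro allI L2_mult_integrable h L2_cnj rep_in_L2)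
  have "cmod (pot a (fst w) x) \<le> norm_L2 (rep_l2 a) * norm_L2 (\<lambda>y. cnj (rep_l2 (fst w) y / of_real (norm (x - y))))"
    unfolding pot_def eq by (rule L2_Cauchy_Schwarz') (intro h L2_cnj rep_in_L2)+
  also have "norm_L2 (\<lambda>y. cnj (rep_l2 (fst w) y / of_real (norm (x - y)))) = norm_L2 (\<lambda>y. rep_l2 (fst w) y / of_real (norm (x - y)))"
    by (simp only: norm_L2_def complex_mod_cnj)
  also have "norm_L2 (rep_l2 a) * \<dots> \<le> norm_L2 (rep_l2 a) * (2 * norm (snd w))"
    by (intro mult_left_mono h) simp
  finally show "cmod (pot a (fst w) x) \<le> 2 * norm a * norm (snd w)" by (simp add: norm_rep mult_ac)
qed

lemma pot_bounded_left: "w \<in> sobolev \<Longrightarrow> pot_bounded (fst w) b"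
  using pot_left unfolding pot_bounded_def by blast
lemma pot_bounded_right: "w \<in> sobolev \<Longrightarrow> pot_bounded a (fst w)"
  using pot_right unfolding pot_bounded_def by blast

lemma pot_diff_left:
  assumes "pot_valid a b" "pot_valid a' b"
  shows "pot (a - a') b x = pot a b x - pot a' b x"
proof -
  have "pot (a - a') b x = (LINT y|lborel. rep_l2 a y * cnj (rep_l2 b y) / of_real (norm (x - y))
      - rep_l2 a' y * cnj (rep_l2 b y) / of_real (norm (x - y)))"
    unfolding pot_def using rep_diff[of a a']
    by (intro integral_cong_AE) (auto elim!: eventually_mono simp: left_diff_distrib diff_divide_distrib)
  then show ?thesis using assms by (simp add: pot_valid_def pot_def)
qed

lemma pot_diff_right:
  assumes "pot_valid a b" "pot_valid a b'"
  shows "pot a (b - b') x = pot a b x - pot a b' x"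
proof -
  have "pot a (b - b') x = (LINT y|lborel. rep_l2 a y * cnj (rep_l2 b y) / of_real (norm (x - y))
      - rep_l2 a y * cnj (rep_l2 b' y) / of_real (norm (x - y)))"
    unfolding pot_def using rep_diff[of b b']
    by (intro integral_cong_AE) (auto elim!: eventually_mono simp: right_diff_distrib diff_divide_distrib)
  then show ?thesis using assms by (simp add: pot_valid_def pot_def)
qed

lemma pot_scaleR_left: "pot (r *\<^sub>R a) b x = of_real r * pot a b x"
proof -
  have "pot (r *\<^sub>R a) b x = (LINT y|lborel. of_real r * (rep_l2 a y * cnj (rep_l2 b y) / of_real (norm (x - y))))"
    unfolding pot_def using rep_scaleR[of r a]
    by (intro integral_cong_AE) (auto elim!: eventually_mono)
  then show ?thesis by (simp only: integral_mult_right_zero pot_def)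
qed

lemma pot_scaleR_right: "pot a (r *\<^sub>R b) x = of_real r * pot a b x"
proof -
  have "pot a (r *\<^sub>R b) x = (LINT y|lborel. of_real r * (rep_l2 a y * cnj (rep_l2 b y) / of_real (norm (x - y))))"
    unfolding pot_def using rep_scaleR[of r b]
    by (intro integral_cong_AE) (auto elim!: eventually_mono)
  then show ?thesis by (simp only: integral_mult_right_zero pot_def)
qed

text \<open>The kernel depends only on the difference of its arguments, so moving both densities
  moves the potential.\<close>

lemma pot_transl: "pot (transl v a) (transl v b) x = pot a b (x + v)"
proof -
  have "pot (transl v a) (transl v b) x = (LINT y|lborel. rep_l2 a (y + v) * cnj (rep_l2 b (y + v)) / of_real (norm ((x + v) - (y + v))))"
    unfolding pot_def using rep_transl[of v a] rep_transl[of v b]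
    by (intro integral_cong_AE) (auto elim!: eventually_elim2)
  also have "\<dots> = pot a b (x + v)"
    unfolding pot_def
    by (rule integral_translate[of "\<lambda>y. rep_l2 a y * cnj (rep_l2 b y) / of_real (norm ((x + v) - y))"]) measurable
  finally show ?thesis .
qed

lemma tau_L2: assumes "pot_bounded a b" "f \<in> L2" shows "(\<lambda>x. pot a b x * f x) \<in> L2"
proof -
  obtain C where C: "\<And>x. cmod (pot a b x) \<le> C" using assms by (auto simp: pot_bounded_def)
  have [measurable]: "f \<in> borel_measurable borel" using assms(2) by (rule L2_measurable)
  show ?thesis
  proof (rule L2_dominated[OF _ L2_cmul[OF assms(2), of "of_real C"]])
    have "cmod (pot a b x) * cmod (f x) \<le> \<bar>C\<bar> * cmod (f x)" for x
      using C[of x] by (intro mult_right_mono) auto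
    then show "AE x in lborel. cmod (pot a b x * f x) \<le> cmod (complex_of_real C * f x)"
      by (simp add: norm_mult)
  qed measurable
qed

lemmas tau_L2_rep = tau_L2[OF _ rep_in_L2]

lemma norm_L2_mono:
  assumes "f \<in> L2" "g \<in> L2" "\<And>x. cmod (f x) \<le> cmod (g x)"
  shows "norm_L2 f \<le> norm_L2 g"
  unfolding norm_L2_def
  by (intro real_sqrt_le_mono integral_mono L2_integrable assms power_mono norm_ge_zero)

lemma norm_tau_le:
  assumes "pot_bounded a b" "\<And>x. cmod (pot a b x) \<le> C"
  shows "norm (tau a b c) \<le> C * norm c"
proof -
  have C: "0 \<le> C" using assms(2)[of 0] norm_ge_zero order_trans by blast
  have "norm (tau a b c) \<le> norm_L2 (\<lambda>x. of_real C * rep_l2 c x)"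
    unfolding tau_def norm_abs[OF tau_L2_rep[OF assms(1)]]
    by (intro norm_L2_mono tau_L2_rep assms(1) L2_cmul rep_in_L2)
       (use assms(2) C in \<open>simp add: norm_mult mult_right_mono\<close>)
  also have "\<dots> = norm (cmul (of_real C) c)"
    by (simp add: norm_abs[OF L2_cmul[OF rep_in_L2], symmetric] abs_cmul)
  finally show ?thesis using C by (simp add: norm_cmul)
qed

lemma norm_tau_left: "w \<in> sobolev \<Longrightarrow> norm (tau (fst w) b c) \<le> 2 * norm (snd w) * norm b * norm c"
  by (rule norm_tau_le[OF pot_bounded_left pot_left(2)])
lemma norm_tau_right: "w \<in> sobolev \<Longrightarrow> norm (tau a (fst w) c) \<le> 2 * norm a * norm (snd w) * norm c"
  by (rule norm_tau_le[OF pot_bounded_right pot_right(2)])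

lemma tau_diff1: "pot_bounded a b \<Longrightarrow> pot_bounded a' b \<Longrightarrow> tau (a - a') b c = tau a b c - tau a' b c"
  unfolding tau_def
  by (subst abs_diff[symmetric]) (auto simp: tau_L2_rep pot_diff_left pot_bounded_def left_diff_distrib)
lemma tau_diff2: "pot_bounded a b \<Longrightarrow> pot_bounded a b' \<Longrightarrow> tau a (b - b') c = tau a b c - tau a b' c"
  unfolding tau_def
  by (subst abs_diff[symmetric]) (auto simp: tau_L2_rep pot_diff_right pot_bounded_def left_diff_distrib)
lemma tau_diff3: assumes "pot_bounded a b" shows "tau a b (c - c') = tau a b c - tau a b c'"
  unfolding tau_def abs_diff[OF tau_L2_rep tau_L2_rep, OF assms assms, symmetric] using rep_diff[of c c']
  by (intro abs_eqI tau_L2_rep L2_diff assms) (auto elim!: eventually_mono simp: right_diff_distrib)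
lemma tau_scaleR1: assumes "pot_bounded a b" shows "tau (r *\<^sub>R a) b c = r *\<^sub>R tau a b c"
  unfolding tau_def abs_scaleR[OF tau_L2_rep[OF assms], symmetric] by (simp add: pot_scaleR_left mult.assoc)
lemma tau_scaleR2: assumes "pot_bounded a b" shows "tau a (r *\<^sub>R b) c = r *\<^sub>R tau a b c"
  unfolding tau_def abs_scaleR[OF tau_L2_rep[OF assms], symmetric] by (simp add: pot_scaleR_right mult.assoc)
lemma tau_scaleR3: assumes "pot_bounded a b" shows "tau a b (r *\<^sub>R c) = r *\<^sub>R tau a b c"
  unfolding tau_def abs_scaleR[OF tau_L2_rep[OF assms], symmetric] using rep_scaleR[of r c]
  by (intro abs_eqI L2_cmul tau_L2_rep assms) (auto elim!: eventually_mono)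
lemma tau_transl: assumes "pot_bounded a b" shows "tau (transl v a) (transl v b) (transl v c) = transl v (tau a b c)"
  unfolding tau_def transl_abs[OF tau_L2_rep[OF assms]]
proof (rule abs_eqI)
  have *: "AE x in lborel. pot (transl v a) (transl v b) x * rep_l2 (transl v c) x = pot a b (x + v) * rep_l2 c (x + v)"
    using rep_transl[of v c] by (auto elim!: eventually_mono simp: pot_transl)
  show L: "(\<lambda>x. pot a b (x + v) * rep_l2 c (x + v)) \<in> L2"
    by (rule L2_translate[OF tau_L2_rep[OF assms]])
  show "(\<lambda>x. pot (transl v a) (transl v b) x * rep_l2 (transl v c) x) \<in> L2"
    by (rule L2_AE[OF _ L *]) measurable
  show "AE x in lborel. pot (transl v a) (transl v b) x * rep_l2 (transl v c) x = pot a b (x + v) * rep_l2 c (x + v)" by fact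
qed

text \<open>Change one slot at a time. Made for the first term of the discrete product rule: there
  the first slot is a difference quotient converging in L2 alone, while the second runs through
  translates converging together with their gradients.\<close>

lemma tendsto_tau_right:
  assumes a: "(a \<longlongrightarrow> a') F" and w: "(w \<longlongrightarrow> w') F" "\<And>h. w h \<in> sobolev" "w' \<in> sobolev" and c: "(c \<longlongrightarrow> c') F"
  shows "((\<lambda>h. tau (a h) (fst (w h)) (c h)) \<longlongrightarrow> tau a' (fst w') c') F"
proof (rule LIM_zero_cancel, rule Lim_null_comparison)
  show "\<forall>\<^sub>F h in F. norm (tau (a h) (fst (w h)) (c h) - tau a' (fst w') c')
      \<le> 2 * norm (a h - a') * norm (snd (w h)) * norm (c h) + 2 * norm a' * norm (snd (w h - w')) * norm (c h)
        + 2 * norm a' * norm (snd w') * norm (c h - c')"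
  proof (rule always_eventually, rule allI)
    fix h
    have "tau (a h) (fst (w h)) (c h) - tau a' (fst w') c' =
        tau (a h - a') (fst (w h)) (c h) + tau a' (fst (w h - w')) (c h) + tau a' (fst w') (c h - c')"
      using w by (simp add: tau_diff1 tau_diff2 tau_diff3 pot_bounded_right)
    also have "norm \<dots> \<le> norm (tau (a h - a') (fst (w h)) (c h)) + norm (tau a' (fst (w h - w')) (c h)) + norm (tau a' (fst w') (c h - c'))"
      by (intro norm_triangle_mono order_refl)
    also have "\<dots> \<le> 2 * norm (a h - a') * norm (snd (w h)) * norm (c h) + 2 * norm a' * norm (snd (w h - w')) * norm (c h)
        + 2 * norm a' * norm (snd w') * norm (c h - c')"
      using w by (intro add_mono norm_tau_right sobolev_diff) auto
    finally show "norm (tau (a h) (fst (w h)) (c h) - tau a' (fst w') c') \<le> \<dots>" .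
  qed
  have "((\<lambda>h. 2 * norm (a h - a') * norm (snd (w h)) * norm (c h) + 2 * norm a' * norm (snd (w h - w')) * norm (c h)
        + 2 * norm a' * norm (snd w') * norm (c h - c')) \<longlongrightarrow>
      2 * norm (a' - a') * norm (snd w') * norm c' + 2 * norm a' * norm (snd (w' - w')) * norm c'
        + 2 * norm a' * norm (snd w') * norm (c' - c')) F"
    by (intro tendsto_intros a w c)
  then show "((\<lambda>h. 2 * norm (a h - a') * norm (snd (w h)) * norm (c h) + 2 * norm a' * norm (snd (w h - w')) * norm (c h)
        + 2 * norm a' * norm (snd w') * norm (c h - c')) \<longlongrightarrow> 0) F" by simp
qed

text \<open>The companion for the other two terms of the product rule, whose first slot is fixed and
  carries the gradient bound.\<close>

lemma tendsto_tau_left: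
  assumes w: "w \<in> sobolev" and b: "(b \<longlongrightarrow> b') F" and c: "(c \<longlongrightarrow> c') F"
  shows "((\<lambda>h. tau (fst w) (b h) (c h)) \<longlongrightarrow> tau (fst w) b' c') F"
proof (rule LIM_zero_cancel, rule Lim_null_comparison)
  show "\<forall>\<^sub>F h in F. norm (tau (fst w) (b h) (c h) - tau (fst w) b' c')
      \<le> 2 * norm (snd w) * norm (b h - b') * norm (c h) + 2 * norm (snd w) * norm b' * norm (c h - c')"
  proof (rule always_eventually, rule allI)
    fix h
    have "tau (fst w) (b h) (c h) - tau (fst w) b' c' = tau (fst w) (b h - b') (c h) + tau (fst w) b' (c h - c')"
      using w by (simp add: tau_diff2 tau_diff3 pot_bounded_left)
    also have "norm \<dots> \<le> norm (tau (fst w) (b h - b') (c h)) + norm (tau (fst w) b' (c h - c'))"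
      by (rule norm_triangle_ineq)
    also have "\<dots> \<le> 2 * norm (snd w) * norm (b h - b') * norm (c h) + 2 * norm (snd w) * norm b' * norm (c h - c')"
      using w by (intro add_mono norm_tau_left)
    finally show "norm (tau (fst w) (b h) (c h) - tau (fst w) b' c') \<le> \<dots>" .
  qed
  have "((\<lambda>h. 2 * norm (snd w) * norm (b h - b') * norm (c h) + 2 * norm (snd w) * norm b' * norm (c h - c')) \<longlongrightarrow>
      2 * norm (snd w) * norm (b' - b') * norm c' + 2 * norm (snd w) * norm b' * norm (c' - c')) F"
    by (intro tendsto_intros b c)
  then show "((\<lambda>h. 2 * norm (snd w) * norm (b h - b') * norm (c h) + 2 * norm (snd w) * norm b' * norm (c h - c')) \<longlongrightarrow> 0) F" by simp
qed

text \<open>The second component is the gradient predicted by the product rule; a derivative of the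
  potential falls on its densities, never on the kernel.\<close>

definition Tri :: "l2 \<times> (l2^3) \<Rightarrow> l2 \<times> (l2^3) \<Rightarrow> l2 \<times> (l2^3) \<Rightarrow> l2 \<times> (l2^3)" where
  "Tri u v w = (tau (fst u) (fst v) (fst w),
     \<chi> j. tau (snd u $ j) (fst v) (fst w) + tau (fst u) (snd v $ j) (fst w) + tau (fst u) (fst v) (snd w $ j))"

text \<open>With D the difference quotient and T the translation, D tau(u,v,w) = tau(D u, T v, T w)
  + tau(u, D v, T w) + tau(u, v, D w). In each term some factor of the potential is in
  \<open>sobolev\<close>, so all three limits exist.\<close>

lemma Tri_sobolev: assumes sobolev: "u \<in> sobolev" "v \<in> sobolev" "w \<in> sobolev" shows "Tri u v w \<in> sobolev"
  unfolding sobolev_def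
proof (intro CollectI allI)
  fix j
  let ?transl = "\<lambda>h. transl (h *\<^sub>R axis j 1)"
  let ?Q = "\<lambda>h. tau (dq (axis j 1) h (fst u)) (fst (transl_pair (h *\<^sub>R axis j 1) v)) (?transl h (fst w))
      + tau (fst u) (dq (axis j 1) h (fst v)) (?transl h (fst w)) + tau (fst u) (fst v) (dq (axis j 1) h (fst w))"
  have "dq (axis j 1) h (tau (fst u) (fst v) (fst w)) = ?Q h" for h
  proof -
    note TX = transl_pair_sobolev[OF sobolev(1), of "h *\<^sub>R axis j 1"] transl_pair_sobolev[OF sobolev(2), of "h *\<^sub>R axis j 1"]
    note oks = pot_bounded_left[OF sobolev(1)] pot_bounded_right[OF sobolev(2)] pot_bounded_right[OF TX(2)] pot_bounded_left[OF TX(1)]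
    have ok1: "pot_bounded a (?transl h (fst v))" for a using oks(3)[of a] by simp
    show ?thesis
      by (simp add: dq_def tau_diff1 tau_diff2 tau_diff3 tau_scaleR1 tau_scaleR2 tau_scaleR3 tau_transl[symmetric] oks ok1
          flip: scaleR_add_right)
  qed
  moreover have "(?Q \<longlongrightarrow> tau (snd u $ j) (fst v) (fst w) + tau (fst u) (snd v $ j) (fst w) + tau (fst u) (fst v) (snd w $ j)) (at 0)"
    using sobolev by (intro tendsto_add tendsto_tau_right tendsto_tau_left tendsto_transl_pair transl_pair_sobolev tendsto_transl_0
        sobolev_gen[unfolded gen_def] tendsto_const)
  ultimately show "gen (axis j 1) (fst (Tri u v w)) (snd (Tri u v w) $ j)"
    by (simp add: gen_def Tri_def)
qed

lemma norm_W_le: "norm (a, v :: 'a::real_normed_vector ^ 3) \<le> norm a + (\<Sum>j\<in>UNIV. norm (v $ j))"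
  using norm_Pair_le[of a v] L2_set_le_sum[of UNIV "\<lambda>j. norm (v $ j)"] by (simp add: norm_vec_def)

lemma norm_fst_W: "norm (fst w) \<le> norm w" and norm_snd_W: "norm (snd w) \<le> norm w"
  and norm_snd_nth_W: "norm (snd w $ j) \<le> norm (w :: l2 \<times> (l2^3))"
  using norm_fst_le[of "fst w" "snd w"] norm_snd_le[of "snd w" "fst w"]
    Finite_Cartesian_Product.norm_nth_le[of "snd w" j] by auto

text \<open>Every value of \<open>tau\<close> costs the Hardy factor 2. The function gives one such
  term and each of the three partial derivatives gives three: 2 + 3 * (2 + 2 + 2) = 20.\<close>

lemma norm_Tri_le:
  assumes sobolev: "u \<in> sobolev" "v \<in> sobolev" "w \<in> sobolev"
  shows "norm (Tri u v w) \<le> 20 * norm u * norm v * norm w"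
proof -
  let ?C = "2 * norm u * norm v * norm w"
  have 1: "norm (tau (fst u) b c) \<le> ?C" if "norm b \<le> norm v" "norm c \<le> norm w" for b c
    by (rule order_trans[OF norm_tau_left[OF sobolev(1)]]) (intro mult_mono that norm_snd_W; simp)
  have 2: "norm (tau a (fst v) c) \<le> ?C" if "norm a \<le> norm u" "norm c \<le> norm w" for a c
    by (rule order_trans[OF norm_tau_right[OF sobolev(2)]]) (intro mult_mono that norm_snd_W; simp)
  have "norm (Tri u v w) \<le> norm (tau (fst u) (fst v) (fst w)) +
      (\<Sum>j\<in>UNIV. norm (tau (snd u $ j) (fst v) (fst w) + tau (fst u) (snd v $ j) (fst w) + tau (fst u) (fst v) (snd w $ j)))"
    unfolding Tri_def by (rule order_trans[OF norm_W_le]) simp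
  also have "\<dots> \<le> ?C + (\<Sum>j\<in>(UNIV::3 set). ?C + ?C + ?C)"
    by (intro add_mono sum_mono norm_triangle_mono 1 2 norm_fst_W norm_snd_nth_W)
  also have "\<dots> = 20 * norm u * norm v * norm w" by simp
  finally show ?thesis .
qed

lemma Tri_diff1: "u \<in> sobolev \<Longrightarrow> u' \<in> sobolev \<Longrightarrow> v \<in> sobolev \<Longrightarrow> w \<in> sobolev \<Longrightarrow> Tri (u - u') v w = Tri u v w - Tri u' v w"
  by (simp add: Tri_def prod_eq_iff vec_eq_iff tau_diff1 pot_bounded_left pot_bounded_right)
lemma Tri_diff2: "u \<in> sobolev \<Longrightarrow> v \<in> sobolev \<Longrightarrow> v' \<in> sobolev \<Longrightarrow> w \<in> sobolev \<Longrightarrow> Tri u (v - v') w = Tri u v w - Tri u v' w"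
  by (simp add: Tri_def prod_eq_iff vec_eq_iff tau_diff2 pot_bounded_left pot_bounded_right)
lemma Tri_diff3: "u \<in> sobolev \<Longrightarrow> v \<in> sobolev \<Longrightarrow> Tri u v (w - w') = Tri u v w - Tri u v w'"
  by (simp add: Tri_def prod_eq_iff vec_eq_iff tau_diff3 pot_bounded_left pot_bounded_right)

text \<open>Replacing one slot at a time leaves three terms, each bounded by 20 R^2 |u - v|.\<close>

lemma Tri_Lipschitz:
  assumes sobolev: "u \<in> sobolev" "v \<in> sobolev" and R: "norm u \<le> R" "norm v \<le> R"
  shows "norm (Tri u u u - Tri v v v) \<le> 60 * R\<^sup>2 * norm (u - v)"
proof -
  have R0: "0 \<le> R" using R(1) norm_ge_zero order_trans by blast
  let ?d = "20 * R\<^sup>2 * norm (u - v)"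
  have "Tri u u u - Tri v v v = Tri (u - v) u u + Tri v (u - v) u + Tri v v (u - v)"
    by (simp add: Tri_diff1 Tri_diff2 Tri_diff3 sobolev)
  also have "norm \<dots> \<le> norm (Tri (u - v) u u) + norm (Tri v (u - v) u) + norm (Tri v v (u - v))"
    by (intro norm_triangle_mono order_refl)
  also have "\<dots> \<le> ?d + ?d + ?d"
  proof (intro add_mono)
    have d: "norm (u - v) * (a * b) \<le> norm (u - v) * (R * R)" if "0 \<le> a" "0 \<le> b" "a \<le> R" "b \<le> R" for a b
      using that R0 by (intro mult_left_mono mult_mono) auto
    show "norm (Tri (u - v) u u) \<le> ?d"
      using norm_Tri_le[OF sobolev_diff[OF sobolev] sobolev(1) sobolev(1)] d[of "norm u" "norm u"] R
      by (simp add: power2_eq_square mult_ac)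
    show "norm (Tri v (u - v) u) \<le> ?d"
      using norm_Tri_le[OF sobolev(2) sobolev_diff[OF sobolev] sobolev(1)] d[of "norm v" "norm u"] R
      by (simp add: power2_eq_square mult_ac)
    show "norm (Tri v v (u - v)) \<le> ?d"
      using norm_Tri_le[OF sobolev(2) sobolev(2) sobolev_diff[OF sobolev]] d[of "norm v" "norm v"] R
      by (simp add: power2_eq_square mult_ac)
  qed
  finally show ?thesis by (simp add: mult_ac)
qed

text \<open>Dividing the equation by \<open>\<i>\<close> leaves the free part plus c (g1 - g2), with
  c the coefficient of both terms. Since \<open>g2\<close> is a scalar multiple of the state, its
  gradient component is that same multiple of the gradient.\<close>

definition nonlin :: "real \<Rightarrow> l2 \<times> (l2^3) \<Rightarrow> l2 \<times> (l2^3)" where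
  "nonlin c w = c *\<^sub>R (Tri w w w - inner (fst (Tri w w w)) (fst w) *\<^sub>R w)"

lemma nonlin_sobolev: "w \<in> sobolev \<Longrightarrow> nonlin c w \<in> sobolev"
  unfolding nonlin_def by (intro sobolev_scaleR sobolev_diff Tri_sobolev)

lemma nonlin_0: "nonlin c 0 = 0"
  using norm_Tri_le[OF sobolev_0 sobolev_0 sobolev_0] by (simp add: nonlin_def)

text \<open>The scalar in \<open>g2\<close> is at most 20 R^4 and has Lipschitz constant 60 R^3 + 20
  R^3. Multiplied by the state it contributes 20 R^4 + 80 R^4, and \<open>Tri\<close> itself
  contributes 60 R^2.\<close>

lemma nonlin_Lipschitz:
  assumes sobolev: "u \<in> sobolev" "v \<in> sobolev" and R: "norm u \<le> R" "norm v \<le> R" and "0 \<le> c"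
  shows "norm (nonlin c u - nonlin c v) \<le> c * (60 * R ^ 2 + 100 * R ^ 4) * norm (u - v)"
proof -
  have R0: "0 \<le> R" using R(1) norm_ge_zero order_trans by blast
  define n where "n w = inner (fst (Tri w w w)) (fst w)" for w
  have Tb: "norm (Tri w w w) \<le> 20 * R ^ 3" if "w \<in> sobolev" "norm w \<le> R" for w
  proof -
    have "norm (Tri w w w) \<le> 20 * (norm w) ^ 3"
      using norm_Tri_le[OF that(1) that(1) that(1)] by (simp add: power3_eq_cube mult_ac)
    then show ?thesis using power_mono[OF that(2), of 3] by simp
  qed
  have Tl: "norm (Tri u u u - Tri v v v) \<le> 60 * R\<^sup>2 * norm (u - v)"
    by (rule Tri_Lipschitz[OF sobolev R])
  have nb: "\<bar>n u\<bar> \<le> 20 * R ^ 4"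
  proof -
    have "\<bar>n u\<bar> \<le> norm (fst (Tri u u u)) * norm (fst u)" unfolding n_def by (rule Cauchy_Schwarz_ineq2)
    also have "\<dots> \<le> (20 * R ^ 3) * R"
      using R0 by (intro mult_mono order_trans[OF norm_fst_W Tb] order_trans[OF norm_fst_W R(1)] sobolev R) auto
    finally show ?thesis by (simp add: power3_eq_cube power4_eq_xxxx mult_ac)
  qed
  have nl: "\<bar>n u - n v\<bar> \<le> 80 * R ^ 3 * norm (u - v)"
  proof -
    have "n u - n v = inner (fst (Tri u u u - Tri v v v)) (fst u) + inner (fst (Tri v v v)) (fst (u - v))"
      by (simp add: n_def inner_diff_left inner_diff_right)
    also have "\<bar>\<dots>\<bar> \<le> norm (fst (Tri u u u - Tri v v v)) * norm (fst u) + norm (fst (Tri v v v)) * norm (fst (u - v))"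
      by (intro order_trans[OF abs_triangle_ineq] add_mono Cauchy_Schwarz_ineq2)
    also have "\<dots> \<le> (60 * R\<^sup>2 * norm (u - v)) * R + (20 * R ^ 3) * norm (u - v)"
      using R0 by (intro add_mono mult_mono order_trans[OF norm_fst_W Tl] order_trans[OF norm_fst_W R(1)]
          order_trans[OF norm_fst_W Tb] norm_fst_W sobolev R) auto
    finally show ?thesis by (simp add: power2_eq_square power3_eq_cube algebra_simps)
  qed
  have "nonlin c u - nonlin c v = c *\<^sub>R ((Tri u u u - Tri v v v) - (n u *\<^sub>R (u - v) + (n u - n v) *\<^sub>R v))"
    by (simp add: nonlin_def n_def algebra_simps)
  also have "norm \<dots> \<le> c * (norm (Tri u u u - Tri v v v) + (\<bar>n u\<bar> * norm (u - v) + \<bar>n u - n v\<bar> * norm v))"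
    using \<open>0 \<le> c\<close> norm_triangle_ineq4[of "Tri u u u - Tri v v v" "n u *\<^sub>R (u - v) + (n u - n v) *\<^sub>R v"]
      norm_triangle_ineq[of "n u *\<^sub>R (u - v)" "(n u - n v) *\<^sub>R v"]
    by (auto intro!: mult_left_mono)
  also have "\<dots> \<le> c * (60 * R\<^sup>2 * norm (u - v) + ((20 * R ^ 4) * norm (u - v) + (80 * R ^ 3 * norm (u - v)) * R))"
    using \<open>0 \<le> c\<close> R0 by (intro mult_left_mono add_mono mult_mono Tl nb nl R) auto
  also have "\<dots> = c * (60 * R ^ 2 + 100 * R ^ 4) * norm (u - v)"
    by (simp add: power3_eq_cube power4_eq_xxxx algebra_simps)
  finally show ?thesis .
qed

lemma g1_tau:
  assumes w: "w \<in> sobolev"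
  shows "g1 (rep_l2 (fst w)) \<in> L2" "abs_l2 (g1 (rep_l2 (fst w))) = tau (fst w) (fst w) (fst w)"
proof -
  let ?u = "rep_l2 (fst w)"
  have "?u y * cnj (?u y) / of_real (norm (x - y)) = of_real ((cmod (?u y))\<^sup>2 / norm (x - y))" for x y
    by (simp only: of_real_divide complex_norm_square)
  then have "pot (fst w) (fst w) x = of_real (LINT y|lborel. (cmod (?u y))\<^sup>2 / norm (x - y))" for x
    unfolding pot_def by (simp only: integral_complex_of_real)
  then have "g1 ?u = (\<lambda>x. pot (fst w) (fst w) x * ?u x)"
    by (simp add: g1_def fun_eq_iff)
  then show "g1 ?u \<in> L2" "abs_l2 (g1 ?u) = tau (fst w) (fst w) (fst w)"
    by (simp_all add: tau_L2_rep[OF pot_bounded_left[OF w]] tau_def)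
qed

text \<open>The inner integral, multiplied by |psi(z)|^2, is \<open>g1\<close> at z times the
  conjugate of psi(z). The double integral is therefore the inner product of \<open>g1\<close> with
  the state.\<close>

lemma g2_tau:
  assumes w: "w \<in> sobolev"
  shows "g2 (rep_l2 (fst w)) \<in> L2"
    "abs_l2 (g2 (rep_l2 (fst w))) = inner (tau (fst w) (fst w) (fst w)) (fst w) *\<^sub>R fst w"
proof -
  let ?u = "rep_l2 (fst w)"
  let ?n = "LINT z|lborel. (LINT y|lborel. (cmod (?u y))\<^sup>2 * (cmod (?u z))\<^sup>2 / norm (z - y))"
  have "inner (tau (fst w) (fst w) (fst w)) (abs_l2 ?u) = Re (LINT z|lborel. g1 ?u z * cnj (?u z))"
    unfolding g1_tau(2)[OF w, symmetric] by (rule inner_l2.abs_eq) (auto simp: g1_tau(1)[OF w])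
  also have "(LINT z|lborel. g1 ?u z * cnj (?u z)) = (LINT z|lborel. of_real (LINT y|lborel. (cmod (?u y))\<^sup>2 * (cmod (?u z))\<^sup>2 / norm (z - y)))"
  proof (rule Bochner_Integration.integral_cong[OF refl])
    fix z
    have "g1 ?u z * cnj (?u z) = of_real ((LINT y|lborel. (cmod (?u y))\<^sup>2 / norm (z - y)) * (cmod (?u z))\<^sup>2)"
      unfolding g1_def of_real_mult complex_norm_square by (simp only: mult_ac)
    also have "(LINT y|lborel. (cmod (?u y))\<^sup>2 / norm (z - y)) * (cmod (?u z))\<^sup>2 =
        (LINT y|lborel. (cmod (?u y))\<^sup>2 * (cmod (?u z))\<^sup>2 / norm (z - y))"
      by (subst integral_mult_left_zero[symmetric]) simp
    finally show "g1 ?u z * cnj (?u z) = of_real (LINT y|lborel. (cmod (?u y))\<^sup>2 * (cmod (?u z))\<^sup>2 / norm (z - y))" .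
  qed
  also have "\<dots> = of_real ?n" by (rule integral_complex_of_real)
  finally have n: "inner (tau (fst w) (fst w) (fst w)) (fst w) = ?n" by simp
  have "g2 ?u = (\<lambda>x. of_real ?n * ?u x)" by (simp add: g2_def fun_eq_iff)
  then show "g2 ?u \<in> L2" "abs_l2 (g2 ?u) = inner (tau (fst w) (fst w) (fst w)) (fst w) *\<^sub>R fst w"
    using abs_scaleR[OF rep_in_L2, of ?n "fst w"] by (simp_all add: n L2_cmul)
qed

section \<open>Local solutions of ordinary differential equations\<close>

text \<open>Riemann sums are linear combinations of values, hence in \<open>V\<close>, and they
  approximate the integral.\<close>

lemma integral_in_closed_subspace:
  fixes f :: "real \<Rightarrow> 'a::banach"
  assumes "closed V" "subspace V" "f integrable_on {a..b}" "\<And>t. f t \<in> V"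
  shows "integral {a..b} f \<in> V"
proof -
  have "integral {a..b} f \<in> closure V"
    unfolding closure_approachable
  proof (intro allI impI)
    fix e :: real assume "0 < e"
    have "(f has_integral integral {a..b} f) (cbox a b)"
      using assms(3) by (simp add: integrable_integral)
    then obtain \<gamma> where \<gamma>: "gauge \<gamma>"
      "\<And>\<D>. \<D> tagged_division_of (cbox a b) \<Longrightarrow> \<gamma> fine \<D> \<Longrightarrow>
          norm ((\<Sum>(x,k) \<in> \<D>. measure lborel k *\<^sub>R f x) - integral {a..b} f) < e"
      using has_integralD[OF _ \<open>0 < e\<close>] by metis
    obtain \<D> where \<D>: "\<D> tagged_division_of (cbox a b)" "\<gamma> fine \<D>"
      using fine_division_exists[OF \<gamma>(1)] by blast
    have "(\<Sum>(x,k) \<in> \<D>. measure lborel k *\<^sub>R f x) \<in> V"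
      using assms(2,4) by (intro subspace_sum) (auto intro: subspace_scale)
    then show "\<exists>y\<in>V. dist y (integral {a..b} f) < e"
      using \<gamma>(2)[OF \<D>] by (auto simp: dist_norm)
  qed
  then show ?thesis using assms(1) by simp
qed

text \<open>The estimates hold only on the subspace \<open>V\<close>, so the fixed point is sought
  among \<open>V\<close>-valued curves. Continuity of the field is assumed along continuous curves,
  which is what a strongly continuous group delivers. The condition on \<open>T * L\<close> makes
  the integral map a contraction with factor 1/2, and the bound on \<open>K\<close> keeps it inside
  the ball of radius \<open>R\<close>.\<close>

theorem picard_closed_subspace:
  fixes f :: "real \<Rightarrow> 'a::banach \<Rightarrow> 'a" and T :: real
  assumes V: "closed V" "subspace V"
    and fX: "\<And>t x. x \<in> V \<Longrightarrow> f t x \<in> V"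
    and cont: "\<And>z. continuous_on UNIV z \<Longrightarrow> (\<And>t. z t \<in> V) \<Longrightarrow> continuous_on UNIV (\<lambda>t. f t (z t))"
    and lip: "\<And>t x y. x \<in> V \<Longrightarrow> y \<in> V \<Longrightarrow> norm x \<le> R \<Longrightarrow> norm y \<le> R \<Longrightarrow> norm (f t x - f t y) \<le> L * norm (x - y)"
    and bound: "\<And>t x. x \<in> V \<Longrightarrow> norm x \<le> R \<Longrightarrow> norm (f t x) \<le> K"
    and \<phi>: "\<phi> \<in> V" "norm \<phi> + T * K \<le> R" and T: "T > 0" "T * L \<le> 1 / 2" "0 \<le> L" and K0: "0 \<le> K"
  obtains z where "continuous_on UNIV z" "\<And>t. z t \<in> V" "z 0 = \<phi>"
    "\<And>t. t \<in> {-T<..<T} \<Longrightarrow> (z has_vector_derivative f t (z t)) (at t)"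
proof -
  \<comment> \<open>Clamping time to the interval makes all curves bounded and continuous on the
    whole line, so that the complete space of such curves can be used.\<close>
  define c where "c t = max (- T) (min T t)" for t
  have c: "c t \<in> {-T..T}" for t using T by (auto simp: c_def)
  have cc: "continuous_on UNIV c" unfolding c_def by (intro continuous_intros)
  \<comment> \<open>The primitive starts at the left end; subtracting its value at 0 gives the
    integral from 0 in both time directions.\<close>
  define J where "J z s = integral {-T..s} (\<lambda>r. f r (z r))" for z s
  define Y where "Y = {z :: real \<Rightarrow>\<^sub>C 'a. \<forall>t. apply_bcontfun z t \<in> V \<inter> cball 0 R}"
  define P where "P z t = \<phi> + (J z (c t) - J z 0)" for z t
  have contz: "continuous_on UNIV (\<lambda>r. f r (apply_bcontfun z r))" if "z \<in> Y" for z
    using that by (intro cont) (auto simp: Y_def)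
  have J': "(J z has_vector_derivative f s (z s)) (at s within {-T..T})" if "z \<in> Y" "s \<in> {-T..T}" for z s
    unfolding J_def using contz[OF that(1)] that(2)
    by (intro integral_has_vector_derivative) (auto intro: continuous_on_subset)
  have Jcont: "continuous_on {-T..T} (J z)" if "z \<in> Y" for z
    unfolding continuous_on_eq_continuous_within
    using has_vector_derivative_continuous[OF J'[OF that]] by blast
  have JX: "J z s \<in> V" if "z \<in> Y" for z s
    unfolding J_def
  proof (rule integral_in_closed_subspace[OF V])
    show "(\<lambda>r. f r (apply_bcontfun z r)) integrable_on {-T..s}"
      by (rule integrable_continuous_real) (rule continuous_on_subset[OF contz[OF that]], simp)
    show "f t (apply_bcontfun z t) \<in> V" for t using that by (auto simp: Y_def intro: fX)
  qed
  have PX: "P z t \<in> V" if "z \<in> Y" for z t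
    unfolding P_def using JX[OF that] V(2) \<phi>(1) by (intro subspace_add subspace_diff) auto
  have PR: "norm (P z t) \<le> R" if "z \<in> Y" for z t
  proof -
    have "norm (J z (c t) - J z 0) \<le> K * \<bar>c t - 0\<bar>"
      by (rule has_vector_derivative_bound[OF convex_real_interval(5) J'[OF that]])
         (use that c T in \<open>auto simp: Y_def intro: bound\<close>)
    also have "\<dots> \<le> K * T" using c[of t] K0 by (intro mult_left_mono) auto
    finally have "norm (P z t) \<le> norm \<phi> + K * T"
      unfolding P_def by (rule norm_triangle_mono[OF order_refl])
    then show ?thesis using \<phi>(2) by (simp add: mult.commute)
  qed
  have Pcont: "continuous_on UNIV (P z)" if "z \<in> Y" for z
    unfolding P_def using c
    by (intro continuous_intros continuous_on_compose2[OF Jcont[OF that] cc]) auto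
  define Q where "Q z = Bcontfun (P (apply_bcontfun z))" for z
  have Q: "apply_bcontfun (Q z) = P (apply_bcontfun z)" if "z \<in> Y" for z
    unfolding Q_def by (rule Bcontfun_inverse) (rule bcontfun_normI[OF Pcont[OF that] PR[OF that]])
  have "\<exists>!z\<in>Y. Q z = z"
  proof (rule Banach_fix[where c="1/2"])
    have "Y = PiC UNIV (\<lambda>_. V \<inter> cball 0 R)"
      by (auto simp: Y_def mem_PiC_iff Pi_iff)
    then have "closed Y" using V(1) by (simp add: closed_PiC closed_Int)
    then show "complete Y" by (simp add: complete_eq_closed)
    have "norm \<phi> \<le> R" using \<phi>(2) T(1) K0 by (smt (verit) mult_nonneg_nonneg)
    then have "const_bcontfun \<phi> \<in> Y" using \<phi>(1) by (simp add: Y_def const_bcontfun.rep_eq)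
    then show "Y \<noteq> {}" by blast
    show "Q ` Y \<subseteq> Y" 
    proof (rule image_subsetI)
      fix z assume "z \<in> Y"
      then show "Q z \<in> Y" using PX[of z] PR[of z] by (subst Y_def) (simp add: Q)
    qed
    fix z y assume zy: "z \<in> Y" "y \<in> Y"
    show "dist (Q z) (Q y) \<le> 1/2 * dist z y"
    proof (rule dist_bound)
      fix t
      have "norm ((J z (c t) - J y (c t)) - (J z 0 - J y 0)) \<le> (L * dist z y) * \<bar>c t - 0\<bar>"
      proof (rule has_vector_derivative_bound[OF convex_real_interval(5), where f="\<lambda>s. J z s - J y s"])
        show "((\<lambda>s. J z s - J y s) has_vector_derivative f s (z s) - f s (y s)) (at s within {-T..T})" if "s \<in> {-T..T}" for s
          by (intro has_vector_derivative_diff J' zy that)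
        show "norm (f s (z s) - f s (y s)) \<le> L * dist z y" for s
        proof -
          have "norm (f s (z s) - f s (y s)) \<le> L * norm (z s - y s)"
            using zy by (intro lip) (auto simp: Y_def)
          also have "\<dots> \<le> L * dist z y"
            using dist_bounded[of z s y] T(3) by (intro mult_left_mono) (auto simp: dist_norm)
          finally show ?thesis .
        qed
      qed (use c T in auto)
      also have "\<dots> \<le> (L * dist z y) * T"
        using c[of t] T(3) by (intro mult_left_mono) auto
      also have "\<dots> = (T * L) * dist z y" by simp
      also have "\<dots> \<le> 1/2 * dist z y" by (intro mult_right_mono T) simp
      finally show "dist (apply_bcontfun (Q z) t) (apply_bcontfun (Q y) t) \<le> 1/2 * dist z y"
        by (simp add: Q zy P_def dist_norm algebra_simps)
    qed
  qed auto
  then obtain z where z: "z \<in> Y" "Q z = z" by blast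
  then have eq: "apply_bcontfun z t = P z t" for t using Q[OF z(1)] by simp
  show thesis
  proof (rule that[of z])
    show "continuous_on UNIV z" by simp
    show "z t \<in> V" for t using z(1) by (simp add: Y_def)
    have "c 0 = 0" using T by (simp add: c_def)
    then show "z 0 = \<phi>" by (subst eq) (simp add: P_def)
    fix t assume t: "t \<in> {-T<..<T}"
    have "(J z has_vector_derivative f t (z t)) (at t within {-T<..<T})"
      using t by (intro has_vector_derivative_within_subset[OF J'[OF z(1)]]) auto
    then have "(J z has_vector_derivative f t (z t)) (at t)"
      using t by (simp only: at_within_open[OF t open_greaterThanLessThan])
    then have "((\<lambda>s. (\<phi> - J z 0) + J z s) has_vector_derivative 0 + f t (z t)) (at t)"
      by (intro has_vector_derivative_add has_vector_derivative_const)
    then have "((\<lambda>s. (\<phi> - J z 0) + J z s) has_vector_derivative f t (z t)) (at t)" by simp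
    then show "(apply_bcontfun z has_vector_derivative f t (z t)) (at t)"
    proof (rule has_vector_derivative_transform_within_open[OF _ open_greaterThanLessThan t])
      fix s assume "s \<in> {-T<..<T}"
      then have "c s = s" by (auto simp: c_def)
      then show "(\<phi> - J z 0) + J z s = z s" using eq[of s] by (simp add: P_def)
    qed
  qed
qed

section \<open>Sobolev functions and the dual space\<close>

text \<open>The bridge between the given definition and the Hilbert space side, by
  \<open>gen_iff_weak\<close> in each coordinate direction.\<close>

lemma has_weak_gradient_iff_gen:
  "has_weak_gradient f g \<longleftrightarrow> f \<in> L2 \<and> (\<forall>j. (\<lambda>x. g x $ j) \<in> L2) \<and>
     (\<forall>j. gen (axis j 1) (abs_l2 f) (abs_l2 (\<lambda>x. g x $ j)))"
proof -
  have "(LINT x|lborel. f x * frechet_derivative \<eta> (at x) (axis j 1)) = pair (abs_l2 f) (abs_l2 (\<lambda>x. frechet_derivative \<eta> (at x) (axis j 1)))"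
    "(LINT x|lborel. g x $ j * \<eta> x) = pair (abs_l2 (\<lambda>x. g x $ j)) (abs_l2 \<eta>)"
    if "f \<in> L2" "\<forall>j. (\<lambda>x. g x $ j) \<in> L2" "\<eta> \<in> test_functions UNIV" for \<eta> j
    using that by (simp_all add: pair_abs test_L2 test_partial)
  then show ?thesis unfolding has_weak_gradient_def gen_iff_weak by (auto simp: Ball_def)
qed

definition emb :: "(real^3 \<Rightarrow> complex) \<Rightarrow> l2 \<times> (l2^3)" where
  "emb v = (abs_l2 v, \<chi> j. abs_l2 (\<lambda>x. weak_gradient v x $ j))"

lemma weak_gradient: "v \<in> W12 \<Longrightarrow> has_weak_gradient v (weak_gradient v)"
  unfolding W12_def weak_gradient_def using someI_ex[of "has_weak_gradient v"] by blast

lemma W12_L2: "v \<in> W12 \<Longrightarrow> v \<in> L2"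
  and weak_gradient_L2: "v \<in> W12 \<Longrightarrow> (\<lambda>x. weak_gradient v x $ j) \<in> L2"
  and emb_sobolev: "v \<in> W12 \<Longrightarrow> emb v \<in> sobolev"
  using weak_gradient[of v] by (simp_all add: has_weak_gradient_iff_gen emb_def sobolev_def)

lemma norm_W12_emb: assumes "v \<in> W12" shows "norm_W12 v = norm (emb v)"
proof -
  have "(LINT x|lborel. (norm (weak_gradient v x))\<^sup>2) = (LINT x|lborel. (\<Sum>j\<in>UNIV. (cmod (weak_gradient v x $ j))\<^sup>2))"
    by (simp add: norm_vec_def L2_set_def sum_nonneg)
  also have "\<dots> = (\<Sum>j\<in>UNIV. (norm (snd (emb v) $ j))\<^sup>2)"
    by (simp add: Bochner_Integration.integral_sum L2_integrable weak_gradient_L2 assms emb_def norm_abs norm_L2_sq)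
  also have "\<dots> = (norm (snd (emb v)))\<^sup>2"
    by (simp add: norm_vec_def L2_set_def sum_nonneg)
  moreover have "(LINT x|lborel. (cmod (v x))\<^sup>2) = (norm (fst (emb v)))\<^sup>2"
    by (simp add: emb_def norm_abs W12_L2 assms norm_L2_sq)
  ultimately show ?thesis unfolding norm_W12_def by (simp add: norm_prod_def add.commute)
qed

text \<open>Uniqueness of generators forces the chosen \<open>weak_gradient\<close> to agree with
  the gradient component of \<open>w\<close>, whatever choice was made.\<close>

lemma W12_I:
  assumes v: "v \<in> L2" and w: "w \<in> sobolev" "abs_l2 v = fst w"
  shows "v \<in> W12" "emb v = w"
proof -
  have "has_weak_gradient v (\<lambda>x. \<chi> j. rep_l2 (snd w $ j) x)"
    unfolding has_weak_gradient_iff_gen using v w by (simp add: sobolev_def)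
  then show v': "v \<in> W12" unfolding W12_def by blast
  have "snd (emb v) $ j = snd w $ j" for j
    using sobolev_gen[OF emb_sobolev[OF v'], of j] sobolev_gen[OF w(1), of j] w(2)
    by (intro gen_unique[of "axis j 1" "fst w"]) (simp_all add: emb_def)
  then show "emb v = w" using w(2) by (auto simp: prod_eq_iff vec_eq_iff emb_def)
qed

lemma W12_rep: assumes "w \<in> sobolev" shows "rep_l2 (fst w) \<in> W12" "emb (rep_l2 (fst w)) = w"
  using W12_I[OF rep_in_L2 assms] by simp_all

lemma fst_emb: "fst (emb v) = abs_l2 v"
  by (simp add: emb_def)

lemma W12_add: assumes "u \<in> W12" "v \<in> W12" shows "(\<lambda>x. u x + v x) \<in> W12" "emb (\<lambda>x. u x + v x) = emb u + emb v"
  using W12_I[OF L2_add[OF W12_L2 W12_L2, OF assms] sobolev_add[OF emb_sobolev emb_sobolev, OF assms]]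
  by (simp_all add: fst_emb abs_add W12_L2 assms)

lemma W12_diff: assumes "u \<in> W12" "v \<in> W12" shows "(\<lambda>x. u x - v x) \<in> W12" "emb (\<lambda>x. u x - v x) = emb u - emb v"
  using W12_I[OF L2_diff[OF W12_L2 W12_L2, OF assms] sobolev_diff[OF emb_sobolev emb_sobolev, OF assms]]
  by (simp_all add: fst_emb abs_diff W12_L2 assms)

lemma W12_cmul: assumes "u \<in> W12"
  shows "(\<lambda>x. c * u x) \<in> W12" "emb (\<lambda>x. c * u x) = (cmul c (fst (emb u)), \<chi> j. cmul c (snd (emb u) $ j))"
proof -
  have "(cmul c (fst (emb u)), \<chi> j. cmul c (snd (emb u) $ j)) \<in> sobolev"
    using emb_sobolev[OF assms] by (simp add: sobolev_def gen_cmul)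
  from W12_I[OF L2_cmul[OF W12_L2[OF assms]] this]
  show "(\<lambda>x. c * u x) \<in> W12" "emb (\<lambda>x. c * u x) = (cmul c (fst (emb u)), \<chi> j. cmul c (snd (emb u) $ j))"
    by (simp_all add: fst_emb abs_cmul W12_L2 assms)
qed

lemma W12_zero: "(\<lambda>_. 0) \<in> W12" "emb (\<lambda>_. 0) = 0"
  using W12_I[OF L2_zero sobolev_0] by (simp_all add: abs_zero)

text \<open>Every functional that occurs is of this form: a function acts through the first
  component, the Laplacian through the gradient components. The curves of functionals can thus be
  handled as curves of pairs in a Banach space.\<close>

definition dpair :: "l2 \<times> (l2^3) \<Rightarrow> l2 \<times> (l2^3) \<Rightarrow> complex" where
  "dpair w u = pair (fst w) (fst u) + (\<Sum>j\<in>UNIV. pair (snd w $ j) (snd u $ j))"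

lemma norm_dpair_le: "cmod (dpair w u) \<le> 4 * norm w * norm u"
proof -
  have "cmod (dpair w u) \<le> cmod (pair (fst w) (fst u)) + (\<Sum>j\<in>UNIV. cmod (pair (snd w $ j) (snd u $ j)))"
    unfolding dpair_def by (intro norm_triangle_mono order_refl norm_sum)
  also have "\<dots> \<le> norm w * norm u + (\<Sum>j\<in>(UNIV::3 set). norm w * norm u)"
    by (intro add_mono sum_mono order_trans[OF norm_pair_le] mult_mono norm_fst_W norm_snd_nth_W norm_ge_zero)
  finally show ?thesis by (simp add: mult_ac)
qed

lemma bounded_bilinear_dpair: "bounded_bilinear dpair"
proof
  fix w w' u u' :: "l2 \<times> (l2^3)" and r :: real
  show "dpair (w + w') u = dpair w u + dpair w' u"
    by (simp add: dpair_def pair.add_left sum.distrib)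
  show "dpair w (u + u') = dpair w u + dpair w u'"
    by (simp add: dpair_def pair.add_right sum.distrib)
  show "dpair (r *\<^sub>R w) u = r *\<^sub>R dpair w u"
    by (simp add: dpair_def pair.scaleR_left scaleR_add_right scaleR_sum_right)
  show "dpair w (r *\<^sub>R u) = r *\<^sub>R dpair w u"
    by (simp add: dpair_def pair.scaleR_right scaleR_add_right scaleR_sum_right)
  show "\<exists>K. \<forall>w u. norm (dpair w u) \<le> norm w * norm u * K"
    by (rule exI[of _ 4]) (use norm_dpair_le in \<open>simp add: mult_ac\<close>)
qed

interpretation dpair: bounded_bilinear dpair by (rule bounded_bilinear_dpair)

lemma W12_dual_I:
  assumes F: "\<And>v. v \<in> W12 \<Longrightarrow> F v = dpair w (emb v)" shows "F \<in> W12_dual"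
proof -
  have "cmod (F u) \<le> (4 * norm w) * norm_W12 u" if "u \<in> W12" for u
    using norm_dpair_le[of w "emb u"] by (simp add: F that norm_W12_emb)
  moreover have "F (\<lambda>x. c * u x) = c * F u" if "u \<in> W12" for c u
    by (simp add: F W12_cmul that dpair_def pair_cmul_right distrib_left sum_distrib_left)
  moreover have "F (\<lambda>x. u x + v x) = F u + F v" if "u \<in> W12" "v \<in> W12" for u v
    by (simp add: F W12_add that dpair.add_right)
  ultimately show ?thesis unfolding W12_dual_def by blast
qed

text \<open>Both bounds come from the same fact: the supremum runs over a nonempty set that is
  bounded above. Together they control the absolute value, as convergence to zero demands.\<close>

lemma norm_W12_dual_le:
  assumes C: "\<And>v. v \<in> W12 \<Longrightarrow> cmod (G v) \<le> C * norm_W12 v" and "0 \<le> C"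
  shows "0 \<le> norm_W12_dual G" "norm_W12_dual G \<le> C"
proof -
  let ?B = "{v \<in> W12. norm_W12 v \<le> 1}"
  have 0: "(\<lambda>_. 0) \<in> ?B" using W12_zero norm_W12_emb[OF W12_zero(1)] by simp
  have le: "cmod (G v) \<le> C" if "v \<in> ?B" for v
    using C[of v] that mult_left_mono[of "norm_W12 v" 1 C] \<open>0 \<le> C\<close> by auto
  show "norm_W12_dual G \<le> C"
    unfolding norm_W12_dual_def using 0 le by (intro cSUP_least) blast+
  have "cmod (G (\<lambda>_. 0)) \<le> norm_W12_dual G"
    unfolding norm_W12_dual_def by (rule cSUP_upper[OF 0], rule bdd_aboveI2[where M=C], rule le)
  then show "0 \<le> norm_W12_dual G" using norm_ge_zero order_trans by blast
qed

lemma norm_W12_dual_dpair: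
  assumes F: "\<And>v. v \<in> W12 \<Longrightarrow> G v = dpair w (emb v)"
  shows "0 \<le> norm_W12_dual G" "norm_W12_dual G \<le> 4 * norm w"
  by (rule norm_W12_dual_le[where C="4 * norm w"]; simp add: F norm_W12_emb norm_dpair_le)+

section \<open>Step functions on a uniform grid and Bochner integrals\<close>

definition grid :: "real \<Rightarrow> nat \<Rightarrow> real \<Rightarrow> real" where
  "grid \<tau> n t = \<tau> * of_int \<lfloor>real (Suc n) * t / \<tau>\<rfloor> / real (Suc n)"

lemma grid_near: assumes "\<tau> > 0" shows "grid \<tau> n t \<le> t" "t - grid \<tau> n t \<le> \<tau> / real (Suc n)"
proof -
  define N where "N = real (Suc n)"
  define k where "k = real_of_int \<lfloor>N * t / \<tau>\<rfloor>"
  have N: "N > 0" by (simp add: N_def)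
  have "k \<le> N * t / \<tau>" "N * t / \<tau> < k + 1"
    unfolding k_def by linarith+
  then have k: "\<tau> * k \<le> t * N" "t * N < \<tau> * k + \<tau>"
    using assms by (simp_all add: field_simps)
  have g: "grid \<tau> n t = \<tau> * k / N" by (simp add: grid_def k_def N_def)
  show "grid \<tau> n t \<le> t" using k(1) N by (simp add: g pos_divide_le_eq)
  have "t \<le> (\<tau> * k + \<tau>) / N" using k(2) N by (simp add: pos_le_divide_eq)
  then show "t - grid \<tau> n t \<le> \<tau> / real (Suc n)"
    unfolding g N_def[symmetric] by (simp add: add_divide_distrib)
qed

lemma floor_range:
  assumes "\<tau> > 0" "t \<in> {-\<tau>..\<tau>}"
  shows "\<lfloor>real (Suc n) * t / \<tau>\<rfloor> \<in> {- int (Suc n)..int (Suc n)}"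
proof -
  define N where "N = real (Suc n)"
  have N: "N > 0" by (simp add: N_def)
  have "- N * \<tau> \<le> N * t" "N * t \<le> N * \<tau>"
    using assms(2) N mult_left_mono[of "- \<tau>" t N] by simp_all
  then have le: "- N \<le> N * t / \<tau>" "N * t / \<tau> \<le> N"
    using assms(1) by (simp_all add: pos_le_divide_eq pos_divide_le_eq)
  have "- int (Suc n) \<le> \<lfloor>N * t / \<tau>\<rfloor>"
    using le(1) by (subst le_floor_iff) (simp add: N_def)
  moreover have "\<lfloor>N * t / \<tau>\<rfloor> \<le> int (Suc n)"
    using floor_mono[OF le(2)] by (simp only: N_def floor_of_nat)
  ultimately show ?thesis by (simp add: N_def)
qed

text \<open>The left end point is itself a grid point, so rounding down does not leave the
  interval.\<close>

lemma grid_in: assumes "\<tau> > 0" "t \<in> {-\<tau>..\<tau>}" shows "grid \<tau> n t \<in> {-\<tau>..\<tau>}"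
proof -
  define N where "N = real (Suc n)"
  define k where "k = \<lfloor>N * t / \<tau>\<rfloor>"
  have N: "N > 0" by (simp add: N_def)
  have "- int (Suc n) \<le> k" using floor_range[OF assms, of n] by (simp add: k_def N_def)
  then have "- N \<le> real_of_int k" unfolding N_def by linarith
  from mult_left_mono[OF this, of \<tau>] have "- \<tau> * N \<le> \<tau> * real_of_int k" using assms(1) by simp
  then have "- \<tau> \<le> \<tau> * real_of_int k / N" using N by (simp add: pos_le_divide_eq)
  then have "- \<tau> \<le> grid \<tau> n t" by (simp add: grid_def k_def N_def)
  then show ?thesis using grid_near(1)[OF assms(1), of n t] assms(2) by auto
qed

lemma finite_grid: assumes "\<tau> > 0" shows "finite (grid \<tau> n ` {-\<tau>..\<tau>})"
proof (rule finite_subset)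
  show "grid \<tau> n ` {-\<tau>..\<tau>} \<subseteq> (\<lambda>k. \<tau> * of_int k / real (Suc n)) ` {- int (Suc n)..int (Suc n)}"
    using floor_range[OF assms] by (auto simp: grid_def)
qed simp

lemma simple_on_grid:
  assumes "\<tau> > 0" "\<And>t. t \<in> {-\<tau>..\<tau>} \<Longrightarrow> u t \<in> V"
  shows "simple_on {-\<tau>..\<tau>} V (\<lambda>t. u (grid \<tau> n t))"
  unfolding simple_on_def
proof (intro conjI allI)
  have "(\<lambda>t. u (grid \<tau> n t)) ` {-\<tau>..\<tau>} = u ` (grid \<tau> n ` {-\<tau>..\<tau>})" by (simp add: image_image)
  then show "finite ((\<lambda>t. u (grid \<tau> n t)) ` {-\<tau>..\<tau>})" using finite_grid[OF assms(1)] by simp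
  show "(\<lambda>t. u (grid \<tau> n t)) ` {-\<tau>..\<tau>} \<subseteq> V" using assms(2) grid_in[OF assms(1)] by auto
  show "{t \<in> {-\<tau>..\<tau>}. u (grid \<tau> n t) = y} \<in> sets lborel" for y
  proof -
    have "(\<lambda>t. \<lfloor>real (Suc n) * t / \<tau>\<rfloor>) -` {k. u (\<tau> * of_int k / real (Suc n)) = y} \<inter> space borel \<in> sets borel"
      by (rule measurable_sets[where A="count_space UNIV"]) measurable
    then have "{-\<tau>..\<tau>} \<inter> ((\<lambda>t. \<lfloor>real (Suc n) * t / \<tau>\<rfloor>) -` {k. u (\<tau> * of_int k / real (Suc n)) = y}) \<in> sets borel"
      by auto
    moreover have "{t \<in> {-\<tau>..\<tau>}. u (grid \<tau> n t) = y} =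
        {-\<tau>..\<tau>} \<inter> ((\<lambda>t. \<lfloor>real (Suc n) * t / \<tau>\<rfloor>) -` {k. u (\<tau> * of_int k / real (Suc n)) = y})"
      by (auto simp: grid_def)
    ultimately show ?thesis by simp
  qed
  have "emeasure lborel {t \<in> {-\<tau>..\<tau>}. u (grid \<tau> n t) \<noteq> (\<lambda>_. 0)} \<le> emeasure lborel {-\<tau>..\<tau>}"
    by (rule emeasure_mono) auto
  also have "\<dots> < \<infinity>" using assms(1) by simp
  finally show "emeasure lborel {t \<in> {-\<tau>..\<tau>}. u (grid \<tau> n t) \<noteq> (\<lambda>_. 0)} < \<infinity>" .
qed

lemma grid_uniform:
  fixes w :: "real \<Rightarrow> 'a::real_normed_vector"
  assumes "\<tau> > 0" "continuous_on {-\<tau>..\<tau>} w" "0 < \<epsilon>"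
  shows "\<forall>\<^sub>F n in sequentially. \<forall>t\<in>{-\<tau>..\<tau>}. norm (w (grid \<tau> n t) - w t) < \<epsilon>"
proof -
  have "uniformly_continuous_on {-\<tau>..\<tau>} w" using assms(2) by (intro compact_uniformly_continuous) auto
  then obtain d where d: "d > 0" "\<And>s t. s \<in> {-\<tau>..\<tau>} \<Longrightarrow> t \<in> {-\<tau>..\<tau>} \<Longrightarrow> dist s t < d \<Longrightarrow> dist (w s) (w t) < \<epsilon>"
    using \<open>0 < \<epsilon>\<close> unfolding uniformly_continuous_on_def by metis
  have "(\<lambda>n. \<tau> / real (Suc n)) \<longlonglongrightarrow> 0"
    using tendsto_mult[OF tendsto_const[of \<tau>] LIMSEQ_inverse_real_of_nat] by (simp add: divide_inverse)
  then have "\<forall>\<^sub>F n in sequentially. \<tau> / real (Suc n) < d" using d(1) by (intro order_tendstoD) auto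
  then show ?thesis
  proof eventually_elim
    case (elim n)
    show ?case
    proof
      fix t assume t: "t \<in> {-\<tau>..\<tau>}"
      have "dist (grid \<tau> n t) t < d" using grid_near(1)[OF assms(1), of n t] grid_near(2)[OF assms(1), of t n] elim by (simp add: dist_real_def)
      from d(2)[OF grid_in[OF assms(1) t] t this] show "norm (w (grid \<tau> n t) - w t) < \<epsilon>" by (simp add: dist_norm)
    qed
  qed
qed

text \<open>The values of \<open>u\<close> carry only a seminorm; the curve \<open>w\<close> in a
  genuine normed space supplies the uniform continuity that makes the step functions converge. It is
  used for \<open>W12\<close> as well as for its dual.\<close>

lemma strongly_measurable_continuous:
  fixes w :: "real \<Rightarrow> 'a::real_normed_vector"
  assumes \<tau>: "\<tau> > 0" and w: "continuous_on {-\<tau>..\<tau>} w" and u: "\<And>t. t \<in> {-\<tau>..\<tau>} \<Longrightarrow> u t \<in> V"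
    and N: "\<And>s t. s \<in> {-\<tau>..\<tau>} \<Longrightarrow> t \<in> {-\<tau>..\<tau>} \<Longrightarrow> \<bar>N (\<lambda>p. u s p - u t p)\<bar> \<le> C * norm (w s - w t)"
  shows "strongly_measurable_on {-\<tau>..\<tau>} V N u"
  unfolding strongly_measurable_on_def
proof (intro conjI exI allI AE_I2 impI)
  show "u t \<in> V" if "t \<in> {-\<tau>..\<tau>}" for t using u that .
  show "simple_on {-\<tau>..\<tau>} V (\<lambda>t. u (grid \<tau> n t))" for n by (rule simple_on_grid[OF \<tau> u])
  fix t assume t: "t \<in> {-\<tau>..\<tau>}"
  show "(\<lambda>n. N (\<lambda>p. u (grid \<tau> n t) p - u t p)) \<longlonglongrightarrow> 0"
  proof (rule tendstoI)
    fix \<epsilon> :: real assume "0 < \<epsilon>"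
    define \<delta> where "\<delta> = \<epsilon> / (\<bar>C\<bar> + 1)"
    have \<delta>: "0 < \<delta>" "\<bar>C\<bar> * \<delta> < \<epsilon>"
      using \<open>0 < \<epsilon>\<close> by (simp_all add: \<delta>_def field_simps add_pos_nonneg)
    show "\<forall>\<^sub>F n in sequentially. dist (N (\<lambda>p. u (grid \<tau> n t) p - u t p)) 0 < \<epsilon>"
      using grid_uniform[OF \<tau> w \<delta>(1)]
    proof eventually_elim
      case (elim n)
      have "\<bar>N (\<lambda>p. u (grid \<tau> n t) p - u t p)\<bar> \<le> C * norm (w (grid \<tau> n t) - w t)"
        by (rule N[OF grid_in[OF \<tau> t] t])
      also have "\<dots> \<le> \<bar>C\<bar> * \<delta>"
        using elim t by (intro mult_mono) (auto simp: less_imp_le)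
      finally show ?case using \<delta>(2) by (simp add: dist_real_def)
    qed
  qed
qed

lemma strongly_measurable_dual:
  assumes \<tau>: "\<tau> > 0" and w: "continuous_on {-\<tau>..\<tau>} w"
    and F: "\<And>t v. t \<in> {-\<tau>..\<tau>} \<Longrightarrow> v \<in> W12 \<Longrightarrow> F t v = dpair (w t) (emb v)"
  shows "strongly_measurable_on {-\<tau>..\<tau>} W12_dual norm_W12_dual F"
proof (rule strongly_measurable_continuous[OF \<tau> w])
  show "F t \<in> W12_dual" if "t \<in> {-\<tau>..\<tau>}" for t by (rule W12_dual_I[OF F[OF that]])
  show "\<bar>norm_W12_dual (\<lambda>p. F s p - F t p)\<bar> \<le> 4 * norm (w s - w t)" if "s \<in> {-\<tau>..\<tau>}" "t \<in> {-\<tau>..\<tau>}" for s t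
    using norm_W12_dual_dpair[of "\<lambda>p. F s p - F t p" "w s - w t"] that by (simp add: F dpair.diff_left)
qed

lemma Linf_dual:
  assumes \<tau>: "\<tau> > 0" and w: "continuous_on {-\<tau>..\<tau>} w"
    and F: "\<And>t v. t \<in> {-\<tau>..\<tau>} \<Longrightarrow> v \<in> W12 \<Longrightarrow> F t v = dpair (w t) (emb v)"
  shows "F \<in> Linf_on {-\<tau>..\<tau>} W12_dual norm_W12_dual"
proof -
  have "bounded (w ` {-\<tau>..\<tau>})" using w by (intro compact_imp_bounded compact_continuous_image) auto
  then obtain B where "\<forall>t\<in>{-\<tau>..\<tau>}. norm (w t) \<le> B" by (auto simp: bounded_iff)
  then have B: "norm (w t) \<le> B" if "t \<in> {-\<tau>..\<tau>}" for t using that by blast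
  have "norm_W12_dual (F t) \<le> 4 * B" if "t \<in> {-\<tau>..\<tau>}" for t
    using norm_W12_dual_dpair(2)[OF F[OF that]] B[OF that] by simp
  then show ?thesis
    unfolding Linf_on_def using strongly_measurable_dual[OF \<tau> w F] by (auto intro!: exI[of _ "4 * B"])
qed

text \<open>Evaluated at a fixed \<open>v\<close>, the integral of a simple function is an ordinary
  scalar integral and can be compared with that of the limit.\<close>

lemma simple_integral_on_eq:
  assumes s: "simple_on I V s" and I: "emeasure lborel I < \<infinity>" "I \<in> sets borel"
  shows "integrable lborel (\<lambda>t. indicator I t *\<^sub>R s t v)"
    "simple_integral_on I s v = (LINT t|lborel. indicator I t *\<^sub>R s t v)"
proof -
  have fin: "finite (s ` I)" and m: "\<And>y. {t\<in>I. s t = y} \<in> sets lborel" using s by (auto simp: simple_on_def)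
  have fm: "emeasure lborel {t\<in>I. s t = y} < \<infinity>" for y
    by (rule le_less_trans[OF emeasure_mono I(1)]) (use I in auto)
  have eq: "(\<lambda>t. indicator I t *\<^sub>R s t v) = (\<lambda>t. \<Sum>y\<in>s ` I. of_real (indicator {t\<in>I. s t = y} t) * y v)"
  proof
    fix t
    have "(\<Sum>y\<in>s ` I. of_real (indicator {t\<in>I. s t = y} t) * y v) = (\<Sum>y\<in>s ` I. if y = s t then indicator I t *\<^sub>R s t v else 0)"
      by (rule sum.cong) (auto simp: indicator_def)
    then show "indicator I t *\<^sub>R s t v = (\<Sum>y\<in>s ` I. of_real (indicator {t\<in>I. s t = y} t) * y v)"
      using fin by (auto simp: indicator_def)
  qed
  have int: "integrable lborel (\<lambda>t. of_real (indicator {t\<in>I. s t = y} t) * y v)" for y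
    using m[of y] fm[of y] by (intro integrable_mult_left integrable_of_real integrable_real_indicator)
  show "integrable lborel (\<lambda>t. indicator I t *\<^sub>R s t v)"
    unfolding eq by (intro Bochner_Integration.integrable_sum int)
  have "(LINT t|lborel. of_real (indicator {t\<in>I. s t = y} t) * y v) = of_real (measure lborel {t\<in>I. s t = y}) * y v" for y
    using m[of y] by simp
  then show "simple_integral_on I s v = (LINT t|lborel. indicator I t *\<^sub>R s t v)"
    unfolding eq simple_integral_on_def by (subst Bochner_Integration.integral_sum) (simp_all only: int)
qed

text \<open>The grid step functions serve in every clause. Uniform continuity of \<open>w\<close>
  gives an error of at most 4 epsilon at each time, over an interval of length 2 \<tau>, uniformly
  for \<open>v\<close> in the unit ball of \<open>W12\<close>.\<close>

lemma has_bochner_integral_dual: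
  assumes \<tau>: "\<tau> > 0" and w: "continuous_on {-\<tau>..\<tau>} w"
    and F: "\<And>t v. t \<in> {-\<tau>..\<tau>} \<Longrightarrow> v \<in> W12 \<Longrightarrow> F t v = dpair (w t) (emb v)"
    and y: "\<And>v. v \<in> W12 \<Longrightarrow> y v = dpair (integral {-\<tau>..\<tau>} w) (emb v)"
  shows "has_bochner_integral_on {-\<tau>..\<tau>} W12_dual norm_W12_dual F y"
  unfolding has_bochner_integral_on_def
proof (intro conjI exI allI)
  let ?I = "{-\<tau>..\<tau>}" and ?s = "\<lambda>n t. F (grid \<tau> n t)"
  show "strongly_measurable_on ?I W12_dual norm_W12_dual F" by (rule strongly_measurable_dual[OF \<tau> w F])
  show "y \<in> W12_dual" by (rule W12_dual_I[OF y])
  show simp: "simple_on ?I W12_dual (?s n)" for n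
    by (rule simple_on_grid[OF \<tau>, where u=F]) (rule W12_dual_I[OF F])
  show "(\<lambda>n. \<integral>\<^sup>+ t\<in>?I. ennreal (norm_W12_dual (\<lambda>p. F t p - ?s n t p)) \<partial>lborel) \<longlonglongrightarrow> 0"
  proof (rule tendsto_zero_ennreal)
    fix r :: real assume r: "0 < r"
    \<comment> \<open>With this choice the total error 8 \<tau> \<epsilon> is half of
      \<open>r\<close>.\<close>
    define \<epsilon> where "\<epsilon> = r / (16 * \<tau>)"
    have \<epsilon>: "0 < \<epsilon>" using r \<tau> by (simp add: \<epsilon>_def)
    show "\<forall>\<^sub>F n in sequentially. (\<integral>\<^sup>+ t\<in>?I. ennreal (norm_W12_dual (\<lambda>p. F t p - ?s n t p)) \<partial>lborel) < ennreal r"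
      using grid_uniform[OF \<tau> w \<epsilon>]
    proof eventually_elim
      case (elim n)
      have "(\<integral>\<^sup>+ t\<in>?I. ennreal (norm_W12_dual (\<lambda>p. F t p - ?s n t p)) \<partial>lborel) \<le> (\<integral>\<^sup>+ t\<in>?I. ennreal (4 * \<epsilon>) \<partial>lborel)"
      proof (rule nn_integral_mono)
        fix t
        show "ennreal (norm_W12_dual (\<lambda>p. F t p - ?s n t p)) * indicator ?I t \<le> ennreal (4 * \<epsilon>) * indicator ?I t"
        proof (cases "t \<in> ?I")
          case True
          have "norm_W12_dual (\<lambda>p. F t p - ?s n t p) \<le> 4 * norm (w t - w (grid \<tau> n t))"
            by (rule norm_W12_dual_dpair(2)) (simp add: F grid_in[OF \<tau> True, simplified] True[simplified] dpair.diff_left)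
          also have "\<dots> \<le> 4 * \<epsilon>" using elim True by (auto simp: norm_minus_commute less_imp_le)
          finally show ?thesis using True by (simp add: ennreal_leI)
        qed simp
      qed
      also have "\<dots> = ennreal (4 * \<epsilon>) * emeasure lborel ?I" by (rule nn_integral_cmult_indicator) simp
      also have "emeasure lborel ?I = ennreal (2 * \<tau>)" using \<tau> by simp
      also have "ennreal (4 * \<epsilon>) * ennreal (2 * \<tau>) = ennreal (4 * \<epsilon> * (2 * \<tau>))"
        using \<tau> \<epsilon> by (intro ennreal_mult[symmetric]) auto
      also have "\<dots> < ennreal r" using \<tau> r by (intro ennreal_lessI) (simp_all add: \<epsilon>_def)
      finally show ?case .
    qed
  qed
  show "(\<lambda>n. norm_W12_dual (\<lambda>p. simple_integral_on ?I (?s n) p - y p)) \<longlonglongrightarrow> 0"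
  proof (rule tendstoI)
    fix r :: real assume r: "0 < r"
    define \<epsilon> where "\<epsilon> = r / (16 * \<tau>)"
    have \<epsilon>: "0 < \<epsilon>" using r \<tau> by (simp add: \<epsilon>_def)
    show "\<forall>\<^sub>F n in sequentially. dist (norm_W12_dual (\<lambda>p. simple_integral_on ?I (?s n) p - y p)) 0 < r"
      using grid_uniform[OF \<tau> w \<epsilon>]
    proof eventually_elim
      case (elim n)
      have "cmod (simple_integral_on ?I (?s n) v - y v) \<le> (8 * \<tau> * \<epsilon>) * norm_W12 v" if v: "v \<in> W12" for v
      proof -
        have I: "emeasure lborel ?I < \<infinity>" "?I \<in> sets borel" using \<tau> by auto
        note si = simple_integral_on_eq[OF simp I, of n v]
        have cont: "continuous_on ?I (\<lambda>t. dpair (w t) (emb v))"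
          by (intro bounded_linear.continuous_on[OF dpair.bounded_linear_left w])
        then have set: "set_integrable lborel ?I (\<lambda>t. dpair (w t) (emb v))"
          by (rule borel_integrable_atLeastAtMost')
        have "y v = integral ?I (\<lambda>t. dpair (w t) (emb v))"
          using integral_linear[OF integrable_continuous_real[OF w] dpair.bounded_linear_left[of "emb v"]]
          by (simp add: y v comp_def)
        also have "\<dots> = (LINT t|lborel. indicator ?I t *\<^sub>R dpair (w t) (emb v))"
          using set_borel_integral_eq_integral(2)[OF set] by (simp add: set_lebesgue_integral_def)
        finally have "simple_integral_on ?I (?s n) v - y v =
            (LINT t|lborel. indicator ?I t *\<^sub>R ?s n t v - indicator ?I t *\<^sub>R dpair (w t) (emb v))"
          using si set by (simp add: set_integrable_def)
        also have "cmod \<dots> \<le> (LINT t|lborel. indicator ?I t * (4 * \<epsilon> * norm (emb v)))"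
        proof (rule order_trans[OF integral_norm_bound integral_mono])
          show "integrable lborel (\<lambda>t. cmod (indicator ?I t *\<^sub>R ?s n t v - indicator ?I t *\<^sub>R dpair (w t) (emb v)))"
            using si(1) set by (intro integrable_norm Bochner_Integration.integrable_diff) (simp_all add: set_integrable_def)
          show "integrable lborel (\<lambda>t. indicator ?I t * (4 * \<epsilon> * norm (emb v)))"
            using I by (intro integrable_mult_left integrable_real_indicator) auto
          show "norm (indicator ?I t *\<^sub>R ?s n t v - indicator ?I t *\<^sub>R dpair (w t) (emb v))
              \<le> indicator ?I t * (4 * \<epsilon> * norm (emb v))" for t
          proof (cases "t \<in> ?I")
            case True
            have "norm (dpair (w (grid \<tau> n t) - w t) (emb v)) \<le> 4 * norm (w (grid \<tau> n t) - w t) * norm (emb v)"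
              by (rule norm_dpair_le)
            also have "\<dots> \<le> 4 * \<epsilon> * norm (emb v)"
              using elim True by (intro mult_right_mono mult_left_mono) (auto simp: less_imp_le)
            finally show ?thesis using True by (simp add: F grid_in[OF \<tau> True, simplified] v dpair.diff_left)
          qed simp
        qed
        also have "\<dots> = (8 * \<tau> * \<epsilon>) * norm_W12 v" using \<tau> by (simp add: norm_W12_emb v)
        finally show ?thesis .
      qed
      from norm_W12_dual_le[OF this] have "\<bar>norm_W12_dual (\<lambda>p. simple_integral_on ?I (?s n) p - y p)\<bar> \<le> 8 * \<tau> * \<epsilon>"
        using \<tau> \<epsilon> by simp
      also have "\<dots> < r" using \<tau> r by (simp add: \<epsilon>_def)
      finally show ?case by simp
    qed
  qed
qed

section \<open>The frictional Newton-Schroedinger equation\<close>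

definition schr_pair :: "real \<Rightarrow> real \<Rightarrow> l2 \<times> (l2^3) \<Rightarrow> l2 \<times> (l2^3)" where
  "schr_pair a t w = (schr a t (fst w), \<chi> j. schr a t (snd w $ j))"

lemma fst_schr_pair: "fst (schr_pair a t w) = schr a t (fst w)"
  and snd_schr_pair: "snd (schr_pair a t w) $ j = schr a t (snd w $ j)"
  by (simp_all add: schr_pair_def)

lemma norm_schr_pair [simp]: "norm (schr_pair a t w) = norm w"
  by (simp add: schr_pair_def norm_prod_def norm_vec_def)

lemma schr_pair_diff: "schr_pair a t (w - w') = schr_pair a t w - schr_pair a t w'"
  by (simp add: schr_pair_def prod_eq_iff vec_eq_iff sch.U_diff)

lemma schr_pair_sobolev: "w \<in> sobolev \<Longrightarrow> schr_pair a t w \<in> sobolev"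
  by (simp add: sobolev_def schr_pair_def gen_schr)

lemma schr_pair_0: "schr_pair a 0 w = w"
  by (simp add: schr_pair_def prod_eq_iff vec_eq_iff)

lemma tendsto_schr_pair:
  fixes z :: "real \<Rightarrow> l2 \<times> (l2^3)"
  assumes "(z \<longlongrightarrow> y) (at t within I)" "(f \<longlongrightarrow> s) (at t within I)"
  shows "((\<lambda>r. schr_pair a (f r) (z r)) \<longlongrightarrow> schr_pair a s y) (at t within I)"
  unfolding schr_pair_def by (intro tendsto_intros sch.tendsto_U assms)

lemma continuous_on_nonlin:
  assumes z: "continuous_on I z" "\<And>t. z t \<in> sobolev" and c: "0 \<le> c"
  shows "continuous_on I (\<lambda>t. nonlin c (z t))"
  unfolding continuous_on_def
proof
  fix t assume t: "t \<in> I"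
  define R where "R = norm (z t) + 1"
  define L where "L = c * (60 * R ^ 2 + 100 * R ^ 4)"
  have zt: "(z \<longlongrightarrow> z t) (at t within I)" using z(1) t by (simp add: continuous_on_def)
  show "((\<lambda>t. nonlin c (z t)) \<longlongrightarrow> nonlin c (z t)) (at t within I)"
  proof (rule LIM_zero_cancel, rule Lim_null_comparison)
    have "\<forall>\<^sub>F s in at t within I. norm (z s) < R"
      using tendsto_norm[OF zt] by (rule order_tendstoD) (simp add: R_def)
    then show "\<forall>\<^sub>F s in at t within I. norm (nonlin c (z s) - nonlin c (z t)) \<le> L * norm (z s - z t)"
    proof eventually_elim
      case (elim s)
      then show ?case
        unfolding L_def by (intro nonlin_Lipschitz z(2) c) (auto simp: R_def)
    qed
    have "((\<lambda>s. L * norm (z s - z t)) \<longlongrightarrow> L * norm (z t - z t)) (at t within I)"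
      by (intro tendsto_intros zt)
    then show "((\<lambda>s. L * norm (z s - z t)) \<longlongrightarrow> 0) (at t within I)" by simp
  qed
qed

lemma continuous_on_schr_pair:
  fixes z :: "real \<Rightarrow> l2 \<times> (l2^3)"
  assumes "continuous_on I z" "continuous_on I f" shows "continuous_on I (\<lambda>t. schr_pair a (f t) (z t))"
  using assms unfolding continuous_on_def by (auto intro: tendsto_schr_pair)

text \<open>In the interaction picture \<open>u t = schr_pair a t (z t)\<close> the equation is an ordinary differential
  equation for \<open>z\<close> with a locally Lipschitz right-hand side.\<close>

lemma mild_solution:
  assumes "0 \<le> c" "0 < M"
  obtains \<tau> where "\<tau> > 0" "\<And>w. w \<in> sobolev \<Longrightarrow> norm w \<le> M \<Longrightarrow>
    \<exists>z. continuous_on UNIV z \<and> (\<forall>t. z t \<in> sobolev) \<and> z 0 = w \<and>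
      (\<forall>t\<in>{-\<tau><..<\<tau>}. (z has_vector_derivative schr_pair a (- t) (nonlin c (schr_pair a t (z t)))) (at t))"
proof -
  \<comment> \<open>Twice the size of the data: half of the radius is left for the integral term. As
    \<open>nonlin\<close> vanishes at 0, the field is bounded by L R on this ball.\<close>
  define R where "R = 2 * M"
  define L where "L = c * (60 * R ^ 2 + 100 * R ^ 4)"
  \<comment> \<open>This ensures that \<open>\<tau> * L\<close> is at most 1/2, which yields the
    contraction and also \<open>\<tau> * (L * R) \<le> M\<close>. The summand 1 covers the case L =
    0.\<close>
  define \<tau> where "\<tau> = 1 / (2 * (L + 1))"
  have L: "0 \<le> L" using assms by (simp add: L_def)
  have \<tau>: "\<tau> > 0" "\<tau> * L \<le> 1 / 2" using L by (simp_all add: \<tau>_def field_simps)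
  have Lip: "norm (nonlin c x - nonlin c y) \<le> L * norm (x - y)"
    if "x \<in> sobolev" "y \<in> sobolev" "norm x \<le> R" "norm y \<le> R" for x y
    unfolding L_def by (rule nonlin_Lipschitz[OF that assms(1)])
  have ex: "\<exists>z. continuous_on UNIV z \<and> (\<forall>t. z t \<in> sobolev) \<and> z 0 = w \<and>
      (\<forall>t\<in>{-\<tau><..<\<tau>}. (z has_vector_derivative schr_pair a (- t) (nonlin c (schr_pair a t (z t)))) (at t))"
    if w: "w \<in> sobolev" "norm w \<le> M" for w
  proof -
    let ?f = "\<lambda>t x. schr_pair a (- t) (nonlin c (schr_pair a t x))"
    obtain z where "continuous_on UNIV z" "\<And>t. z t \<in> sobolev" "z 0 = w"
      "\<And>t. t \<in> {-\<tau><..<\<tau>} \<Longrightarrow> (z has_vector_derivative ?f t (z t)) (at t)"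
    proof (rule picard_closed_subspace[of sobolev ?f R L "L * R" w \<tau>])
      show "closed sobolev" by (rule closed_sobolev)
      show "subspace sobolev" by (simp add: subspace_def sobolev_0 sobolev_add sobolev_scaleR)
      show "?f t x \<in> sobolev" if "x \<in> sobolev" for t x by (intro schr_pair_sobolev nonlin_sobolev that)
      show "continuous_on UNIV (\<lambda>t. ?f t (z t))" if "continuous_on UNIV z" "\<And>t. z t \<in> sobolev" for z
        using that assms(1)
        by (intro continuous_on_schr_pair continuous_on_nonlin schr_pair_sobolev continuous_intros) auto
      show "norm (?f t x - ?f t y) \<le> L * norm (x - y)"
        if "x \<in> sobolev" "y \<in> sobolev" "norm x \<le> R" "norm y \<le> R" for t x y
        using Lip[of "schr_pair a t x" "schr_pair a t y"] that by (simp add: schr_pair_sobolev flip: schr_pair_diff)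
      show "norm (?f t x) \<le> L * R" if "x \<in> sobolev" "norm x \<le> R" for t x
      proof -
        have "norm (?f t x) \<le> L * norm x"
          using Lip[of "schr_pair a t x" 0] that assms(2) by (simp add: schr_pair_sobolev sobolev_0 nonlin_0 R_def)
        also have "\<dots> \<le> L * R" by (intro mult_left_mono that L)
        finally show ?thesis .
      qed
      show "norm w + \<tau> * (L * R) \<le> R"
      proof -
        have "\<tau> * L * R \<le> 1 / 2 * R" using \<tau>(2) assms(2) by (intro mult_right_mono) (simp_all add: R_def)
        then have "\<tau> * (L * R) \<le> M" by (simp only: mult.assoc) (simp add: R_def)
        then show ?thesis using w(2) by (simp add: R_def)
      qed
      show "0 \<le> L * R" using L assms(2) by (simp add: R_def)
    qed (use w \<tau> L in auto)
    then show ?thesis by blast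
  qed
  from that[OF \<tau>(1) ex] show thesis .
qed

lemma pair_interaction_derivative:
  assumes z: "(\<zeta> has_vector_derivative \<zeta>') (at t)"
    and x: "\<And>j. gen (axis j 1) (\<zeta> t) (xg j)" and v: "\<And>j. gen (axis j 1) v (vg j)"
  shows "((\<lambda>s. pair (schr a s (\<zeta> s)) v) has_vector_derivative
    pair (schr a t \<zeta>') v - (\<i> * of_real a) * (\<Sum>j\<in>UNIV. pair (schr a t (xg j)) (vg j))) (at t)"
proof -
  have "((\<lambda>h. pair ((\<zeta> (t + h) - \<zeta> t) /\<^sub>R h) (schr a (t + h) v)) \<longlongrightarrow> pair \<zeta>' (schr a t v)) (at 0)"
  proof (rule bounded_bilinear.tendsto[OF bounded_bilinear_pair])
    show "((\<lambda>h. (\<zeta> (t + h) - \<zeta> t) /\<^sub>R h) \<longlongrightarrow> \<zeta>') (at 0)"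
      using z by (simp add: has_vector_derivative_iff_quotient)
    show "((\<lambda>h. schr a (t + h) v) \<longlongrightarrow> schr a t v) (at 0)"
      using sch.isCont_U by (simp add: isCont_iff)
  qed
  moreover have "((\<lambda>h. (pair (schr a (t + h) (\<zeta> t)) v - pair (schr a t (\<zeta> t)) v) /\<^sub>R h) \<longlongrightarrow>
      - (\<i> * of_real a) * (\<Sum>j\<in>UNIV. pair (schr a t (xg j)) (vg j))) (at 0)"
    using schr_weak_equation[OF x v, of a t] by (simp only: has_vector_derivative_iff_quotient)
  ultimately have "((\<lambda>h. pair ((\<zeta> (t + h) - \<zeta> t) /\<^sub>R h) (schr a (t + h) v)
      + (pair (schr a (t + h) (\<zeta> t)) v - pair (schr a t (\<zeta> t)) v) /\<^sub>R h) \<longlongrightarrow>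
      pair \<zeta>' (schr a t v) + - (\<i> * of_real a) * (\<Sum>j\<in>UNIV. pair (schr a t (xg j)) (vg j))) (at 0)"
    by (rule tendsto_add)
  moreover have "pair ((\<zeta> (t + h) - \<zeta> t) /\<^sub>R h) (schr a (t + h) v)
      + (pair (schr a (t + h) (\<zeta> t)) v - pair (schr a t (\<zeta> t)) v) /\<^sub>R h =
      (pair (schr a (t + h) (\<zeta> (t + h))) v - pair (schr a t (\<zeta> t)) v) /\<^sub>R h" for h
    by (simp add: pair_schr pair.scaleR_left pair.diff_left scaleR_diff_right)
  ultimately show ?thesis
    by (simp add: has_vector_derivative_iff_quotient pair_schr)
qed

lemma laplacian_emb:
  assumes "u \<in> W12" "v \<in> W12"
  shows "laplacian u v = - (\<Sum>j\<in>UNIV. pair (snd (emb u) $ j) (snd (emb v) $ j))"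
proof -
  have "integrable lborel (\<lambda>x. weak_gradient u x $ j * weak_gradient v x $ j)" for j
    by (intro L2_mult_integrable weak_gradient_L2 assms)
  then show ?thesis
    by (simp add: laplacian_def Bochner_Integration.integral_sum emb_def pair_abs weak_gradient_L2 assms)
qed

lemma as_dual_pair: "f \<in> L2 \<Longrightarrow> v \<in> W12 \<Longrightarrow> as_dual f v = pair (abs_l2 f) (fst (emb v))"
  by (simp add: as_dual_def pair_abs W12_L2 fst_emb)

text \<open>For fixed \<open>v\<close> the claim is scalar integration by parts. Integrals of curves
  of pairs commute with \<open>dpair\<close>, so the scalar identities assemble to an equality of
  functionals.\<close>

lemma weak_time_derivative_dual:
  assumes \<tau>: "\<tau> > 0" and w: "continuous_on {-\<tau>..\<tau>} w" "continuous_on {-\<tau>..\<tau>} w'"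
    and F: "\<And>t v. t \<in> {-\<tau>..\<tau>} \<Longrightarrow> v \<in> W12 \<Longrightarrow> F t v = dpair (w t) (emb v)"
    and F': "\<And>t v. t \<in> {-\<tau>..\<tau>} \<Longrightarrow> v \<in> W12 \<Longrightarrow> F' t v = dpair (w' t) (emb v)"
    and deriv: "\<And>t v. t \<in> {-\<tau><..<\<tau>} \<Longrightarrow> v \<in> W12 \<Longrightarrow>
        ((\<lambda>t. dpair (w t) (emb v)) has_vector_derivative dpair (w' t) (emb v)) (at t)"
  shows "has_weak_time_derivative {-\<tau>..\<tau>} W12_dual norm_W12_dual F F'"
  unfolding has_weak_time_derivative_def
proof
  let ?I = "{-\<tau>..\<tau>}"
  fix \<eta> :: "real \<Rightarrow> real" assume \<eta>: "\<eta> \<in> test_functions (interior ?I)"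
  have \<eta>': "(\<eta> has_real_derivative deriv \<eta> t) (at t)" for t
    using test_has_derivative[OF \<eta>, of t] by (metis differentiableI real_differentiable_def
        DERIV_deriv_iff_real_differentiable field_differentiable_def)
  have "frechet_derivative \<eta> (at t) 1 = deriv \<eta> t" for t
    using frechet_derivative_at[OF \<eta>'[of t, unfolded has_field_derivative_def]] by (metis mult_1_right)
  then have cd: "continuous_on ?I (deriv \<eta>)"
    using test_continuous[OF test_partial[OF \<eta>, of 1], of ?I] by simp
  have c\<eta>: "continuous_on ?I \<eta>" by (rule test_continuous[OF \<eta>])
  obtain K where K: "K \<subseteq> interior ?I" "\<And>t. t \<notin> K \<Longrightarrow> \<eta> t = 0" using test_support[OF \<eta>] by blast
  have "\<tau> \<notin> K" "- \<tau> \<notin> K" using K(1) by auto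
  \<comment> \<open>The support lies in the open interval, so the boundary terms drop out.\<close>
  then have end0: "\<eta> \<tau> = 0" "\<eta> (- \<tau>) = 0" by (simp_all add: K(2))
  define p where "p t = deriv \<eta> t *\<^sub>R w t" for t
  define q where "q t = - (\<eta> t *\<^sub>R w' t)" for t
  have cp: "continuous_on ?I p" unfolding p_def by (intro continuous_intros cd w)
  have cq: "continuous_on ?I q" unfolding q_def by (intro continuous_intros c\<eta> w)
  \<comment> \<open>The definition asks for one functional that is the integral of both curves; it
    is built from the first and shown to agree with the second on \<open>W12\<close>.\<close>
  define y where "y v = dpair (integral ?I p) (emb v)" for v
  have y2: "y v = dpair (integral ?I q) (emb v)" if v: "v \<in> W12" for v
  proof -
    let ?g = "\<lambda>t. dpair (w t) (emb v)" and ?g' = "\<lambda>t. dpair (w' t) (emb v)"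
    have "((\<lambda>t. \<eta> t *\<^sub>R ?g' t + deriv \<eta> t *\<^sub>R ?g t) has_integral \<eta> \<tau> *\<^sub>R ?g \<tau> - \<eta> (- \<tau>) *\<^sub>R ?g (- \<tau>)) ?I"
    proof (rule fundamental_theorem_of_calculus_interior[where f="\<lambda>t. \<eta> t *\<^sub>R ?g t"])
      show "- \<tau> \<le> \<tau>" using \<tau> by simp
      show "continuous_on ?I (\<lambda>t. \<eta> t *\<^sub>R ?g t)"
        by (intro continuous_intros c\<eta> bounded_linear.continuous_on[OF dpair.bounded_linear_left w(1)])
      show "((\<lambda>t. \<eta> t *\<^sub>R ?g t) has_vector_derivative \<eta> t *\<^sub>R ?g' t + deriv \<eta> t *\<^sub>R ?g t) (at t)"
        if "t \<in> {-\<tau><..<\<tau>}" for t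
        by (rule has_vector_derivative_scaleR[OF \<eta>' deriv[OF that v]])
    qed
    then have int: "integral ?I (\<lambda>t. dpair (p t - q t) (emb v)) = 0"
      by (simp add: end0 integral_unique p_def q_def dpair.add_left dpair.scaleR_left dpair.minus_left dpair.diff_left add.commute)
    have "integral ?I (\<lambda>t. dpair (p t - q t) (emb v)) = dpair (integral ?I (\<lambda>t. p t - q t)) (emb v)"
      using integral_linear[OF integrable_continuous_real[OF continuous_on_diff[OF cp cq]] dpair.bounded_linear_left[of "emb v"]]
      by (simp add: comp_def)
    also have "integral ?I (\<lambda>t. p t - q t) = integral ?I p - integral ?I q"
      by (rule Henstock_Kurzweil_Integration.integral_diff) (intro integrable_continuous_real cp cq)+
    finally show ?thesis using int by (simp add: y_def dpair.diff_left)
  qed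
  show "\<exists>y. has_bochner_integral_on ?I W12_dual norm_W12_dual (\<lambda>t p. of_real (deriv \<eta> t) * F t p) y \<and>
      has_bochner_integral_on ?I W12_dual norm_W12_dual (\<lambda>t p. - (of_real (\<eta> t) * F' t p)) y"
  proof (intro exI conjI)
    show "has_bochner_integral_on ?I W12_dual norm_W12_dual (\<lambda>t p. of_real (deriv \<eta> t) * F t p) y"
      by (rule has_bochner_integral_dual[OF \<tau> cp])
         (simp_all add: F p_def y_def dpair.scaleR_left scaleR_conv_of_real)
    show "has_bochner_integral_on ?I W12_dual norm_W12_dual (\<lambda>t p. - (of_real (\<eta> t) * F' t p)) y"
      by (rule has_bochner_integral_dual[OF \<tau> cq])
         (simp_all add: F' q_def y2 dpair.scaleR_left dpair.minus_left scaleR_conv_of_real)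
  qed
qed

theorem theorem3p3:
  fixes hbar m G M :: real
  assumes "hbar > 0" and "m > 0" and "G > 0" and "M > 0"
  shows "\<exists>T>0. \<forall>\<phi>\<in>W12. norm_W12 \<phi> \<le> M \<longrightarrow>
           (\<exists>\<psi>. weak_solution hbar m G {-T..T} \<phi> \<psi>)"
proof -
  define a where "a = hbar / (2 * m)"
  define c where "c = 4 * pi * (G * m\<^sup>2 / hbar)"
  have c: "0 \<le> c" using assms by (simp add: c_def)
  \<comment> \<open>The time is fixed before the initial value, so one interval serves all data of
    norm at most \<open>M\<close>.\<close>
  obtain \<tau> where \<tau>: "\<tau> > 0" and sol: "\<And>w. w \<in> sobolev \<Longrightarrow> norm w \<le> M \<Longrightarrow>
    \<exists>z. continuous_on UNIV z \<and> (\<forall>t. z t \<in> sobolev) \<and> z 0 = w \<and>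
      (\<forall>t\<in>{-\<tau><..<\<tau>}. (z has_vector_derivative schr_pair a (- t) (nonlin c (schr_pair a t (z t)))) (at t))"
    using mild_solution[OF c assms(4)] by blast
  have "\<exists>\<psi>. weak_solution hbar m G {-\<tau>..\<tau>} \<phi> \<psi>" if \<phi>: "\<phi> \<in> W12" "norm_W12 \<phi> \<le> M" for \<phi>
  proof -
    let ?I = "{-\<tau>..\<tau>}"
    obtain z where z: "continuous_on UNIV z" "\<And>t. z t \<in> sobolev" "z 0 = emb \<phi>"
      and z': "\<And>t. t \<in> {-\<tau><..<\<tau>} \<Longrightarrow> (z has_vector_derivative schr_pair a (- t) (nonlin c (schr_pair a t (z t)))) (at t)"
      using sol[OF emb_sobolev[OF \<phi>(1)]] \<phi> norm_W12_emb[OF \<phi>(1)] by auto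
    define u where "u t = schr_pair a t (z t)" for t
    have uX: "u t \<in> sobolev" for t unfolding u_def by (intro schr_pair_sobolev z)
    have uc: "continuous_on J u" for J
      unfolding u_def by (intro continuous_on_schr_pair continuous_on_subset[OF z(1)] continuous_intros) auto
    define \<psi> where "\<psi> t = rep_l2 (fst (u t))" for t
    have \<psi>: "\<psi> t \<in> W12" "emb (\<psi> t) = u t" for t
      unfolding \<psi>_def by (intro W12_rep uX)+
    \<comment> \<open>As a functional the state acts through its function component alone, so the
      gradient slot is zero. In \<open>w'\<close> the gradient slot carries the Laplacian after one
      integration by parts, hence the minus sign.\<close>
    define w where "w t = (fst (u t), 0 :: l2^3)" for t
    define w' where "w' t = (fst (nonlin c (u t)), \<chi> j. cmul (- (\<i> * of_real a)) (snd (u t) $ j))" for t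
    have wc: "continuous_on ?I w" unfolding w_def by (intro continuous_intros uc)
    have wc': "continuous_on ?I w'"
      unfolding w'_def
      by (intro continuous_intros bounded_linear.continuous_on[OF bounded_linear_cmul]
          continuous_on_nonlin uc uX c)
    \<comment> \<open>The candidate derivative is the equation solved for it, so the equation holds
      at every time and for every \<open>v\<close>; what remains is that it is the weak time
      derivative.\<close>
    define \<psi>' where "\<psi>' t v = - \<i> * (- of_real a * laplacian (\<psi> t) v
        + \<i> * of_real c * as_dual (g1 (\<psi> t)) v - \<i> * of_real c * as_dual (g2 (\<psi> t)) v)" for t v
    have \<psi>_dual: "as_dual (\<psi> t) v = dpair (w t) (emb v)" if "v \<in> W12" for t v
      by (simp add: as_dual_pair W12_L2 \<psi> that dpair_def w_def pair.zero_left) (simp add: \<psi>_def)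
    have \<psi>'_dual: "\<psi>' t v = dpair (w' t) (emb v)" if v: "v \<in> W12" for t v
    proof -
      let ?f = "fst (u t)"
      let ?t = "tau ?f ?f ?f"
      have 1: "as_dual (g1 (\<psi> t)) v = pair ?t (fst (emb v))"
        unfolding \<psi>_def using g1_tau[OF uX] v by (simp add: as_dual_pair)
      have 2: "as_dual (g2 (\<psi> t)) v = pair (inner ?t ?f *\<^sub>R ?f) (fst (emb v))"
        unfolding \<psi>_def using g2_tau[OF uX] v by (simp add: as_dual_pair)
      have 3: "fst (nonlin c (u t)) = c *\<^sub>R (?t - inner ?t ?f *\<^sub>R ?f)"
        by (simp add: nonlin_def Tri_def)
      have "\<psi>' t v = - (\<i> * of_real a) * (\<Sum>j\<in>UNIV. pair (snd (u t) $ j) (snd (emb v) $ j))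
          + of_real c * (pair ?t (fst (emb v)) - pair (inner ?t ?f *\<^sub>R ?f) (fst (emb v)))"
        unfolding \<psi>'_def laplacian_emb[OF \<psi>(1) v] \<psi>(2) 1 2 by (simp add: algebra_simps)
      also have "\<dots> = dpair (w' t) (emb v)"
        by (simp add: dpair_def w'_def 3 pair.scaleR_left pair.diff_left pair_cmul_left scaleR_conv_of_real
            sum_distrib_left sum_negf right_diff_distrib)
      finally show ?thesis .
    qed
    have deriv: "((\<lambda>t. dpair (w t) (emb v)) has_vector_derivative dpair (w' t) (emb v)) (at t)"
      if t: "t \<in> {-\<tau><..<\<tau>}" and v: "v \<in> W12" for t v
    proof -
      have "((\<lambda>t. fst (z t)) has_vector_derivative fst (schr_pair a (- t) (nonlin c (u t)))) (at t)"
        unfolding u_def by (rule bounded_linear.has_vector_derivative[OF bounded_linear_fst z'[OF t]])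
      \<comment> \<open>The backward evolution in the field of \<open>z\<close> cancels against the
        forward evolution, leaving the nonlinearity at \<open>u t\<close>.\<close>
      from pair_interaction_derivative[OF this sobolev_gen[OF z(2)] sobolev_gen[OF emb_sobolev[OF v]], of a]
      show ?thesis
        by (simp add: dpair_def w_def w'_def u_def fst_schr_pair snd_schr_pair sch.U_inverse pair_cmul_left pair.zero_left
            sum_negf flip: sum_distrib_left)
    qed
    have "\<psi> \<in> Linf_on ?I W12 norm_W12"
    proof -
      have "bounded (u ` ?I)" by (intro compact_imp_bounded compact_continuous_image uc) auto
      then obtain B where "\<forall>t\<in>?I. norm (u t) \<le> B" by (auto simp: bounded_iff)
      then have "\<forall>t\<in>?I. norm_W12 (\<psi> t) \<le> B" by (simp add: norm_W12_emb \<psi>)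
      moreover have "strongly_measurable_on ?I W12 norm_W12 \<psi>"
        by (rule strongly_measurable_continuous[OF \<tau> uc, where C=1])
           (simp_all add: \<psi> norm_W12_emb W12_diff)
      ultimately show ?thesis
        unfolding Linf_on_def by (intro CollectI conjI exI[of _ B] AE_I2) auto
    qed
    moreover have "W1inf_on ?I W12_dual norm_W12_dual (\<lambda>t. as_dual (\<psi> t)) \<psi>'"
      unfolding W1inf_on_def
      by (intro conjI Linf_dual[OF \<tau> wc] Linf_dual[OF \<tau> wc'] weak_time_derivative_dual[OF \<tau> wc wc'] \<psi>_dual \<psi>'_dual deriv)
    moreover have "\<i> * \<psi>' t v = - of_real (hbar / (2 * m)) * laplacian (\<psi> t) v
             + \<i> * of_real (4 * pi * (G * m\<^sup>2 / hbar)) * as_dual (g1 (\<psi> t)) v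
             - \<i> * of_real (4 * pi * (G * m\<^sup>2 / hbar)) * as_dual (g2 (\<psi> t)) v" for t v
      unfolding \<psi>'_def a_def[symmetric] c_def[symmetric] by simp
    moreover have "has_value_at ?I \<psi> 0 \<phi>"
      unfolding has_value_at_def
    \<comment> \<open>The constructed solution is norm continuous in time and thus its own
      continuous representative.\<close>
    proof (intro exI[of _ \<psi>] conjI ballI)
      show "\<psi> t \<in> L2" for t by (simp add: W12_L2 \<psi>)
      show "((\<lambda>s. norm_L2 (\<lambda>x. \<psi> s x - \<psi> t x)) \<longlongrightarrow> 0) (at t within ?I)" if "t \<in> ?I" for t
      proof -
        have "(u \<longlongrightarrow> u t) (at t within ?I)" using uc[of ?I] that by (simp add: continuous_on_def)
        then have "((\<lambda>s. norm (fst (u s) - fst (u t))) \<longlongrightarrow> norm (fst (u t) - fst (u t))) (at t within ?I)"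
          by (intro tendsto_intros)
        moreover have "norm_L2 (\<lambda>x. \<psi> s x - \<psi> t x) = norm (fst (u s) - fst (u t))" for s
          unfolding \<psi>_def by (simp add: abs_diff L2_diff flip: norm_abs)
        ultimately show ?thesis by simp
      qed
      have "u 0 = emb \<phi>" by (simp add: u_def schr_pair_0 z)
      then show "AE x in lborel. \<psi> 0 x = \<phi> x"
        using rep_abs[OF W12_L2[OF \<phi>(1)]] by (simp add: \<psi>_def fst_emb)
    qed simp
    ultimately show ?thesis unfolding weak_solution_def by blast
  qed
  then show ?thesis using \<tau> by blast
qed

end
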